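(* Let $p>5$, $m=\frac{p-1}{2}$ and $s_c=\frac32-\frac1m$. There is a constant $c>0$ depending only on $p$ such that the following holds. Let $w_L$ be a radial solution of the linear wave equation $\partial_{tt}w_L-\Delta w_L=0$ on $\mathbb{R}\times\mathbb{R}^3$ with initial data in $\dot H^{s_c}(\mathbb{R}^3)\times\dot H^{s_c-1}(\mathbb{R}^3)$, let $R>0$, and let $$E_{m,R}(t)=\int_{R+|t|}^\infty|\partial_t(rw_L)(t,r)|^m+|\partial_r(rw_L)(t,r)|^m\,dr .$$ Then either $E_{m,R}(t)\ge c\,E_{m,R}(0)$ for all $t\ge0$, or $E_{m,R}(t)\ge c\,E_{m,R}(0)$ for all $t\le0$.
   Context: All functions are real-valued and radial in the space variable, $r=|x|$. The solution of the linear wave equation with data $(w_0,w_1)$ is $w_L(t)=\cos(t\sqrt{-\Delta})w_0+\frac{\sin(t\sqrt{-\Delta})}{\sqrt{-\Delta}}w_1$. *)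

theory Defs
  imports "HOL-Analysis.Analysis"
begin

primrec iter_deriv ::
  "'a list \<Rightarrow> ('a::euclidean_space \<Rightarrow> complex) \<Rightarrow> 'a \<Rightarrow> complex" where
  "iter_deriv [] f = f"
| "iter_deriv (v # vs) f = (\<lambda>x. frechet_derivative (iter_deriv vs f) (at x) v)"

definition schwartz :: "('a::euclidean_space \<Rightarrow> complex) \<Rightarrow> bool" where
  "schwartz f \<longleftrightarrow>
     (\<forall>vs\<in>lists Basis. iter_deriv vs f differentiable_on UNIV \<and>
        (\<forall>k::nat. bounded (range (\<lambda>x. (1 + norm x) ^ k *\<^sub>R iter_deriv vs f x))))"

definition fourier :: "('a::euclidean_space \<Rightarrow> complex) \<Rightarrow> 'a \<Rightarrow> complex" where
  "fourier f \<xi> = (LINT x|lborel. exp (- (\<i> * of_real (x \<bullet> \<xi>))) * f x)"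

(* The tempered distribution given by the function f has Fourier transform given by
   the function g. Integrability against every Schwartz function makes f and g locally
   integrable and makes them tempered distributions. *)
definition has_fourier ::
  "('a::euclidean_space \<Rightarrow> complex) \<Rightarrow> ('a \<Rightarrow> complex) \<Rightarrow> bool" where
  "has_fourier f g \<longleftrightarrow>
     (\<forall>\<phi>. schwartz \<phi> \<longrightarrow>
        integrable lborel (\<lambda>x. f x * fourier \<phi> x) \<and>
        integrable lborel (\<lambda>\<xi>. g \<xi> * \<phi> \<xi>) \<and>
        (LINT x|lborel. f x * fourier \<phi> x) = (LINT \<xi>|lborel. g \<xi> * \<phi> \<xi>))"

(* Membership in the homogeneous Sobolev space of order s on R^3. It is used only for
   0 <= s < 3/2, where every element of that space is a function (Sobolev embedding), so
   that no distributions other than functions are needed. *)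
definition in_hdot :: "real \<Rightarrow> (real^3 \<Rightarrow> real) \<Rightarrow> bool" where
  "in_hdot s f \<longleftrightarrow>
     (\<exists>g. has_fourier (\<lambda>x. of_real (f x)) g \<and>
          integrable lborel (\<lambda>\<xi>. (norm \<xi> powr s * norm (g \<xi>))\<^sup>2))"

(* w(t) = cos(t sqrt(-Laplacian)) w0 + sin(t sqrt(-Laplacian))/sqrt(-Laplacian) w1, as
   Fourier multipliers; the equality is one of functions up to null sets. The value of
   the second symbol at 0 is irrelevant. *)
definition linear_wave ::
  "(real^3 \<Rightarrow> real) \<Rightarrow> (real^3 \<Rightarrow> real) \<Rightarrow> (real \<Rightarrow> real^3 \<Rightarrow> real) \<Rightarrow> bool" where
  "linear_wave w0 w1 w \<longleftrightarrow>
     (\<exists>g0 g1. has_fourier (\<lambda>x. of_real (w0 x)) g0 \<and>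
              has_fourier (\<lambda>x. of_real (w1 x)) g1 \<and>
              (\<forall>t. has_fourier (\<lambda>x. of_real (w t x))
                     (\<lambda>\<xi>. of_real (cos (t * norm \<xi>)) * g0 \<xi>
                        + of_real (sin (t * norm \<xi>) / norm \<xi>) * g1 \<xi>)))"

abbreviation radial_fun :: "(real \<Rightarrow> real) \<Rightarrow> real^3 \<Rightarrow> real" where
  "radial_fun u \<equiv> (\<lambda>x. u (norm x))"

(* Smooth functions with compact support in the open half-line r > 0. *)
definition test_fun :: "(real \<Rightarrow> real) \<Rightarrow> bool" where
  "test_fun \<psi> \<longleftrightarrow>
     (\<forall>k x. (deriv ^^ k) \<psi> field_differentiable at x) \<and>
     (\<exists>a>0. \<exists>b. \<forall>r. r \<notin> {a..b} \<longrightarrow> \<psi> r = 0)"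

definition loc_integrable :: "(real \<Rightarrow> real) \<Rightarrow> bool" where
  "loc_integrable f \<longleftrightarrow> (\<forall>a>0. \<forall>b. set_integrable lborel {a..b} f)"

(* Elements of the homogeneous Sobolev spaces are defined up to null sets and
   the solution need not be differentiable, so both partial derivatives of U(t,r) are
   taken in the sense of distributions on r > 0 at a fixed time t: dist_dr is the weak
   derivative of U(t,.), and dist_dt is the derivative of the distribution-valued map
   t |-> U(t,.). Either is determined up to a null set. *)
definition dist_dr :: "(real \<Rightarrow> real \<Rightarrow> real) \<Rightarrow> real \<Rightarrow> real \<Rightarrow> real" where
  "dist_dr U t =
     (SOME z. loc_integrable z \<and>
        (\<forall>\<psi>. test_fun \<psi> \<longrightarrow>
           (LINT r|lborel. U t r * deriv \<psi> r) = - (LINT r|lborel. z r * \<psi> r)))"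

definition dist_dt :: "(real \<Rightarrow> real \<Rightarrow> real) \<Rightarrow> real \<Rightarrow> real \<Rightarrow> real" where
  "dist_dt U t =
     (SOME v. loc_integrable v \<and>
        (\<forall>\<psi>. test_fun \<psi> \<longrightarrow>
           ((\<lambda>\<tau>. LINT r|lborel. U \<tau> r * \<psi> r)
              has_real_derivative (LINT r|lborel. v r * \<psi> r)) (at t)))"

definition ext_energy :: "real \<Rightarrow> real \<Rightarrow> (real \<Rightarrow> real \<Rightarrow> real) \<Rightarrow> real \<Rightarrow> ennreal" where
  "ext_energy m R u t =
     (\<integral>\<^sup>+ r\<in>{R + \<bar>t\<bar><..}.
        ennreal (\<bar>dist_dt (\<lambda>\<tau> \<rho>. \<rho> * u \<tau> \<rho>) t r\<bar> powr m
               + \<bar>dist_dr (\<lambda>\<tau> \<rho>. \<rho> * u \<tau> \<rho>) t r\<bar> powr m) \<partial>lborel)"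

end

theory Submission
  imports Defs "HOL-Probability.Probability"
begin

text \<open>In the radial setting U(t,r) = r w(t,r) solves the one-dimensional wave equation with U(t,0) = 0, so
  U(t,r) is the integral of a single profile f over (t - r, t + r), and the weak derivatives of U are
  f(t + r) + f(t - r) in r and f(t + r) - f(t - r) in t. Up to constants, the exterior energy is therefore the
  sum of an incoming part (f(t + r)) and an outgoing part (f(t - r)) over r > R + |t|; the outgoing part is
  constant for t >= 0 and the incoming part is constant for t <= 0, and one of them carries half of the energy at t = 0.

  The only Schwartz functions used are Gaussians. Paired with a Gaussian of parameter b, the Fourier data
  yields a smoothed profile. The condition |x|^s k in L^2 with 1 <= s < 3/2 makes the smoothed
  profiles Cauchy in L^1 with weight 1/(1 + y^2) as b tends to 0; their limit is f. Uniqueness of the Laplace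
  transform then turns the Gaussian pairings of U(t,r) into the representation by f.\<close>

section \<open>Gaussians as Schwartz functions\<close>

text \<open>The formula behind f: averaging a plane wave of frequency x over a sphere of radius r
  gives sin(r|x|)/(r|x|), and sin(r|x|) cos(t|x|) is |x|/2 times the integral of cos(y|x|) over y in
  (t - r, t + r); likewise with sin(t|x|) and sin(y|x|). So, formally, f(y) is 1/(16 pi^3) times the
  integral over R^3 of k0 cos(y|x|) + k1 sin(y|x|), where k0 and k1 are the real parts of the
  Fourier transforms of the data, the second divided by |x|. The obstacle is that this integral need
  not converge, while the weak derivatives have to be locally integrable functions; hence smoothing
  and a limit. In the limit s < 3/2 controls low frequencies and s >= 1 high ones; m > 2 provides
  both. Time and the profile variable coincide: up to constants, the same Gaussian-weighted
  frequency integral is the wave at time t paired with a Gaussian in space and f convolved with a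
  Gaussian at t. No L^m bound on f enters; energies live in [0, infinity] and are compared through
  pointwise inequalities.\<close>

definition gauss :: "real \<Rightarrow> 'a::euclidean_space \<Rightarrow> real" where
  "gauss a x = exp (- (a * (norm x)\<^sup>2))"

lemma gauss_pos: "gauss a x > 0"
  by (simp add: gauss_def)

lemma gauss_measurable [measurable]: "gauss a \<in> borel_measurable borel"
  unfolding gauss_def by measurable

text \<open>Polynomials times a fixed Gaussian form a class closed under directional derivatives.
  The polynomial dependence of D on x is recorded so that the step can be iterated.\<close>

lemma real_polynomial_function_has_derivative:
  fixes p :: "'a::euclidean_space \<Rightarrow> real"
  assumes "real_polynomial_function p"
  shows "\<exists>D. (\<forall>x. (p has_derivative D x) (at x)) \<and>
             (\<forall>v. real_polynomial_function (\<lambda>x. D x v))"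
  using assms
proof induction
  case (linear f)
  then show ?case
    by (intro exI[of _ "\<lambda>_. f"]) (auto simp: bounded_linear_imp_has_derivative)
next
  case (const c)
  then show ?case by (intro exI[of _ "\<lambda>_ _. 0"]) auto
next
  case (add f g)
  then obtain D E where "\<forall>x. (f has_derivative D x) (at x)" "\<forall>v. real_polynomial_function (\<lambda>x. D x v)"
    "\<forall>x. (g has_derivative E x) (at x)" "\<forall>v. real_polynomial_function (\<lambda>x. E x v)" by blast
  then show ?case
    by (intro exI[of _ "\<lambda>x v. D x v + E x v"]) (auto intro!: has_derivative_add)
next
  case (mult f g)
  then obtain D E where "\<forall>x. (f has_derivative D x) (at x)" "\<forall>v. real_polynomial_function (\<lambda>x. D x v)"
    "\<forall>x. (g has_derivative E x) (at x)" "\<forall>v. real_polynomial_function (\<lambda>x. E x v)" by blast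
  with mult.hyps show ?case
    by (intro exI[of _ "\<lambda>x v. f x * E x v + D x v * g x"])
       (auto intro!: has_derivative_mult real_polynomial_function.intros(3,4))
qed

lemma real_polynomial_function_growth:
  fixes p :: "'a::euclidean_space \<Rightarrow> real"
  assumes "real_polynomial_function p"
  shows "\<exists>C n. \<forall>x. \<bar>p x\<bar> \<le> C * (1 + norm x) ^ n"
  using assms
proof induction
  case (linear f)
  then obtain K where K: "\<And>x. norm (f x) \<le> norm x * K" "K \<ge> 0" using bounded_linear.nonneg_bounded by blast
  have "\<bar>f x\<bar> \<le> K * (1 + norm x) ^ 1" for x
    using K(1)[of x] K(2) by (simp add: algebra_simps)
  then show ?case by blast
next
  case (const c)
  have "\<bar>c\<bar> \<le> \<bar>c\<bar> * (1 + norm x) ^ 0" for x :: 'a by simp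
  then show ?case by blast
next
  case (add f g)
  then obtain C n D k where *: "\<forall>x. \<bar>f x\<bar> \<le> C * (1 + norm x) ^ n" "\<forall>x. \<bar>g x\<bar> \<le> D * (1 + norm x) ^ k" by blast
  have "\<bar>f x + g x\<bar> \<le> (\<bar>C\<bar> + \<bar>D\<bar>) * (1 + norm x) ^ (n + k)" for x
  proof -
    have "\<bar>f x\<bar> \<le> \<bar>C\<bar> * (1 + norm x) ^ n"
      using *(1) by (meson abs_ge_self mult_right_mono norm_ge_zero order_trans zero_le_power add_nonneg_nonneg zero_le_one)
    also have "\<dots> \<le> \<bar>C\<bar> * (1 + norm x) ^ (n + k)"
      by (intro mult_left_mono power_increasing) auto
    finally have 1: "\<bar>f x\<bar> \<le> \<bar>C\<bar> * (1 + norm x) ^ (n + k)" .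
    have "\<bar>g x\<bar> \<le> \<bar>D\<bar> * (1 + norm x) ^ k"
      using *(2) by (meson abs_ge_self mult_right_mono norm_ge_zero order_trans zero_le_power add_nonneg_nonneg zero_le_one)
    also have "\<dots> \<le> \<bar>D\<bar> * (1 + norm x) ^ (n + k)"
      by (intro mult_left_mono power_increasing) auto
    finally show ?thesis using 1 by (simp add: algebra_simps)
  qed
  then show ?case by blast
next
  case (mult f g)
  then obtain C n D k where *: "\<forall>x. \<bar>f x\<bar> \<le> C * (1 + norm x) ^ n" "\<forall>x. \<bar>g x\<bar> \<le> D * (1 + norm x) ^ k" by blast
  have "\<bar>f x * g x\<bar> \<le> (C * D) * (1 + norm x) ^ (n + k)" for x
  proof -
    have "\<bar>f x\<bar> * \<bar>g x\<bar> \<le> (C * (1 + norm x) ^ n) * (D * (1 + norm x) ^ k)"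
      using * by (intro mult_mono) (auto intro: order_trans[OF abs_ge_zero])
    then show ?thesis by (simp add: abs_mult power_add algebra_simps)
  qed
  then show ?case by blast
qed

text \<open>Since 1 + r <= exp r, completing the square in n r suffices. The explicit constant
  serves the Schwartz bounds and, later, the comparison of Gaussians with
  \<open>weight\<close>.\<close>

lemma one_plus_power_le_exp:
  fixes a r :: real
  assumes "a > 0" "r \<ge> 0"
  shows "(1 + r) ^ n \<le> exp ((real n)\<^sup>2 / (4 * a)) * exp (a * r\<^sup>2)"
proof -
  have "(1 + r) ^ n \<le> exp r ^ n"
    using assms by (intro power_mono) auto
  also have "\<dots> = exp (real n * r)" by (simp add: exp_of_nat_mult)
  also have "real n * r \<le> (real n)\<^sup>2 / (4 * a) + a * r\<^sup>2"
  proof -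
    have "0 \<le> (real n - 2 * a * r)\<^sup>2 / (4 * a)" using assms by simp
    also have "\<dots> = (real n)\<^sup>2 / (4 * a) - real n * r + a * r\<^sup>2"
      using assms by (simp add: power2_eq_square field_simps)
    finally show ?thesis by simp
  qed
  finally show ?thesis by (simp add: exp_add)
qed

lemma has_derivative_poly_gauss:
  fixes p :: "'a::euclidean_space \<Rightarrow> real"
  assumes "(p has_derivative D) (at x)"
  shows "((\<lambda>x. complex_of_real (p x * gauss a x)) has_derivative
           (\<lambda>v. of_real ((D v - 2 * a * (x \<bullet> v) * p x) * gauss a x))) (at x)"
proof -
  have "((\<lambda>x. - (a * (x \<bullet> x))) has_derivative (\<lambda>v. - (a * (x \<bullet> v + v \<bullet> x)))) (at x)"
    by (intro derivative_intros)
  from has_derivative_mult[OF assms has_derivative_exp[OF this]]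
  have "((\<lambda>x. p x * exp (- (a * (x \<bullet> x)))) has_derivative
           (\<lambda>v. (D v - 2 * a * (x \<bullet> v) * p x) * exp (- (a * (x \<bullet> x))))) (at x)"
    by (rule has_derivative_eq_rhs) (simp add: fun_eq_iff algebra_simps inner_commute)
  then show ?thesis
    unfolding gauss_def power2_norm_eq_inner by (rule has_derivative_of_real)
qed

lemma iter_deriv_poly_gauss:
  fixes p :: "'a::euclidean_space \<Rightarrow> real"
  assumes "real_polynomial_function p"
  shows "\<exists>q. real_polynomial_function q \<and>
    iter_deriv vs (\<lambda>x. complex_of_real (p x * gauss a x)) = (\<lambda>x. of_real (q x * gauss a x))"
proof (induction vs)
  case Nil
  then show ?case using assms by auto
next
  case (Cons v vs)
  then obtain q where q: "real_polynomial_function q"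
    "iter_deriv vs (\<lambda>x. complex_of_real (p x * gauss a x)) = (\<lambda>x. of_real (q x * gauss a x))" by blast
  obtain D where D: "\<And>x. (q has_derivative D x) (at x)" "\<And>v. real_polynomial_function (\<lambda>x. D x v)"
    using real_polynomial_function_has_derivative[OF q(1)] by blast
  have "real_polynomial_function (\<lambda>x. D x v + (- 2 * a) * ((x \<bullet> v) * q x))"
    by (rule real_polynomial_function.intros(3)[OF D(2)
          real_polynomial_function.intros(4)[OF real_polynomial_function.intros(2)
          real_polynomial_function.intros(4)[OF real_polynomial_function.intros(1)[OF bounded_linear_inner_left] q(1)]]])
  also have "(\<lambda>x. D x v + (- 2 * a) * ((x \<bullet> v) * q x)) = (\<lambda>x. D x v - 2 * a * (x \<bullet> v) * q x)"
    by (simp add: fun_eq_iff)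
  finally have "real_polynomial_function (\<lambda>x. D x v - 2 * a * (x \<bullet> v) * q x)" .
  moreover have "iter_deriv (v # vs) (\<lambda>x. complex_of_real (p x * gauss a x)) =
      (\<lambda>x. of_real ((D x v - 2 * a * (x \<bullet> v) * q x) * gauss a x))"
    unfolding iter_deriv.simps q(2)
    by (rule ext) (rule frechet_derivative_at[OF has_derivative_poly_gauss[OF D(1)], symmetric, THEN fun_cong])
  ultimately show ?case by blast
qed

lemma schwartz_gauss:
  assumes "a > 0"
  shows "schwartz (\<lambda>x::'a::euclidean_space. complex_of_real (gauss a x))"
  unfolding schwartz_def
proof (intro ballI conjI allI)
  fix vs :: "'a list" and k :: nat
  have one: "real_polynomial_function (\<lambda>_::'a. 1)"
    by (rule real_polynomial_function.intros(2))
  obtain q :: "'a \<Rightarrow> real" where q: "real_polynomial_function q"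
    "iter_deriv vs (\<lambda>x. complex_of_real (gauss a x)) = (\<lambda>x. of_real (q x * gauss a x))"
    using iter_deriv_poly_gauss[OF one, of vs a] unfolding mult_1 by (elim exE conjE)
  obtain D where D: "\<forall>x. (q has_derivative D x) (at x)"
    using real_polynomial_function_has_derivative[OF q(1)] by (elim exE conjE)
  have "(\<lambda>x. complex_of_real (q x * gauss a x)) differentiable (at x)" for x
    unfolding differentiable_def by (rule exI, rule has_derivative_poly_gauss[OF D[rule_format]])
  then show "iter_deriv vs (\<lambda>x. complex_of_real (gauss a x)) differentiable_on UNIV"
    unfolding q(2) by (intro differentiable_at_imp_differentiable_on) auto
  obtain C n where C: "\<And>x. \<bar>q x\<bar> \<le> C * (1 + norm x) ^ n"
    using real_polynomial_function_growth[OF q(1)] by blast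
  have "norm ((1 + norm x) ^ k *\<^sub>R iter_deriv vs (\<lambda>x. complex_of_real (gauss a x)) x)
      \<le> C * exp ((real (k + n))\<^sup>2 / (4 * a))" for x :: 'a
  proof -
    have C0: "C \<ge> 0" using C[of 0] by simp
    have "norm ((1 + norm x) ^ k *\<^sub>R iter_deriv vs (\<lambda>x. complex_of_real (gauss a x)) x)
       = (1 + norm x) ^ k * \<bar>q x\<bar> * gauss a x"
      unfolding q(2) using gauss_pos[of a x]
      by (simp add: abs_mult norm_mult del: of_real_mult)
    also have "\<dots> \<le> (1 + norm x) ^ k * (C * (1 + norm x) ^ n) * gauss a x"
      using C gauss_pos[of a x] by (intro mult_right_mono mult_left_mono) auto
    also have "\<dots> = C * ((1 + norm x) ^ (k + n) * gauss a x)"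
      by (simp add: power_add algebra_simps)
    also have "(1 + norm x) ^ (k + n) * gauss a x \<le>
        (exp ((real (k + n))\<^sup>2 / (4 * a)) * exp (a * (norm x)\<^sup>2)) * gauss a x"
      using one_plus_power_le_exp[OF assms, of "norm x" "k + n"] gauss_pos[of a x]
      by (intro mult_right_mono) auto
    also have "\<dots> = exp ((real (k + n))\<^sup>2 / (4 * a))"
      by (simp add: gauss_def exp_minus field_simps)
    finally show ?thesis using C0 by (simp add: mult_left_mono)
  qed
  then show "bounded (range (\<lambda>x. (1 + norm x) ^ k *\<^sub>R iter_deriv vs (\<lambda>x. complex_of_real (gauss a x)) x))"
    by (intro boundedI) (elim rangeE, simp only:)
qed

section \<open>Fourier transforms of Gaussians\<close>

lemma std_normal_fourier:
  "(LBINT x. std_normal_density x *\<^sub>R iexp (t * x)) = complex_of_real (exp (- (t\<^sup>2) / 2))"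
proof -
  have "(CLINT x|std_normal_distribution. iexp (t * x)) = complex_of_real (exp (- (t\<^sup>2) / 2))"
    using char_std_normal_distribution by (simp add: char_def fun_eq_iff)
  then show ?thesis
    by (subst (asm) integral_density) (auto simp: normal_density_nonneg)
qed

lemma real_gauss_fourier:
  fixes a \<xi> :: real
  assumes "a > 0"
  shows "integrable lborel (\<lambda>x. complex_of_real (gauss a x) * iexp (\<xi> * x))"
    and "(LBINT x. complex_of_real (gauss a x) * iexp (\<xi> * x))
           = of_real (sqrt (pi / a) * gauss (1 / (4 * a)) \<xi>)"
proof -
  \<comment> \<open>With this c, \<open>gauss a x\<close> is sqrt (2 pi) times the standard normal
    density at c x, so a linear change of variables reduces the claim to the characteristic function
    of the normal law.\<close>
  define c where "c = sqrt (2 * a)"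
  have c: "c > 0" "c\<^sup>2 = 2 * a" using assms by (auto simp: c_def)
  have *: "complex_of_real (gauss a x) * iexp (\<xi> * x) =
       of_real (sqrt (2 * pi)) * (std_normal_density (0 + c * x) *\<^sub>R iexp ((\<xi> / c) * (0 + c * x)))" for x
    using c by (simp add: gauss_def std_normal_density_def scaleR_conv_of_real power_mult_distrib
       flip: of_real_mult)
  have i: "integrable lborel (\<lambda>x. std_normal_density x *\<^sub>R iexp (t * x))" for t
    by (rule Bochner_Integration.integrable_bound[OF integrable_normal_density[of 1 0]])
       (auto simp: normal_density_nonneg)
  show "integrable lborel (\<lambda>x. complex_of_real (gauss a x) * iexp (\<xi> * x))"
    unfolding * using c by (intro integrable_mult_right lborel_integrable_real_affine i) auto
  have "(LBINT x. complex_of_real (gauss a x) * iexp (\<xi> * x)) =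
     of_real (sqrt (2 * pi)) * (LBINT x. (std_normal_density (0 + c * x) *\<^sub>R iexp ((\<xi> / c) * (0 + c * x))))"
    unfolding * by (rule integral_mult_right_zero)
  also have "(LBINT x. (std_normal_density (0 + c * x) *\<^sub>R iexp ((\<xi> / c) * (0 + c * x))))
      = (1 / c) *\<^sub>R complex_of_real (exp (- ((\<xi> / c)\<^sup>2) / 2))"
    unfolding std_normal_fourier[of "\<xi> / c", symmetric]
    by (subst (2) lborel_integral_real_affine[of c _ 0]) (use c in auto)
  also have "of_real (sqrt (2 * pi)) * \<dots> = of_real ((sqrt (2 * pi) / c) * exp (- ((\<xi> / c)\<^sup>2) / 2))"
    by (simp add: scaleR_conv_of_real)
  also have "(sqrt (2 * pi) / c) = sqrt (pi / a)"
    by (simp add: c_def flip: real_sqrt_divide)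
  also have "exp (- ((\<xi> / c)\<^sup>2) / 2) = gauss (1 / (4 * a)) \<xi>"
    using c by (simp add: gauss_def power_divide)
  finally show "(LBINT x. complex_of_real (gauss a x) * iexp (\<xi> * x))
           = of_real (sqrt (pi / a) * gauss (1 / (4 * a)) \<xi>)" .
qed

lemma gauss_eq_prod: "gauss a x = (\<Prod>b\<in>Basis. gauss a (x \<bullet> b))"
  by (simp add: gauss_def power2_norm_eq_inner euclidean_inner[of x x] sum_distrib_left
      flip: exp_sum sum_negf power2_eq_square)

text \<open>\<open>lborel\<close> is the image of a product of one-dimensional measures, and both
  the Gaussian and the exponential factor over coordinates, so the integral is a product of
  one-dimensional ones.\<close>

lemma fourier_gauss:
  fixes \<xi> :: "'a::euclidean_space"
  assumes "a > 0"
  shows "fourier (\<lambda>x. complex_of_real (gauss a x)) \<xi>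
           = of_real (sqrt (pi / a) ^ DIM('a) * gauss (1 / (4 * a)) \<xi>)"
proof -
  interpret product_sigma_finite "\<lambda>_::'a. lborel :: real measure" by standard
  let ?T = "\<lambda>f. \<Sum>b\<in>Basis. f b *\<^sub>R b :: 'a"
  have T: "?T f \<bullet> b = f b" if "b \<in> Basis" for f b
    using that by simp
  have e: "exp (- (\<i> * of_real (x \<bullet> \<xi>))) * complex_of_real (gauss a x) =
     (\<Prod>b\<in>Basis. complex_of_real (gauss a (x \<bullet> b)) * iexp (- (\<xi> \<bullet> b) * (x \<bullet> b)))" for x
    unfolding prod.distrib exp_sum[symmetric, OF finite_Basis] gauss_eq_prod[of a x]
    by (subst euclidean_inner[of x \<xi>])
       (simp add: sum_distrib_left sum_negf mult.assoc mult.commute mult.left_commute)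
  have "fourier (\<lambda>x. complex_of_real (gauss a x)) \<xi> = (LINT f|(\<Pi>\<^sub>M b\<in>Basis. lborel).
      exp (- (\<i> * of_real (?T f \<bullet> \<xi>))) * complex_of_real (gauss a (?T f)))"
    unfolding fourier_def by (subst lborel_eq, subst integral_distr) simp_all
  also have "\<dots> = (LINT f|(\<Pi>\<^sub>M b\<in>Basis. lborel).
      (\<Prod>b\<in>Basis. complex_of_real (gauss a (f b)) * iexp (- (\<xi> \<bullet> b) * f b)))"
    unfolding e by (intro Bochner_Integration.integral_cong prod.cong refl) (simp only: T)
  also have "\<dots> = (\<Prod>b\<in>Basis. LBINT x. complex_of_real (gauss a x) * iexp (- (\<xi> \<bullet> b) * x))"
    by (intro product_integral_prod real_gauss_fourier(1)[OF assms]) auto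
  also have "\<dots> = (\<Prod>b\<in>Basis. of_real (sqrt (pi / a) * gauss (1 / (4 * a)) (- (\<xi> \<bullet> b))))"
    by (simp only: real_gauss_fourier(2)[OF assms])
  also have "\<dots> = of_real (sqrt (pi / a) ^ DIM('a) * (\<Prod>b\<in>Basis. gauss (1 / (4 * a)) (\<xi> \<bullet> b)))"
    by (simp add: prod.distrib gauss_def)
  also have "(\<Prod>b\<in>Basis. gauss (1 / (4 * a)) (\<xi> \<bullet> b)) = gauss (1 / (4 * a)) \<xi>"
    by (rule gauss_eq_prod[symmetric])
  finally show ?thesis .
qed

text \<open>Everything drawn from \<open>has_fourier\<close> passes through these three facts. The
  function w and the Gaussians are real, so only the real part of g survives the pairing.\<close>

lemma has_fourier_gauss:
  fixes w :: "'a::euclidean_space \<Rightarrow> real"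
  assumes "has_fourier (\<lambda>x. of_real (w x)) g" "a > 0"
  shows "integrable lborel (\<lambda>\<xi>. g \<xi> * of_real (gauss a \<xi>))"
    and "integrable lborel (\<lambda>x. w x * gauss a x)"
    and "sqrt (pi / a) ^ DIM('a) * (LBINT x. w x * gauss (1 / (4 * a)) x)
           = (LBINT \<xi>. Re (g \<xi>) * gauss a \<xi>)"
proof -
  have h: "integrable lborel (\<lambda>x. of_real (w x) * fourier (\<lambda>x. complex_of_real (gauss a x)) x)"
    "integrable lborel (\<lambda>\<xi>. g \<xi> * complex_of_real (gauss a \<xi>))"
    "(LBINT x. of_real (w x) * fourier (\<lambda>x. complex_of_real (gauss a x)) x)
      = (LBINT \<xi>. g \<xi> * complex_of_real (gauss a \<xi>))" if "a > 0" for a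
    using assms(1) schwartz_gauss[OF that, where 'a='a] unfolding has_fourier_def by auto
  show "integrable lborel (\<lambda>\<xi>. g \<xi> * of_real (gauss a \<xi>))" using h(2)[OF assms(2)] .
  have f: "complex_of_real (w x) * fourier (\<lambda>x. complex_of_real (gauss a x)) x =
    complex_of_real (sqrt (pi / a) ^ DIM('a) * (w x * gauss (1 / (4 * a)) x))" if "a > 0" for a x
    unfolding fourier_gauss[OF that] of_real_mult by (simp add: mult_ac)
  show "integrable lborel (\<lambda>x. w x * gauss a x)"
  proof -
    \<comment> \<open>The transform of the Gaussian with parameter 1/(4a) is a multiple of
      \<open>gauss a\<close>: the map a to 1/(4a) is an involution.\<close>
    have a: "1 / (4 * a) > 0" using assms(2) by simp
    have "integrable lborel (\<lambda>x. complex_of_real (sqrt (pi / (1 / (4 * a))) ^ DIM('a) * (w x * gauss (1 / (4 * (1 / (4 * a)))) x)))"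
      using h(1)[OF a] unfolding f[OF a] .
    then have "integrable lborel (\<lambda>x. sqrt (pi / (1 / (4 * a))) ^ DIM('a) * (w x * gauss (1 / (4 * (1 / (4 * a)))) x))"
      by (simp only: complex_of_real_integrable_eq)
    then show ?thesis using assms(2) by simp
  qed
  have "complex_of_real (sqrt (pi / a) ^ DIM('a) * (LBINT x. w x * gauss (1 / (4 * a)) x))
      = (LBINT \<xi>. g \<xi> * complex_of_real (gauss a \<xi>))"
    using h(3)[OF assms(2)] unfolding f[OF assms(2)] integral_complex_of_real
    by (simp only: integral_mult_right_zero)
  then have "sqrt (pi / a) ^ DIM('a) * (LBINT x. w x * gauss (1 / (4 * a)) x)
      = Re (LBINT \<xi>. g \<xi> * complex_of_real (gauss a \<xi>))" by (metis Re_complex_of_real)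
  also have "\<dots> = (LBINT \<xi>. Re (g \<xi> * complex_of_real (gauss a \<xi>)))"
    by (rule integral_Re[symmetric, OF h(2)[OF assms(2)]])
  finally show "sqrt (pi / a) ^ DIM('a) * (LBINT x. w x * gauss (1 / (4 * a)) x)
           = (LBINT \<xi>. Re (g \<xi>) * gauss a \<xi>)" by simp
qed

section \<open>Radial integration and Laplace uniqueness\<close>

definition sphere_area :: "real \<Rightarrow> real" where
  "sphere_area r = (if r > 0 then 4 * pi * r\<^sup>2 else 0)"

lemma sphere_area_nonneg: "sphere_area r \<ge> 0"
  by (simp add: sphere_area_def)

lemma sphere_area_measurable [measurable]: "sphere_area \<in> borel_measurable borel"
  unfolding sphere_area_def by measurable

text \<open>Half-lines \<open>{..r}\<close> generate the Borel sets and are stable under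
  intersection, and their preimages under the norm are balls. So the ball volume, whose derivative
  is the sphere area, determines the image measure. Radial functions need no more of polar
  coordinates.\<close>

lemma distr_norm_lborel:
  "distr (lborel :: (real^3) measure) borel norm = density lborel (\<lambda>r. ennreal (sphere_area r))"
proof (rule measure_eqI_generator_eq[where E = "range atMost" and \<Omega> = UNIV and A = "\<lambda>n. {..real n}"])
  show "Int_stable (range atMost :: real set set)"
    by (auto simp: Int_stable_def)
  fix X assume "X \<in> range (atMost :: real \<Rightarrow> real set)"
  then obtain r where X: "X = {..r}" by blast
  have *: "emeasure (distr (lborel :: (real^3) measure) borel norm) {..r} =
        emeasure (density lborel (\<lambda>r. ennreal (sphere_area r))) {..r}" if r: "r \<ge> 0" for r
  proof -
    have "emeasure (density lborel (\<lambda>r. ennreal (sphere_area r))) {..r}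
        = (\<integral>\<^sup>+x. ennreal (sphere_area x) * indicator {..r} x \<partial>lborel)"
      by (subst emeasure_density) auto
    also have "\<dots> = (\<integral>\<^sup>+x. ennreal (4 * pi * x\<^sup>2) * indicator {0..r} x \<partial>lborel)"
      by (intro nn_integral_cong) (auto simp: sphere_area_def indicator_def not_less)
    also have "\<dots> = ennreal (4 * pi / 3 * r ^ 3 - 4 * pi / 3 * 0 ^ 3)"
      using r by (intro nn_integral_FTC_Icc) (auto intro!: derivative_eq_intros simp: power2_eq_square)
    also have "\<dots> = emeasure lborel (cball (0 :: real^3) r)"
      using r by (simp add: emeasure_cball unit_ball_vol_3)
    also have "cball (0 :: real^3) r = norm -` {..r}" by auto
    also have "emeasure lborel \<dots> = emeasure (distr (lborel :: (real^3) measure) borel norm) {..r}"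
      by (subst emeasure_distr) auto
    finally show ?thesis ..
  qed
  show "emeasure (distr (lborel :: (real^3) measure) borel norm) X =
        emeasure (density lborel (\<lambda>r. ennreal (sphere_area r))) X"
  proof (cases "r \<ge> 0")
    case True
    then show ?thesis using * X by simp
  next
    case False
    have "norm -` {..r} = ({} :: (real^3) set)"
      using False by (auto dest: order_trans[OF norm_ge_zero])
    moreover have "(\<integral>\<^sup>+x. ennreal (sphere_area x) * indicator {..r} x \<partial>lborel) = (\<integral>\<^sup>+(x::real). 0 \<partial>lborel)"
      using False by (intro nn_integral_cong) (auto simp: sphere_area_def indicator_def)
    ultimately show ?thesis unfolding X
      by (subst emeasure_distr) (auto simp: emeasure_density)
  qed
next
  fix n :: nat
  have "norm -` {..real n} = cball (0 :: real^3) (real n)" by auto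
  then show "emeasure (distr (lborel :: (real^3) measure) borel norm) {..real n} \<noteq> \<infinity>"
    by (subst emeasure_distr) (auto simp: emeasure_cball)
qed (auto simp: borel_eq_atMost real_arch_simple)

lemma nn_integral_norm:
  assumes [measurable]: "f \<in> borel_measurable borel"
  shows "(\<integral>\<^sup>+x. f (norm x) \<partial>(lborel :: (real^3) measure)) = (\<integral>\<^sup>+r. ennreal (sphere_area r) * f r \<partial>lborel)"
  by (subst nn_integral_distr[symmetric, where M' = borel])
     (simp_all add: distr_norm_lborel nn_integral_density)

lemma integrable_norm_iff:
  fixes f :: "real \<Rightarrow> real"
  assumes [measurable]: "f \<in> borel_measurable borel"
  shows "integrable (lborel :: (real^3) measure) (\<lambda>x. f (norm x)) \<longleftrightarrow>
         integrable lborel (\<lambda>r. sphere_area r * f r)"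
  by (subst integrable_distr_eq[symmetric, where N = borel])
     (simp_all add: distr_norm_lborel integrable_density sphere_area_nonneg)

lemma integral_norm:
  fixes f :: "real \<Rightarrow> real"
  assumes [measurable]: "f \<in> borel_measurable borel"
  shows "(LINT x|(lborel :: (real^3) measure). f (norm x)) = (LBINT r. sphere_area r * f r)"
  by (subst integral_distr[symmetric, where N = borel])
     (simp_all add: distr_norm_lborel integral_density sphere_area_nonneg)

text \<open>A kernel bounded by 1 leaves the integrand dominated by the integrable product of |f|
  and |g|. Later exchanges of integrals are brought to this form by moving unbounded factors into f
  and g.\<close>

lemma integral_swap_dominated:
  fixes f :: "'a \<Rightarrow> real" and g :: "'b \<Rightarrow> real"
  assumes "sigma_finite_measure M" "sigma_finite_measure N"
    and f: "integrable M f" and g: "integrable N g"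
    and K [measurable]: "(\<lambda>(x, y). K x y) \<in> borel_measurable (M \<Otimes>\<^sub>M N)"
    and bound: "\<And>x y. \<bar>K x y\<bar> \<le> 1"
  shows "(LINT x|M. f x * (LINT y|N. g y * K x y)) = (LINT y|N. g y * (LINT x|M. f x * K x y))"
    and "integrable M (\<lambda>x. f x * (LINT y|N. g y * K x y))"
proof -
  interpret M: sigma_finite_measure M by fact
  interpret N: sigma_finite_measure N by fact
  interpret pair_sigma_finite M N ..
  have [measurable]: "f \<in> borel_measurable M" "g \<in> borel_measurable N" using f g by auto
  have i: "integrable (M \<Otimes>\<^sub>M N) (\<lambda>(x, y). f x * (g y * K x y))"
  proof (rule Bochner_Integration.integrable_bound)
    show "integrable (M \<Otimes>\<^sub>M N) (\<lambda>(x, y). \<bar>f x\<bar> * \<bar>g y\<bar>)"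
      using f g by (intro Fubini_integrable) (auto simp: abs_mult)
    show "AE z in M \<Otimes>\<^sub>M N. norm (case z of (x, y) \<Rightarrow> f x * (g y * K x y)) \<le> norm (case z of (x, y) \<Rightarrow> \<bar>f x\<bar> * \<bar>g y\<bar>)"
      using bound by (auto simp: abs_mult intro!: AE_I2 mult_left_mono mult_left_le)
  qed measurable
  have "(LINT x|M. f x * (LINT y|N. g y * K x y)) = (LINT x|M. (LINT y|N. f x * (g y * K x y)))" by simp
  also have "\<dots> = (LINT y|N. (LINT x|M. f x * (g y * K x y)))"
    using Fubini_integral[OF i] by simp
  also have "\<dots> = (LINT y|N. g y * (LINT x|M. f x * K x y))"
  proof (rule Bochner_Integration.integral_cong[OF refl])
    fix y
    have "(\<lambda>x. f x * (g y * K x y)) = (\<lambda>x. g y * (f x * K x y))"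
      by (simp add: fun_eq_iff)
    then show "(LINT x|M. f x * (g y * K x y)) = g y * (LINT x|M. f x * K x y)" by simp
  qed
  finally show "(LINT x|M. f x * (LINT y|N. g y * K x y)) = (LINT y|N. g y * (LINT x|M. f x * K x y))" .
  show "integrable M (\<lambda>x. f x * (LINT y|N. g y * K x y))"
    using integrable_fst[OF i] by simp
qed

text \<open>With y = exp (- z) the decay of \<Phi> becomes a power of y. Dividing by y powr \<beta>
  with \<beta> < \<alpha> still leaves the positive power y powr (\<alpha> - \<beta>), so the value
  0 at y = 0 is the continuous one.\<close>

lemma laplace_weighted_continuous:
  fixes \<Phi> :: "real \<Rightarrow> real"
  assumes \<Phi>: "continuous_on UNIV \<Phi>" and \<alpha>: "\<alpha> > 0" "\<beta> < \<alpha>" "\<beta> > 0"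
    and bound: "\<And>z. z \<ge> 0 \<Longrightarrow> \<bar>\<Phi> z\<bar> \<le> C * exp (- (\<alpha> * z))"
  shows "continuous_on {0..1} (\<lambda>y. if y \<le> 0 then 0 else \<Phi> (- ln y) * y powr (- \<beta>))"
    (is "continuous_on _ ?\<Psi>")
  unfolding continuous_on_eq_continuous_within
proof
  fix y :: real assume y: "y \<in> {0..1}"
  show "continuous (at y within {0..1}) ?\<Psi>"
  proof (cases "y = 0")
    case False
    with y have y: "y > 0" by simp
    have "continuous_on {0<..} (\<lambda>y. \<Phi> (- ln y) * y powr (- \<beta>))"
      by (intro continuous_intros continuous_on_compose2[OF \<Phi>]) auto
    then have "continuous (at y) (\<lambda>y. \<Phi> (- ln y) * y powr (- \<beta>))"
      using y by (simp add: continuous_on_eq_continuous_at)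
    moreover have "\<forall>\<^sub>F x in nhds y. ?\<Psi> x = \<Phi> (- ln x) * x powr (- \<beta>)"
      using eventually_nhds_in_open[of "{0<..}" y] y by (auto elim!: eventually_mono)
    ultimately have "continuous (at y) ?\<Psi>"
      by (subst isCont_cong)
    then show ?thesis by (rule continuous_at_imp_continuous_at_within)
  next
    case True
    have "(?\<Psi> \<longlongrightarrow> 0) (at 0 within {0..1})"
    proof (rule Lim_null_comparison)
      show "\<forall>\<^sub>F x in at 0 within {0..1}. norm (?\<Psi> x) \<le> C * x powr (\<alpha> - \<beta>)"
        unfolding eventually_at_filter
      proof (intro always_eventually allI impI)
        fix x :: real assume "x \<noteq> 0" "x \<in> {0..1}"
        then have x: "0 < x" "x \<le> 1" by auto
        have "norm (?\<Psi> x) = \<bar>\<Phi> (- ln x)\<bar> * x powr (- \<beta>)" using x by (simp add: abs_mult)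
        also have "\<dots> \<le> (C * exp (- (\<alpha> * (- ln x)))) * x powr (- \<beta>)"
          using x by (intro mult_right_mono bound) auto
        also have "\<dots> = C * x powr (\<alpha> - \<beta>)"
          using x by (simp add: powr_def algebra_simps flip: exp_add)
        finally show "norm (?\<Psi> x) \<le> C * x powr (\<alpha> - \<beta>)" .
      qed
      have "((\<lambda>x. C * x powr (\<alpha> - \<beta>)) \<longlongrightarrow> C * 0 powr (\<alpha> - \<beta>)) (at 0 within {0..1})"
        using \<alpha> by (intro tendsto_intros) (auto simp: eventually_at_filter)
      then show "((\<lambda>x. C * x powr (\<alpha> - \<beta>)) \<longlongrightarrow> 0) (at 0 within {0..1})" by simp
    qed
    then show ?thesis using True by (simp add: continuous_within)
  qed
qed

text \<open>After the substitution y = exp (- z), finite combinations of exponentials exp (- n z) become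
  polynomials on [0,1], so the Weierstrass theorem makes them dense.\<close>

lemma laplace_unique:
  fixes k f :: "'a \<Rightarrow> real" and \<Phi> :: "real \<Rightarrow> real"
  assumes f [measurable]: "f \<in> borel_measurable M" and f0: "\<And>x. f x \<ge> 0"
    and int: "\<And>a. a > 0 \<Longrightarrow> integrable M (\<lambda>x. k x * exp (- (a * f x)))"
    and zero: "\<And>a. a > 0 \<Longrightarrow> (LINT x|M. k x * exp (- (a * f x))) = 0"
    and \<Phi>: "continuous_on UNIV \<Phi>" and \<alpha>: "\<alpha> > 0"
    and bound: "\<And>z. z \<ge> 0 \<Longrightarrow> \<bar>\<Phi> z\<bar> \<le> C * exp (- (\<alpha> * z))"
  shows "(LINT x|M. k x * \<Phi> (f x)) = 0"
proof -
  \<comment> \<open>Half of the decay is set aside as exp (- \<beta> z). It makes the approximation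
    error integrable against k, and it gives the i-th monomial the exponent \<beta> + i, positive
    even for i = 0 as \<open>zero\<close> requires.\<close>
  define \<beta> where "\<beta> = \<alpha> / 2"
  have \<beta>: "\<beta> > 0" "\<beta> < \<alpha>" using \<alpha> by (auto simp: \<beta>_def)
  define \<Psi> where "\<Psi> = (\<lambda>y. if y \<le> 0 then 0 else \<Phi> (- ln y) * y powr (- \<beta>))"
  have \<Psi>: "\<Phi> z = exp (- (\<beta> * z)) * \<Psi> (exp (- z))" for z
    by (simp add: \<Psi>_def powr_def flip: exp_add)
  have \<Psi>_cont: "continuous_on {0..1} \<Psi>"
    unfolding \<Psi>_def by (rule laplace_weighted_continuous[OF \<Phi> \<alpha> \<beta>(2,1) bound])
  have [measurable]: "\<Phi> \<in> borel_measurable borel"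
    using \<Phi> by (rule borel_measurable_continuous_onI)
  have [measurable]: "k \<in> borel_measurable M"
  proof -
    have [measurable]: "(\<lambda>x. k x * exp (- (1 * f x))) \<in> borel_measurable M" using int[of 1] by auto
    have "(\<lambda>x. (k x * exp (- (1 * f x))) * exp (f x)) \<in> borel_measurable M" by measurable
    then show ?thesis by (simp add: mult.assoc flip: exp_add)
  qed
  have int\<Phi>: "integrable M (\<lambda>x. k x * \<Phi> (f x))"
  proof (rule Bochner_Integration.integrable_bound)
    show "integrable M (\<lambda>x. C * (k x * exp (- (\<alpha> * f x))))" using int[OF \<alpha>] by simp
    show "AE x in M. norm (k x * \<Phi> (f x)) \<le> norm (C * (k x * exp (- (\<alpha> * f x))))"
    proof (intro AE_I2)
      fix x
      have "\<bar>\<Phi> (f x)\<bar> \<le> \<bar>C * exp (- (\<alpha> * f x))\<bar>" using bound[OF f0[of x]] by linarith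
      then show "norm (k x * \<Phi> (f x)) \<le> norm (C * (k x * exp (- (\<alpha> * f x))))"
        using mult_left_mono[of "\<bar>\<Phi> (f x)\<bar>" "\<bar>C * exp (- (\<alpha> * f x))\<bar>" "\<bar>k x\<bar>"]
        by (simp add: abs_mult mult.left_commute)
    qed
  qed measurable
  define I where "I = (LINT x|M. \<bar>k x\<bar> * exp (- (\<beta> * f x)))"
  have intI: "integrable M (\<lambda>x. \<bar>k x\<bar> * exp (- (\<beta> * f x)))"
    using integrable_abs[OF int[OF \<beta>(1)]] by (simp add: abs_mult)
  have "I \<ge> 0" unfolding I_def by (intro integral_nonneg_AE) auto
  have le: "\<bar>LINT x|M. k x * \<Phi> (f x)\<bar> \<le> e * I" if e: "e > 0" for e
  proof -
    obtain p where "real_polynomial_function p" and p: "\<And>y. y \<in> {0..1} \<Longrightarrow> \<bar>\<Psi> y - p y\<bar> < e"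
      using Stone_Weierstrass_real_polynomial_function[OF _ \<Psi>_cont e] by auto
    then obtain c n where pc: "p = (\<lambda>y. \<Sum>i\<le>n. c i * y ^ i)"
      using real_polynomial_function_iff_sum by blast
    have s: "k x * exp (- (\<beta> * f x)) * p (exp (- f x)) =
       (\<Sum>i\<le>n. c i * (k x * exp (- ((\<beta> + real i) * f x))))" for x
    proof -
      have "exp (- ((\<beta> + real i) * f x)) = exp (- (\<beta> * f x)) * exp (- f x) ^ i" for i
        by (simp add: algebra_simps flip: exp_add exp_of_nat_mult)
      then show ?thesis
        unfolding pc sum_distrib_left by (intro sum.cong refl) (simp add: mult_ac)
    qed
    have pos: "\<beta> + real i > 0" for i using \<beta> by simp
    have ip: "integrable M (\<lambda>x. k x * exp (- (\<beta> * f x)) * p (exp (- f x)))"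
      unfolding s using int[OF pos] by (intro Bochner_Integration.integrable_sum integrable_mult_right)
    have "(LINT x|M. k x * exp (- (\<beta> * f x)) * p (exp (- f x)))
       = (\<Sum>i\<le>n. LINT x|M. c i * (k x * exp (- ((\<beta> + real i) * f x))))"
      unfolding s by (rule Bochner_Integration.integral_sum) (intro integrable_mult_right int[OF pos])
    also have "\<dots> = 0" using zero[OF pos] by simp
    finally have "(LINT x|M. k x * \<Phi> (f x)) =
        (LINT x|M. k x * \<Phi> (f x) - k x * exp (- (\<beta> * f x)) * p (exp (- f x)))"
      using ip int\<Phi> by simp
    also have "\<bar>\<dots>\<bar> \<le> (LINT x|M. \<bar>k x * \<Phi> (f x) - k x * exp (- (\<beta> * f x)) * p (exp (- f x))\<bar>)"
      by (rule integral_abs_bound)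
    also have "\<dots> \<le> (LINT x|M. e * (\<bar>k x\<bar> * exp (- (\<beta> * f x))))"
    proof (rule integral_mono)
      fix x
      have "k x * \<Phi> (f x) - k x * exp (- (\<beta> * f x)) * p (exp (- f x)) =
        (k x * exp (- (\<beta> * f x))) * (\<Psi> (exp (- f x)) - p (exp (- f x)))"
        unfolding \<Psi>[of "f x"] by (simp add: algebra_simps)
      moreover have "\<bar>\<Psi> (exp (- f x)) - p (exp (- f x))\<bar> \<le> e"
        using p[of "exp (- f x)"] f0[of x] by (simp add: less_imp_le)
      ultimately show "\<bar>k x * \<Phi> (f x) - k x * exp (- (\<beta> * f x)) * p (exp (- f x))\<bar> \<le> e * (\<bar>k x\<bar> * exp (- (\<beta> * f x)))"
        using mult_right_mono[of "\<bar>\<Psi> (exp (- f x)) - p (exp (- f x))\<bar>" e "\<bar>k x\<bar> * exp (- (\<beta> * f x))"]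
        by (simp add: abs_mult mult_ac)
    qed (use ip int\<Phi> intI in auto)
    also have "\<dots> = e * I" unfolding I_def by simp
    finally show ?thesis .
  qed
  have "\<bar>LINT x|M. k x * \<Phi> (f x)\<bar> \<le> 0 + e" if "e > 0" for e
  proof -
    \<comment> \<open>Division by I + 1 instead of I covers I = 0.\<close>
    have "\<bar>LINT x|M. k x * \<Phi> (f x)\<bar> \<le> (e / (I + 1)) * I"
      using that \<open>I \<ge> 0\<close> by (intro le) auto
    also have "\<dots> \<le> e" using that \<open>I \<ge> 0\<close> by (simp add: field_simps)
    finally show ?thesis by simp
  qed
  then have "\<bar>LINT x|M. k x * \<Phi> (f x)\<bar> \<le> 0" by (rule field_le_epsilon)
  then show ?thesis by simp
qed

section \<open>A weighted bound for cosine and sine transforms\<close>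

text \<open>Integrable, yet decaying only polynomially: a Gaussian divided by it stays bounded, and
  a translation changes it by a bounded factor. So functions in weighted L^1 can be shifted and
  paired with Gaussians.\<close>

definition weight :: "real \<Rightarrow> real" where
  "weight y = inverse (1 + y\<^sup>2)"

lemma weight_bounds: "0 < weight y" "weight y \<le> 1"
  by (auto simp: weight_def field_simps add_pos_nonneg intro: add_nonneg_pos)

lemma weight_measurable [measurable]: "weight \<in> borel_measurable borel"
  unfolding weight_def by measurable

lemma weight_integrable: "integrable lborel weight"
  using integrable_inverse_1_plus_square by (simp add: weight_def[abs_def] set_integrable_def)

lemma weight_integral_pos: "(LBINT y. weight y) > 0"
proof -
  have "indicator {0..1} y * (1/2) \<le> weight y" for y
    using weight_bounds(1)[of y] power_le_one[of y 2]
    by (auto simp: weight_def indicator_def field_simps add_pos_nonneg)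
  then have "(LBINT y. indicator {0..1::real} y * (1/2)) \<le> (LBINT y. weight y)"
    by (intro Bochner_Integration.integral_mono weight_integrable) auto
  then show ?thesis by simp
qed

lemma gauss_real_integral:
  fixes a t :: real
  assumes "a > 0"
  shows "integrable lborel (gauss a :: real \<Rightarrow> real)"
    and "(LBINT x. gauss a (x::real) * cos (t * x)) = sqrt (pi / a) * gauss (1 / (4 * a)) t"
    and "(LBINT x. gauss a (t - x)) = sqrt (pi / a)"
proof -
  note i = real_gauss_fourier[OF assms]
  show 1: "integrable lborel (gauss a :: real \<Rightarrow> real)"
    using i(1)[of 0] by (simp add: complex_of_real_integrable_eq)
  have c: "(LBINT x. gauss a (x::real) * cos (t * x)) = sqrt (pi / a) * gauss (1 / (4 * a)) t" for t
  proof -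
    have "(LBINT x. gauss a (x::real) * cos (t * x)) = (LBINT x. Re (complex_of_real (gauss a x) * iexp (t * x)))"
      by (simp add: Re_exp)
    also have "\<dots> = Re (LBINT x. complex_of_real (gauss a x) * iexp (t * x))"
      by (rule integral_Re[OF i(1)])
    finally show ?thesis unfolding i(2) by (simp only: Re_complex_of_real)
  qed
  show "(LBINT x. gauss a (x::real) * cos (t * x)) = sqrt (pi / a) * gauss (1 / (4 * a)) t" by (rule c)
  have "(LBINT x. gauss a (t - x)) = (LBINT x. gauss a (x::real))"
    using lborel_integral_real_affine[of "-1" "gauss a :: real \<Rightarrow> real" t] by simp
  then show "(LBINT x. gauss a (t - x)) = sqrt (pi / a)"
    using c[of 0] by (simp add: gauss_def)
qed

lemma gauss_shift_integrable:
  fixes a t :: real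
  assumes "a > 0"
  shows "integrable lborel (\<lambda>x. gauss a (t - x))"
  using lborel_integrable_real_affine[OF gauss_real_integral(1)[OF assms], of "-1" t] by simp

text \<open>In polar coordinates the power is r^(2 - 2s). On r <= 1 it is integrable because s <
  3/2, and J is bounded by C; on r > 1 it is at most 1 because s >= 1, and the integral of J is
  bounded by D.\<close>

lemma nn_integral_norm_powr:
  fixes J :: "real \<Rightarrow> real"
  assumes s: "1 \<le> s" "s < 3 / 2"
    and [measurable]: "J \<in> borel_measurable borel"
    and J: "\<And>r. 0 \<le> J r" "\<And>r. J r \<le> C" and D: "(\<integral>\<^sup>+r. ennreal (J r) \<partial>lborel) \<le> ennreal D" "D \<ge> 0"
  shows "(\<integral>\<^sup>+x. ennreal (norm x powr (- 2 * s) * J (norm x)) \<partial>(lborel :: (real^3) measure))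
            \<le> ennreal (4 * pi * (C / (3 - 2 * s) + D))"
proof -
  have C: "C \<ge> 0" using J[of 0] by linarith
  have "((\<lambda>r. r powr (2 - 2 * s)) has_integral 1 powr (2 - 2 * s + 1) / (2 - 2 * s + 1)) {0..1}"
    using s by (intro has_integral_powr_from_0) auto
  then have h: "((\<lambda>r. r powr (2 - 2 * s) * indicator {0..1} r) has_integral 1 / (3 - 2 * s)) UNIV"
  proof -
    have "(\<lambda>r. r powr (2 - 2 * s) * indicator {0..1} r) = (\<lambda>r. if r \<in> {0..1} then r powr (2 - 2 * s) else 0)"
      by (auto simp: fun_eq_iff indicator_def)
    then show ?thesis using \<open>(_ has_integral _) {0..1}\<close> by (simp only: has_integral_restrict_UNIV) simp
  qed
  have I: "(\<integral>\<^sup>+r. ennreal (r powr (2 - 2 * s) * indicator {0..1} r) \<partial>lborel) = ennreal (1 / (3 - 2 * s))"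
    by (rule nn_integral_has_integral_lborel[OF _ _ h]) auto
  have "(\<integral>\<^sup>+x. ennreal (norm x powr (- 2 * s) * J (norm x)) \<partial>(lborel :: (real^3) measure))
     = (\<integral>\<^sup>+r. ennreal (sphere_area r) * ennreal (r powr (- 2 * s) * J r) \<partial>lborel)"
    by (rule nn_integral_norm) measurable
  also have "\<dots> \<le> (\<integral>\<^sup>+r. ennreal (4 * pi * C) * ennreal (r powr (2 - 2 * s) * indicator {0..1} r) +
       ennreal (4 * pi) * ennreal (J r) \<partial>lborel)"
  proof (rule nn_integral_mono)
    fix r :: real
    have "sphere_area r * (r powr (- 2 * s) * J r) \<le>
       4 * pi * C * (r powr (2 - 2 * s) * indicator {0..1} r) + 4 * pi * J r"
    proof (cases "r > 0")
      case True
      have e: "sphere_area r * (r powr (- 2 * s) * J r) = 4 * pi * (r powr (2 - 2 * s) * J r)"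
        using True by (simp add: sphere_area_def powr_diff powr_minus field_simps)
      show ?thesis
      proof (cases "r \<le> 1")
        case r1: True
        have "r powr (2 - 2 * s) * J r \<le> C * r powr (2 - 2 * s)"
          using mult_right_mono[OF J(2)[of r], of "r powr (2 - 2 * s)"] by (simp add: mult.commute)
        then show ?thesis unfolding e using True r1 J(1)[of r] by (simp add: add_increasing2)
      next
        case False
        then have "r powr (2 - 2 * s) \<le> 1" using s powr_mono[of "2 - 2 * s" 0 r] by simp
        then have "r powr (2 - 2 * s) * J r \<le> J r" using J(1)[of r] by (simp add: mult_left_le_one_le)
        then show ?thesis unfolding e using False by simp
      qed
    next
      case False
      then show ?thesis using C J(1)[of r] by (simp add: sphere_area_def)
    qed
    then show "ennreal (sphere_area r) * ennreal (r powr (- 2 * s) * J r) \<le>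
       ennreal (4 * pi * C) * ennreal (r powr (2 - 2 * s) * indicator {0..1} r) + ennreal (4 * pi) * ennreal (J r)"
      using C J(1)[of r] sphere_area_nonneg[of r]
      by (simp add: ennreal_leI flip: ennreal_mult ennreal_plus)
  qed
  also have "\<dots> = ennreal (4 * pi * C) * ennreal (1 / (3 - 2 * s)) + ennreal (4 * pi) * (\<integral>\<^sup>+r. ennreal (J r) \<partial>lborel)"
    by (subst nn_integral_add) (simp_all add: nn_integral_cmult I)
  also have "\<dots> \<le> ennreal (4 * pi * C) * ennreal (1 / (3 - 2 * s)) + ennreal (4 * pi) * ennreal D"
    by (intro add_left_mono mult_left_mono D) auto
  also have "\<dots> = ennreal (4 * pi * (C / (3 - 2 * s) + D))"
    using C D s by (simp add: algebra_simps flip: ennreal_mult ennreal_plus)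
  finally show ?thesis .
qed

definition cos_transform :: "(real \<Rightarrow> real) \<Rightarrow> real \<Rightarrow> real" where
  "cos_transform f \<rho> = (LBINT y. f y * cos (y * \<rho>))"

definition sin_transform :: "(real \<Rightarrow> real) \<Rightarrow> real \<Rightarrow> real" where
  "sin_transform f \<rho> = (LBINT y. f y * sin (y * \<rho>))"

text \<open>The Gaussian factor makes Fubini's theorem applicable.\<close>

lemma bessel_gauss:
  fixes \<zeta> :: "real \<Rightarrow> real"
  assumes [measurable]: "\<zeta> \<in> borel_measurable borel" and \<zeta>: "\<And>y. \<bar>\<zeta> y\<bar> \<le> weight y" and \<delta>: "\<delta> > 0"
  defines "W \<equiv> (LBINT y. weight y)"
  defines "c \<equiv> cos_transform \<zeta>" and "d \<equiv> sin_transform \<zeta>"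
  shows "(LBINT \<rho>. gauss \<delta> \<rho> * ((c \<rho>)\<^sup>2 + (d \<rho>)\<^sup>2)) \<le> 2 * pi * W"
    and "integrable lborel (\<lambda>\<rho>. gauss \<delta> \<rho> * ((c \<rho>)\<^sup>2 + (d \<rho>)\<^sup>2))"
    and "\<And>\<rho>. \<bar>c \<rho>\<bar> \<le> W" "\<And>\<rho>. \<bar>d \<rho>\<bar> \<le> W" "c \<in> borel_measurable borel" "d \<in> borel_measurable borel"
proof -
  have W: "W > 0" unfolding W_def by (rule weight_integral_pos)
  have \<zeta>1: "\<bar>\<zeta> y\<bar> \<le> 1" for y using \<zeta>[of y] weight_bounds(2)[of y] by linarith
  have i\<zeta>: "integrable lborel \<zeta>"
    by (rule Bochner_Integration.integrable_bound[OF weight_integrable])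
       (use \<zeta> weight_bounds(1) in \<open>auto intro!: AE_I2 simp: less_imp_le\<close>)
  have ie: "integrable lborel (\<lambda>y. \<zeta> y * e y)" "\<bar>LBINT y. \<zeta> y * e y\<bar> \<le> W"
    if [measurable]: "e \<in> borel_measurable borel" and e: "\<And>y. \<bar>e y\<bar> \<le> 1" for e
  proof -
    have le: "\<bar>\<zeta> y * e y\<bar> \<le> weight y" for y
      using mult_mono[OF \<zeta>[of y] e[of y]] weight_bounds(1)[of y] by (simp add: abs_mult)
    show "integrable lborel (\<lambda>y. \<zeta> y * e y)"
      by (rule Bochner_Integration.integrable_bound[OF weight_integrable])
         (use le weight_bounds(1) in \<open>auto intro!: AE_I2 simp: less_imp_le\<close>)
    then show "\<bar>LBINT y. \<zeta> y * e y\<bar> \<le> W" unfolding W_def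
      by (intro order_trans[OF integral_abs_bound] integral_mono weight_integrable) (use le in auto)
  qed
  show [measurable]: "c \<in> borel_measurable borel" "d \<in> borel_measurable borel"
    unfolding c_def d_def cos_transform_def sin_transform_def by measurable
  show cW: "\<bar>c \<rho>\<bar> \<le> W" and dW: "\<bar>d \<rho>\<bar> \<le> W" for \<rho>
    unfolding c_def d_def cos_transform_def sin_transform_def by (intro ie; simp)+
  \<comment> \<open>Integrating this against \<open>\<zeta>\<close> once more exhibits c^2 + d^2 as
    the double integral of \<zeta>(y) \<zeta>(y') cos ((y - y') \<rho>).\<close>
  have comb: "c \<rho> * cos (y * \<rho>) + d \<rho> * sin (y * \<rho>) = (LBINT y'. \<zeta> y' * cos ((y - y') * \<rho>))" for y \<rho>
  proof -
    have "(LBINT y'. \<zeta> y' * cos ((y - y') * \<rho>))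
      = (LBINT y'. (\<zeta> y' * cos (y' * \<rho>)) * cos (y * \<rho>) + (\<zeta> y' * sin (y' * \<rho>)) * sin (y * \<rho>))"
      by (intro Bochner_Integration.integral_cong refl) (simp add: left_diff_distrib cos_diff algebra_simps)
    also have "\<dots> = c \<rho> * cos (y * \<rho>) + d \<rho> * sin (y * \<rho>)"
      unfolding c_def d_def cos_transform_def sin_transform_def by (subst Bochner_Integration.integral_add) (auto intro!: integrable_mult_left ie)
    finally show ?thesis ..
  qed
  \<comment> \<open>The bracket is at most 2 W, so the quotient is a kernel bounded by 1, as
    \<open>integral_swap_dominated\<close> expects.\<close>
  define K where "K = (\<lambda>\<rho> y. (c \<rho> * cos (y * \<rho>) + d \<rho> * sin (y * \<rho>)) / (2 * W))"
  have K1: "\<bar>K \<rho> y\<bar> \<le> 1" for \<rho> y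
  proof -
    have "\<bar>c \<rho> * cos (y * \<rho>)\<bar> \<le> W * 1" "\<bar>d \<rho> * sin (y * \<rho>)\<bar> \<le> W * 1"
      unfolding abs_mult using W cW dW by (intro mult_mono; simp)+
    then show ?thesis unfolding K_def using W by (simp add: field_simps abs_le_iff)
  qed
  have sf: "sigma_finite_measure (lborel :: real measure)" by (rule lborel.sigma_finite_measure_axioms)
  note swap = integral_swap_dominated[OF sf sf gauss_real_integral(1)[OF \<delta>] i\<zeta>]
  have Kint: "2 * W * (LBINT y. \<zeta> y * K \<rho> y) = (c \<rho>)\<^sup>2 + (d \<rho>)\<^sup>2" for \<rho>
  proof -
    have "(LBINT y. \<zeta> y * K \<rho> y) = (LBINT y. (\<zeta> y * cos (y * \<rho>)) * c \<rho> + (\<zeta> y * sin (y * \<rho>)) * d \<rho>) / (2 * W)"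
      unfolding K_def integral_divide_zero[symmetric]
      by (intro Bochner_Integration.integral_cong refl) (simp add: algebra_simps)
    then have "2 * W * (LBINT y. \<zeta> y * K \<rho> y) = (LBINT y. (\<zeta> y * cos (y * \<rho>)) * c \<rho> + (\<zeta> y * sin (y * \<rho>)) * d \<rho>)"
      using W by simp
    also have "\<dots> = c \<rho> * c \<rho> + d \<rho> * d \<rho>"
      by (subst Bochner_Integration.integral_add) (auto intro!: integrable_mult_left ie simp: c_def d_def cos_transform_def sin_transform_def)
    finally show ?thesis by (simp add: power2_eq_square)
  qed
  have Km: "(\<lambda>(\<rho>, y). K \<rho> y) \<in> borel_measurable (lborel \<Otimes>\<^sub>M lborel)" unfolding K_def by measurable
  \<comment> \<open>Integrating out \<rho> turns cos ((y - y') \<rho>) into a Gaussian in y - y' of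
    mass 2 pi, whatever \<delta> is. Estimating this copy of \<zeta> by 1, and only the outer copy
    by \<open>weight\<close>, gives a bound uniform in \<delta>.\<close>
  have inner: "\<bar>LBINT \<rho>. gauss \<delta> \<rho> * K \<rho> y\<bar> \<le> pi / W" for y
  proof -
    have "2 * W * (LBINT \<rho>. gauss \<delta> \<rho> * K \<rho> y) =
        (LBINT \<rho>. gauss \<delta> \<rho> * (LBINT y'. \<zeta> y' * cos ((y - y') * \<rho>)))"
      unfolding K_def comb using W
      by (subst Bochner_Integration.integral_mult_right_zero[symmetric]) simp
    also have "\<dots> = (LBINT y'. \<zeta> y' * (LBINT \<rho>. gauss \<delta> \<rho> * cos ((y - y') * \<rho>)))"
      by (rule swap(1)) auto
    also have "\<dots> = (LBINT y'. \<zeta> y' * (sqrt (pi / \<delta>) * gauss (1 / (4 * \<delta>)) (y - y')))"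
      by (simp add: gauss_real_integral(2)[OF \<delta>])
    finally have e: "2 * W * (LBINT \<rho>. gauss \<delta> \<rho> * K \<rho> y) = \<dots>" .
    have \<delta>4: "1 / (4 * \<delta>) > 0" using \<delta> by simp
    have le: "\<bar>\<zeta> y' * (sqrt (pi / \<delta>) * gauss (1 / (4 * \<delta>)) (y - y'))\<bar> \<le> sqrt (pi / \<delta>) * gauss (1 / (4 * \<delta>)) (y - y')" for y'
      using \<zeta>1[of y'] \<delta> gauss_pos[of "1 / (4 * \<delta>)" "y - y'"]
      by (simp add: abs_mult mult_left_le_one_le)
    have ig: "integrable lborel (\<lambda>y'. sqrt (pi / \<delta>) * gauss (1 / (4 * \<delta>)) (y - y'))"
      using gauss_shift_integrable[OF \<delta>4] by simp
    have ig2: "integrable lborel (\<lambda>y'. \<bar>\<zeta> y' * (sqrt (pi / \<delta>) * gauss (1 / (4 * \<delta>)) (y - y'))\<bar>)"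
      by (rule Bochner_Integration.integrable_bound[OF ig]) (use le in \<open>auto intro!: AE_I2 order_trans[OF le]\<close>)
    have "\<bar>2 * W * (LBINT \<rho>. gauss \<delta> \<rho> * K \<rho> y)\<bar> \<le> (LBINT y'. sqrt (pi / \<delta>) * gauss (1 / (4 * \<delta>)) (y - y'))"
      unfolding e by (intro order_trans[OF integral_abs_bound] integral_mono ig ig2 le)
    also have "\<dots> = sqrt (pi / \<delta>) * sqrt (pi / (1 / (4 * \<delta>)))"
      using gauss_real_integral(3)[OF \<delta>4] by simp
    also have "\<dots> = sqrt ((2 * pi)\<^sup>2)"
      using \<delta> by (simp add: power2_eq_square flip: real_sqrt_mult)
    also have "\<dots> = 2 * pi" by (subst real_sqrt_abs) simp
    finally show ?thesis using W by (simp add: abs_mult field_simps)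
  qed
  have e: "gauss \<delta> \<rho> * ((c \<rho>)\<^sup>2 + (d \<rho>)\<^sup>2) = 2 * W * (gauss \<delta> \<rho> * (LBINT y. \<zeta> y * K \<rho> y))" for \<rho>
    unfolding Kint[symmetric] by simp
  show "integrable lborel (\<lambda>\<rho>. gauss \<delta> \<rho> * ((c \<rho>)\<^sup>2 + (d \<rho>)\<^sup>2))"
    unfolding e by (intro integrable_mult_right swap(2) Km K1)
  have "(LBINT \<rho>. gauss \<delta> \<rho> * ((c \<rho>)\<^sup>2 + (d \<rho>)\<^sup>2)) =
      2 * W * (LBINT y. \<zeta> y * (LBINT \<rho>. gauss \<delta> \<rho> * K \<rho> y))"
    unfolding e swap(1)[OF Km K1, symmetric] by simp
  also have "(LBINT y. \<zeta> y * (LBINT \<rho>. gauss \<delta> \<rho> * K \<rho> y)) \<le> (LBINT y. weight y * (pi / W))"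
  proof (rule integral_mono')
    show "integrable lborel (\<lambda>y. weight y * (pi / W))" using weight_integrable by simp
    show "\<zeta> y * (LBINT \<rho>. gauss \<delta> \<rho> * K \<rho> y) \<le> weight y * (pi / W)" for y
      using mult_mono[OF \<zeta>[of y] inner[of y]] weight_bounds(1)[of y]
      by (simp flip: abs_mult)
    show "0 \<le> weight y * (pi / W)" for y using weight_bounds(1)[of y] W by simp
  qed
  also have "\<dots> = pi" using W by (simp flip: W_def)
  finally show "(LBINT \<rho>. gauss \<delta> \<rho> * ((c \<rho>)\<^sup>2 + (d \<rho>)\<^sup>2)) \<le> 2 * pi * W"
    using W by (simp add: mult_ac)
qed

text \<open>The bound of \<open>bessel_gauss\<close> is independent of \<delta>, so Fatou's lemma
  along \<delta> = 1/(n + 1) removes the Gaussian.\<close>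

lemma bessel:
  fixes \<zeta> :: "real \<Rightarrow> real"
  assumes [measurable]: "\<zeta> \<in> borel_measurable borel" and \<zeta>: "\<And>y. \<bar>\<zeta> y\<bar> \<le> weight y"
  defines "c \<equiv> cos_transform \<zeta>" and "d \<equiv> sin_transform \<zeta>"
  shows "(\<integral>\<^sup>+\<rho>. ennreal ((c \<rho>)\<^sup>2 + (d \<rho>)\<^sup>2) \<partial>lborel) \<le> ennreal (2 * pi * (LBINT y. weight y))"
proof -
  note b = bessel_gauss[OF assms(1) \<zeta>, folded c_def d_def]
  have [measurable]: "c \<in> borel_measurable borel" "d \<in> borel_measurable borel" using b(5,6)[of 1] by auto
  let ?u = "\<lambda>n \<rho>. ennreal (gauss (inverse (real (Suc n))) \<rho> * ((c \<rho>)\<^sup>2 + (d \<rho>)\<^sup>2))"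
  have lim: "(\<lambda>n. ?u n \<rho>) \<longlonglongrightarrow> ennreal ((c \<rho>)\<^sup>2 + (d \<rho>)\<^sup>2)" for \<rho>
  proof -
    have "(\<lambda>n. gauss (inverse (real (Suc n))) \<rho> * ((c \<rho>)\<^sup>2 + (d \<rho>)\<^sup>2)) \<longlonglongrightarrow> exp (- (0 * (norm \<rho>)\<^sup>2)) * ((c \<rho>)\<^sup>2 + (d \<rho>)\<^sup>2)"
      unfolding gauss_def by (intro tendsto_intros LIMSEQ_inverse_real_of_nat)
    then show ?thesis by (intro tendsto_ennrealI) simp
  qed
  have "(\<integral>\<^sup>+\<rho>. ennreal ((c \<rho>)\<^sup>2 + (d \<rho>)\<^sup>2) \<partial>lborel) = (\<integral>\<^sup>+\<rho>. liminf (\<lambda>n. ?u n \<rho>) \<partial>lborel)"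
    by (intro nn_integral_cong lim_imp_Liminf[symmetric] lim) auto
  also have "\<dots> \<le> liminf (\<lambda>n. \<integral>\<^sup>+\<rho>. ?u n \<rho> \<partial>lborel)"
    by (intro nn_integral_liminf) measurable
  also have "\<dots> \<le> liminf (\<lambda>n::nat. ennreal (2 * pi * (LBINT y. weight y)))"
  proof (intro Liminf_mono always_eventually allI)
    fix n
    have pos: "inverse (real (Suc n)) > 0" by simp
    have "(\<integral>\<^sup>+\<rho>. ?u n \<rho> \<partial>lborel) = ennreal (LBINT \<rho>. gauss (inverse (real (Suc n))) \<rho> * ((c \<rho>)\<^sup>2 + (d \<rho>)\<^sup>2))"
      by (intro nn_integral_eq_integral b(2)[OF pos] AE_I2 mult_nonneg_nonneg less_imp_le[OF gauss_pos]
          add_nonneg_nonneg zero_le_power2)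
    also have "\<dots> \<le> ennreal (2 * pi * (LBINT y. weight y))"
      by (intro ennreal_leI b(1)[OF pos])
    finally show "(\<integral>\<^sup>+\<rho>. ?u n \<rho> \<partial>lborel) \<le> ennreal (2 * pi * (LBINT y. weight y))" .
  qed
  also have "\<dots> = ennreal (2 * pi * (LBINT y. weight y))" by (simp add: Liminf_const)
  finally show ?thesis .
qed

text \<open>Testing F against sgn F times the weight turns its weighted norm into a pairing of the k's with
  the transforms of a bounded function, to which Young's inequality and the Bessel inequality apply.\<close>

lemma weighted_transform_bound:
  assumes s: "1 \<le> s" "s < 3 / 2"
  shows "\<exists>M\<ge>0. \<forall>(k0::real^3 \<Rightarrow> real) k1 \<eta>. \<eta> > 0 \<longrightarrow> integrable lborel k0 \<longrightarrow> integrable lborel k1 \<longrightarrow>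
    integrable lborel (\<lambda>x. (norm x powr s)\<^sup>2 * ((k0 x)\<^sup>2 + (k1 x)\<^sup>2)) \<longrightarrow>
    (LBINT x. (norm x powr s)\<^sup>2 * ((k0 x)\<^sup>2 + (k1 x)\<^sup>2)) \<le> \<eta>\<^sup>2 \<longrightarrow>
    (LBINT y. weight y * \<bar>LBINT x. k0 x * cos (y * norm x) + k1 x * sin (y * norm x)\<bar>) \<le> M * \<eta>"
proof -
  define W where "W = (LBINT y. weight y)"
  have W: "W > 0" unfolding W_def by (rule weight_integral_pos)
  \<comment> \<open>The value of \<open>nn_integral_norm_powr\<close> for J = c^2 + d^2, with the
    sup bound 2 W^2 from \<open>bessel_gauss\<close> and the integral bound 2 pi W from
    \<open>bessel\<close>.\<close>
  define M where "M = 4 * pi * (2 * W\<^sup>2 / (3 - 2 * s) + 2 * pi * W)"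
  have M: "M \<ge> 0" unfolding M_def using s W by simp
  have "(LBINT y. weight y * \<bar>LBINT x. k0 x * cos (y * norm x) + k1 x * sin (y * norm x)\<bar>) \<le> (1 + M) / 2 * \<eta>"
    if \<eta>: "\<eta> > 0" and i0: "integrable lborel k0" and i1: "integrable lborel k1"
      and iQ: "integrable lborel (\<lambda>x. (norm x powr s)\<^sup>2 * ((k0 x)\<^sup>2 + (k1 x)\<^sup>2))"
      and Q: "(LBINT x. (norm x powr s)\<^sup>2 * ((k0 x)\<^sup>2 + (k1 x)\<^sup>2)) \<le> \<eta>\<^sup>2"
    for k0 k1 :: "real^3 \<Rightarrow> real" and \<eta>
  proof -
    have [measurable]: "k0 \<in> borel_measurable borel" "k1 \<in> borel_measurable borel" using i0 i1 by auto
    have ik: "integrable lborel (\<lambda>x. k0 x * cos (y * norm x))" "integrable lborel (\<lambda>x. k1 x * sin (y * norm x))" for y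
      by (rule Bochner_Integration.integrable_bound[OF i0], measurable, simp add: abs_mult mult_left_le)
         (rule Bochner_Integration.integrable_bound[OF i1], measurable, simp add: abs_mult mult_left_le)
    define F where "F = (\<lambda>y. LBINT x. k0 x * cos (y * norm x) + k1 x * sin (y * norm x))"
    have [measurable]: "F \<in> borel_measurable borel" unfolding F_def by measurable
    define \<zeta> where "\<zeta> = (\<lambda>y. sgn (F y) * weight y)"
    have [measurable]: "\<zeta> \<in> borel_measurable borel" unfolding \<zeta>_def by measurable
    have \<zeta>: "\<bar>\<zeta> y\<bar> \<le> weight y" for y
      using weight_bounds(1)[of y] by (simp add: \<zeta>_def abs_mult sgn_if)
    have i\<zeta>: "integrable lborel \<zeta>"
      by (rule Bochner_Integration.integrable_bound[OF weight_integrable])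
         (use \<zeta> weight_bounds(1) in \<open>auto intro!: AE_I2 simp: less_imp_le\<close>)
    define c where "c = cos_transform \<zeta>"
    define d where "d = sin_transform \<zeta>"
    note b = bessel_gauss(3-6)[OF _ \<zeta>, of 1, folded c_def d_def W_def, simplified]
    have [measurable]: "c \<in> borel_measurable borel" "d \<in> borel_measurable borel" using b by auto
    define H where "H = (\<lambda>\<rho>. (c \<rho>)\<^sup>2 + (d \<rho>)\<^sup>2)"
    have [measurable]: "H \<in> borel_measurable borel" unfolding H_def by measurable
    have H: "0 \<le> H \<rho>" "H \<rho> \<le> 2 * W\<^sup>2" for \<rho>
    proof -
      have "(c \<rho>)\<^sup>2 \<le> W\<^sup>2" "(d \<rho>)\<^sup>2 \<le> W\<^sup>2"
        using b(1)[of \<rho>] b(2)[of \<rho>] W by (simp_all add: abs_le_square_iff[symmetric])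
      then show "0 \<le> H \<rho>" "H \<rho> \<le> 2 * W\<^sup>2" by (auto simp: H_def)
    qed
    have nnH: "(\<integral>\<^sup>+x. ennreal (norm x powr (- 2 * s) * H (norm x)) \<partial>(lborel :: (real^3) measure)) \<le> ennreal M"
      unfolding M_def
      by (rule nn_integral_norm_powr[OF s _ H])
         (use bessel[OF _ \<zeta>, folded c_def d_def W_def] W in \<open>auto simp: H_def\<close>)
    have iH: "integrable lborel (\<lambda>x::real^3. norm x powr (- 2 * s) * H (norm x))"
      using nnH H(1) by (intro integrableI_nonneg) (auto simp: less_top[symmetric] top_unique intro: le_less_trans)
    have IH: "(LBINT x. norm (x::real^3) powr (- 2 * s) * H (norm x)) \<le> M"
      using nnH H(1) M by (subst (asm) nn_integral_eq_integral[OF iH]) auto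
    have sf: "sigma_finite_measure (lborel :: real measure)" "sigma_finite_measure (lborel :: (real^3) measure)"
      by (rule lborel.sigma_finite_measure_axioms)+
    note sw0 = integral_swap_dominated[OF sf i\<zeta> i0, where K = "\<lambda>y x. cos (y * norm x)"]
    note sw1 = integral_swap_dominated[OF sf i\<zeta> i1, where K = "\<lambda>y x. sin (y * norm x)"]
    note sw0' = integral_swap_dominated(2)[OF sf(2,1) i0 i\<zeta>, where K = "\<lambda>x y. cos (y * norm x)"]
    note sw1' = integral_swap_dominated(2)[OF sf(2,1) i1 i\<zeta>, where K = "\<lambda>x y. sin (y * norm x)"]
    have "(LBINT y. weight y * \<bar>F y\<bar>) = (LBINT y. \<zeta> y * F y)"
      by (intro Bochner_Integration.integral_cong) (auto simp: \<zeta>_def sgn_if)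
    also have "\<dots> = (LBINT y. \<zeta> y * (LBINT x. k0 x * cos (y * norm x)) + \<zeta> y * (LBINT x. k1 x * sin (y * norm x)))"
      unfolding F_def by (intro Bochner_Integration.integral_cong refl) (simp add: Bochner_Integration.integral_add ik distrib_left)
    also have "\<dots> = (LBINT y. \<zeta> y * (LBINT x. k0 x * cos (y * norm x))) + (LBINT y. \<zeta> y * (LBINT x. k1 x * sin (y * norm x)))"
      by (intro Bochner_Integration.integral_add sw0(2) sw1(2)) simp_all
    also have "\<dots> = (LBINT x. k0 x * c (norm x)) + (LBINT x. k1 x * d (norm x))"
      by (subst sw0(1), simp, simp, subst sw1(1)) (simp_all add: c_def d_def cos_transform_def sin_transform_def)
    also have "\<dots> = (LBINT x. k0 x * c (norm x) + k1 x * d (norm x))"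
      unfolding c_def d_def cos_transform_def sin_transform_def by (intro Bochner_Integration.integral_add[symmetric] sw0' sw1') simp_all
    also have "\<dots> \<le> (LBINT x. ((norm x powr s)\<^sup>2 * ((k0 x)\<^sup>2 + (k1 x)\<^sup>2)) / (2 * \<eta>) + (norm x powr (- 2 * s) * H (norm x)) * (\<eta> / 2))"
    proof (rule integral_mono_AE)
      show "integrable lborel (\<lambda>x. k0 x * c (norm x) + k1 x * d (norm x))"
        unfolding c_def d_def cos_transform_def sin_transform_def by (intro Bochner_Integration.integrable_add sw0' sw1') simp_all
      show "integrable lborel (\<lambda>x. ((norm x powr s)\<^sup>2 * ((k0 x)\<^sup>2 + (k1 x)\<^sup>2)) / (2 * \<eta>) + (norm x powr (- 2 * s) * H (norm x)) * (\<eta> / 2))"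
        by (intro Bochner_Integration.integrable_add integrable_divide iQ integrable_mult_left iH)
      have "k0 x * c (norm x) + k1 x * d (norm x) \<le>
         ((norm x powr s)\<^sup>2 * ((k0 x)\<^sup>2 + (k1 x)\<^sup>2)) / (2 * \<eta>) + (norm x powr (- 2 * s) * H (norm x)) * (\<eta> / 2)"
        if "x \<noteq> 0" for x
      proof -
        define A where "A = norm x powr s"
        have A: "A > 0" "norm x powr (- 2 * s) = 1 / A\<^sup>2"
          using that by (auto simp: A_def powr_minus powr_power field_simps)
        \<comment> \<open>The parameter \<eta> balances the two terms: after integration the first
          is at most \<eta>^2/(2 \<eta>) and the second at most M \<eta>/2, so the total is linear
          in \<eta>.\<close>
        have young: "u * v \<le> A\<^sup>2 * u\<^sup>2 / (2 * \<eta>) + v\<^sup>2 / A\<^sup>2 * (\<eta> / 2)" for u v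
        proof -
          have "0 \<le> (A\<^sup>2 * u - \<eta> * v)\<^sup>2 / (2 * \<eta> * A\<^sup>2)" using \<eta> by simp
          also have "\<dots> = A\<^sup>2 * u\<^sup>2 / (2 * \<eta>) + v\<^sup>2 / A\<^sup>2 * (\<eta> / 2) - u * v"
            using \<eta> A by (simp add: power2_eq_square field_simps)
          finally show ?thesis by simp
        qed
        show ?thesis
          using young[of "k0 x" "c (norm x)"] young[of "k1 x" "d (norm x)"]
          unfolding A(2) A_def[symmetric] H_def by (simp add: distrib_left distrib_right add_divide_distrib)
      qed
      then show "AE x in lborel. k0 x * c (norm x) + k1 x * d (norm x) \<le>
         ((norm x powr s)\<^sup>2 * ((k0 x)\<^sup>2 + (k1 x)\<^sup>2)) / (2 * \<eta>) + (norm x powr (- 2 * s) * H (norm x)) * (\<eta> / 2)"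
        using AE_lborel_singleton[of "0::real^3"] by (auto elim!: eventually_mono)
    qed
    also have "\<dots> = (LBINT x. (norm x powr s)\<^sup>2 * ((k0 x)\<^sup>2 + (k1 x)\<^sup>2)) / (2 * \<eta>) +
        (LBINT x. norm (x::real^3) powr (- 2 * s) * H (norm x)) * (\<eta> / 2)"
      by (subst Bochner_Integration.integral_add) (use iH in \<open>auto intro!: integrable_divide iQ integrable_mult_left\<close>)
    also have "\<dots> \<le> \<eta>\<^sup>2 / (2 * \<eta>) + M * (\<eta> / 2)"
      using \<eta> by (intro add_mono divide_right_mono Q mult_right_mono IH) auto
    also have "\<dots> = (1 + M) / 2 * \<eta>" using \<eta> by (simp add: power2_eq_square field_simps)
    finally show ?thesis unfolding F_def .
  qed
  then show ?thesis using M by (intro exI[of _ "(1 + M) / 2"]) auto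
qed

section \<open>The profile of a radial wave\<close>

text \<open>Geometric decay makes the increments absolutely summable almost everywhere, with an
  integrable sum W that dominates every G n; dominated convergence does the rest. Convergence is
  recorded only against bounded h, because the limit will be tested with Gaussians divided by
  \<open>weight\<close>.\<close>

lemma integrable_fast_Cauchy_limit:
  fixes G :: "nat \<Rightarrow> 'a \<Rightarrow> real"
  assumes G: "\<And>n. integrable M (G n)"
    and Cauchy: "\<And>n. (LINT x|M. \<bar>G (Suc n) x - G n x\<bar>) \<le> C * (1 / 2) ^ n"
  shows "\<exists>g. integrable M g \<and>
    (\<forall>h\<in>borel_measurable M. (\<exists>B. \<forall>x. \<bar>h x\<bar> \<le> B) \<longrightarrow>
      (\<lambda>n. LINT x|M. G n x * h x) \<longlonglongrightarrow> (LINT x|M. g x * h x))"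
proof -
  have [measurable]: "G n \<in> borel_measurable M" for n using G by auto
  define D where "D = (\<lambda>n x. G (Suc n) x - G n x)"
  have iD: "integrable M (D n)" for n unfolding D_def using G by auto
  have [measurable]: "D n \<in> borel_measurable M" for n using iD by auto
  have C: "0 \<le> C" using order_trans[OF _ Cauchy[of 0]] by simp
  have sD: "summable (\<lambda>n. LINT x|M. norm (D n x))"
    by (rule summable_comparison_test'[where g = "\<lambda>n. C * (1 / 2) ^ n"])
       (use Cauchy in \<open>auto simp: D_def intro!: summable_mult summable_geometric\<close>)
  have AE_sum: "AE x in M. summable (\<lambda>n. norm (D n x))"
  proof -
    have "(\<integral>\<^sup>+x. (\<Sum>n. ennreal (norm (D n x))) \<partial>M) = (\<Sum>n. \<integral>\<^sup>+x. ennreal (norm (D n x)) \<partial>M)"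
      by (rule nn_integral_suminf) measurable
    also have "\<dots> = (\<Sum>n. ennreal (LINT x|M. norm (D n x)))"
      using iD by (intro suminf_cong nn_integral_eq_integral) auto
    also have "\<dots> = ennreal (\<Sum>n. LINT x|M. norm (D n x))"
      by (intro suminf_ennreal2 sD) simp
    finally have "(\<integral>\<^sup>+x. (\<Sum>n. ennreal (norm (D n x))) \<partial>M) \<noteq> \<infinity>" by simp
    then have "AE x in M. (\<Sum>n. ennreal (norm (D n x))) \<noteq> \<infinity>"
      by (intro nn_integral_PInf_AE) measurable
    then show ?thesis
      by eventually_elim (auto intro: summable_suminf_not_top)
  qed
  define W where "W = (\<lambda>x. \<bar>G 0 x\<bar> + (\<Sum>n. norm (D n x)))"
  have iW: "integrable M W" unfolding W_def
    using AE_sum sD iD G by (intro Bochner_Integration.integrable_add integrable_suminf) auto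
  define g where "g = (\<lambda>x. G 0 x + (\<Sum>n. D n x))"
  have [measurable]: "g \<in> borel_measurable M" unfolding g_def by measurable
  have tel: "G n x = G 0 x + (\<Sum>i<n. D i x)" for n x
    by (simp add: D_def sum_lessThan_telescope[where f = "\<lambda>n. G n x"])
  have lim: "AE x in M. (\<lambda>n. G n x) \<longlonglongrightarrow> g x"
    using AE_sum
  proof eventually_elim
    case (elim x)
    then have "summable (\<lambda>n. D n x)" by (rule summable_norm_cancel)
    then have "(\<lambda>n. G 0 x + (\<Sum>i<n. D i x)) \<longlonglongrightarrow> G 0 x + (\<Sum>n. D n x)"
      by (intro tendsto_intros summable_LIMSEQ)
    then show ?case unfolding g_def by (simp flip: tel)
  qed
  have bd: "AE x in M. norm (G n x) \<le> W x" for n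
    using AE_sum
  proof eventually_elim
    case (elim x)
    have "norm (G n x) \<le> \<bar>G 0 x\<bar> + (\<Sum>i<n. norm (D i x))"
      unfolding tel[of n x] using norm_sum[of "\<lambda>i. D i x" "{..<n}"]
      by (intro order_trans[OF norm_triangle_ineq]) simp
    also have "(\<Sum>i<n. norm (D i x)) \<le> (\<Sum>n. norm (D n x))"
      by (intro sum_le_suminf elim) auto
    finally show ?case by (simp add: W_def)
  qed
  have "integrable M g"
    by (rule integrable_dominated_convergence[OF _ _ iW lim bd]) measurable
  moreover have "(\<lambda>n. LINT x|M. G n x * h x) \<longlonglongrightarrow> (LINT x|M. g x * h x)"
    if [measurable]: "h \<in> borel_measurable M" and B: "\<And>x. \<bar>h x\<bar> \<le> B" for h B
  proof (rule integral_dominated_convergence[where w = "\<lambda>x. W x * B"])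
    show "integrable M (\<lambda>x. W x * B)" using iW by simp
    show "AE x in M. (\<lambda>n. G n x * h x) \<longlonglongrightarrow> g x * h x"
      using lim by eventually_elim (intro tendsto_intros)
    show "AE x in M. norm (G n x * h x) \<le> W x * B" for n
      using bd[of n] by eventually_elim (auto simp: abs_mult intro!: mult_mono B intro: order_trans[OF abs_ge_zero])
  qed measurable
  ultimately show ?thesis by blast
qed

lemma integrable_mult_bounded:
  fixes g e :: "'a \<Rightarrow> real"
  assumes g: "integrable M g" and e [measurable]: "e \<in> borel_measurable M" and "\<And>x. \<bar>e x\<bar> \<le> 1"
  shows "integrable M (\<lambda>x. g x * e x)"
proof (rule Bochner_Integration.integrable_bound[OF g])
  have [measurable]: "g \<in> borel_measurable M" using g by auto
  show "(\<lambda>x. g x * e x) \<in> borel_measurable M" by measurable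
  show "AE x in M. norm (g x * e x) \<le> norm (g x)"
  proof (rule AE_I2)
    show "norm (g x * e x) \<le> norm (g x)" for x
      using mult_left_mono[OF assms(3)[of x] abs_ge_zero[of "g x"]] by (simp add: abs_mult)
  qed
qed

section \<open>Gaussian-smoothed profiles\<close>

lemma gauss_mult: "gauss a x * gauss b x = gauss (a + b) x"
  by (simp add: gauss_def algebra_simps flip: exp_add)

lemma gauss_le_1: "a \<ge> 0 \<Longrightarrow> gauss a x \<le> 1"
  by (simp add: gauss_def)

text \<open>Cauchy-Schwarz in the form 2uv <= u^2 + v^2: |x|^s k is in L^2, and so is |x|^(-s) times
  the Gaussian, since s < 3/2 makes |x|^(-2s) integrable at the origin.\<close>

lemma integrable_mult_gauss:
  fixes k :: "real^3 \<Rightarrow> real"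
  assumes s: "1 \<le> s" "s < 3 / 2" and [measurable]: "k \<in> borel_measurable borel"
    and k: "integrable lborel (\<lambda>x. (norm x powr s * k x)\<^sup>2)" and b: "b > 0"
  shows "integrable lborel (\<lambda>x. k x * gauss b x)"
proof -
  let ?J = "\<lambda>r::real. gauss (2 * b) r"
  have b2: "2 * b > 0" using b by simp
  have "(\<integral>\<^sup>+r. ennreal (?J r) \<partial>lborel) = ennreal (LBINT r. ?J r)"
    by (intro nn_integral_eq_integral gauss_real_integral b2 AE_I2 less_imp_le[OF gauss_pos])
  also have "(LBINT r. ?J r) = sqrt (pi / (2 * b))"
    using gauss_real_integral(2)[OF b2, of 0] by (simp add: gauss_def)
  finally have D: "(\<integral>\<^sup>+r. ennreal (?J r) \<partial>lborel) \<le> ennreal (sqrt (pi / (2 * b)))" by simp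
  have "(\<integral>\<^sup>+x. ennreal (norm x powr (- 2 * s) * ?J (norm x)) \<partial>(lborel :: (real^3) measure))
      \<le> ennreal (4 * pi * (1 / (3 - 2 * s) + sqrt (pi / (2 * b))))"
    by (rule nn_integral_norm_powr[OF s _ less_imp_le[OF gauss_pos] gauss_le_1 D]) (use b in auto)
  also have "\<dots> < \<infinity>" by simp
  finally have iJ: "integrable lborel (\<lambda>x::real^3. norm x powr (- 2 * s) * ?J (norm x))"
    by (intro integrableI_nonneg AE_I2 mult_nonneg_nonneg less_imp_le[OF gauss_pos]) auto
  show ?thesis
  proof (rule Bochner_Integration.integrable_bound)
    show "integrable lborel (\<lambda>x. (norm x powr s * k x)\<^sup>2 + norm x powr (- 2 * s) * ?J (norm x))"
      using k iJ by simp
    have "norm (k x * gauss b x) \<le> norm ((norm x powr s * k x)\<^sup>2 + norm x powr (- 2 * s) * ?J (norm x))"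
      if "x \<noteq> 0" for x
    proof -
      define A where "A = norm x powr s"
      have A: "A > 0" "norm x powr (- 2 * s) = 1 / A\<^sup>2"
        using that by (auto simp: A_def powr_minus powr_power field_simps)
      have J: "?J (norm x) = (gauss b x)\<^sup>2"
        by (simp add: gauss_def power2_eq_square flip: exp_add)
      have "2 * (\<bar>A * k x\<bar> * (gauss b x / A)) \<le> \<bar>A * k x\<bar>\<^sup>2 + (gauss b x / A)\<^sup>2"
        using sum_squares_bound[of "\<bar>A * k x\<bar>" "gauss b x / A"] by simp
      moreover have "\<bar>A * k x\<bar> * (gauss b x / A) = norm (k x * gauss b x)"
        using A gauss_pos[of b x] by (simp add: abs_mult)
      ultimately have "2 * norm (k x * gauss b x) \<le> (A * k x)\<^sup>2 + (gauss b x / A)\<^sup>2"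
        by (simp only: power2_abs)
      then have "norm (k x * gauss b x) \<le> (A * k x)\<^sup>2 + (gauss b x / A)\<^sup>2"
        using norm_ge_zero[of "k x * gauss b x"] by linarith
      then show ?thesis unfolding A(2) A_def[symmetric] J by (simp add: power_divide)
    qed
    then show "AE x in lborel. norm (k x * gauss b x) \<le> norm ((norm x powr s * k x)\<^sup>2 + norm x powr (- 2 * s) * ?J (norm x))"
      using AE_lborel_singleton[of "0::real^3"] by (auto elim!: eventually_mono)
  qed measurable
qed

text \<open>A Gaussian convergence factor makes the formal frequency integral for the profile
  absolutely convergent. The constant 1/(16 pi^3) is supplied in
  \<open>radial_wave_profile\<close>.\<close>

definition wave_smooth :: "(real^3 \<Rightarrow> real) \<Rightarrow> (real^3 \<Rightarrow> real) \<Rightarrow> real \<Rightarrow> real \<Rightarrow> real" where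
  "wave_smooth k0 k1 b y =
     (LBINT x. (k0 x * cos (y * norm x) + k1 x * sin (y * norm x)) * gauss b x)"

lemma gauss_real_sin_integral:
  fixes a t :: real
  assumes "a > 0"
  shows "(LBINT x. gauss a (x::real) * sin (t * x)) = 0"
proof -
  note i = real_gauss_fourier[OF assms]
  have "(LBINT x. gauss a (x::real) * sin (t * x)) = (LBINT x. Im (complex_of_real (gauss a x) * iexp (t * x)))"
    by (simp add: Im_exp)
  also have "\<dots> = Im (LBINT x. complex_of_real (gauss a x) * iexp (t * x))"
    by (rule integral_Im[OF i(1)])
  finally show ?thesis unfolding i(2) by (simp only: Im_complex_of_real)
qed

text \<open>Convolution with an even kernel multiplies cosine and sine of frequency \<rho> by the
  kernel's Fourier transform there; the sine integral that would mix them vanishes by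
  oddness.\<close>

lemma gauss_convolve_trig:
  fixes c t \<rho> :: real
  assumes "c > 0"
  shows "(LBINT y. gauss c (t - y) * cos (y * \<rho>)) = sqrt (pi / c) * gauss (1 / (4 * c)) \<rho> * cos (t * \<rho>)"
    and "(LBINT y. gauss c (t - y) * sin (y * \<rho>)) = sqrt (pi / c) * gauss (1 / (4 * c)) \<rho> * sin (t * \<rho>)"
proof -
  have i: "integrable lborel (\<lambda>x. gauss c x * cos (\<rho> * x))" "integrable lborel (\<lambda>x. gauss c x * sin (\<rho> * x))"
    by (rule integrable_mult_bounded[OF gauss_real_integral(1)[OF assms]]; simp)+
  have "(LBINT y. gauss c (t - y) * cos (y * \<rho>)) = (LBINT x. gauss c x * cos ((t - x) * \<rho>))"
    using lborel_integral_real_affine[of "-1" "\<lambda>y. gauss c (t - y) * cos (y * \<rho>)" t] by simp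
  also have "\<dots> = (LBINT x. cos (t * \<rho>) * (gauss c x * cos (\<rho> * x)) + sin (t * \<rho>) * (gauss c x * sin (\<rho> * x)))"
    by (intro Bochner_Integration.integral_cong refl) (simp add: left_diff_distrib cos_diff algebra_simps)
  also have "\<dots> = cos (t * \<rho>) * (LBINT x. gauss c x * cos (\<rho> * x)) + sin (t * \<rho>) * (LBINT x. gauss c x * sin (\<rho> * x))"
    using i by (subst Bochner_Integration.integral_add) simp_all
  finally show "(LBINT y. gauss c (t - y) * cos (y * \<rho>)) = sqrt (pi / c) * gauss (1 / (4 * c)) \<rho> * cos (t * \<rho>)"
    unfolding gauss_real_integral(2)[OF assms] gauss_real_sin_integral[OF assms] by (simp only: mult_zero_right add_0_right mult.commute)
  have "(LBINT y. gauss c (t - y) * sin (y * \<rho>)) = (LBINT x. gauss c x * sin ((t - x) * \<rho>))"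
    using lborel_integral_real_affine[of "-1" "\<lambda>y. gauss c (t - y) * sin (y * \<rho>)" t] by simp
  also have "\<dots> = (LBINT x. sin (t * \<rho>) * (gauss c x * cos (\<rho> * x)) - cos (t * \<rho>) * (gauss c x * sin (\<rho> * x)))"
    by (intro Bochner_Integration.integral_cong refl) (simp add: left_diff_distrib sin_diff algebra_simps)
  also have "\<dots> = sin (t * \<rho>) * (LBINT x. gauss c x * cos (\<rho> * x)) - cos (t * \<rho>) * (LBINT x. gauss c x * sin (\<rho> * x))"
    using i by (subst Bochner_Integration.integral_diff) simp_all
  finally show "(LBINT y. gauss c (t - y) * sin (y * \<rho>)) = sqrt (pi / c) * gauss (1 / (4 * c)) \<rho> * sin (t * \<rho>)"
    unfolding gauss_real_integral(2)[OF assms] gauss_real_sin_integral[OF assms] by (simp only: mult_zero_right diff_zero mult.commute)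
qed

lemma wave_smooth_measurable:
  assumes [measurable]: "k0 \<in> borel_measurable borel" "k1 \<in> borel_measurable borel"
  shows "wave_smooth k0 k1 b \<in> borel_measurable borel"
  unfolding wave_smooth_def[abs_def] by measurable

context
  fixes k0 k1 :: "real^3 \<Rightarrow> real" and s :: real
  assumes s: "1 \<le> s" "s < 3 / 2"
    and k0 [measurable]: "k0 \<in> borel_measurable borel" and k1 [measurable]: "k1 \<in> borel_measurable borel"
    and i0: "integrable lborel (\<lambda>x. (norm x powr s * k0 x)\<^sup>2)"
    and i1: "integrable lborel (\<lambda>x. (norm x powr s * k1 x)\<^sup>2)"
begin

lemma wave_smooth_integrable:
  assumes "b > 0"
  shows "integrable lborel (\<lambda>x. (k0 x * gauss b x) * cos (y * norm x))"
    and "integrable lborel (\<lambda>x. (k1 x * gauss b x) * sin (y * norm x))"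
proof -
  show "integrable lborel (\<lambda>x. (k0 x * gauss b x) * cos (y * norm x))"
    by (rule integrable_mult_bounded[OF integrable_mult_gauss[OF s k0 i0 assms]]) auto
  show "integrable lborel (\<lambda>x. (k1 x * gauss b x) * sin (y * norm x))"
    by (rule integrable_mult_bounded[OF integrable_mult_gauss[OF s k1 i1 assms]]) auto
qed

lemma wave_smooth_alt:
  assumes "b > 0"
  shows "wave_smooth k0 k1 b y =
    (LBINT x. (k0 x * gauss b x) * cos (y * norm x)) + (LBINT x. (k1 x * gauss b x) * sin (y * norm x))"
proof -
  have "wave_smooth k0 k1 b y =
    (LBINT x. (k0 x * gauss b x) * cos (y * norm x) + (k1 x * gauss b x) * sin (y * norm x))"
    unfolding wave_smooth_def by (intro Bochner_Integration.integral_cong refl) (simp add: algebra_simps)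
  also have "\<dots> = (LBINT x. (k0 x * gauss b x) * cos (y * norm x)) + (LBINT x. (k1 x * gauss b x) * sin (y * norm x))"
    by (rule Bochner_Integration.integral_add[OF wave_smooth_integrable[OF assms]])
  finally show ?thesis .
qed

text \<open>Convolution in y multiplies the integrand by a Gaussian in frequency, and Gaussian
  parameters add. So a can stay fixed while b tends to 0, which is how the identity reaches the
  limit profile.\<close>

lemma wave_smooth_convolve:
  assumes a: "a > 0" and b: "b > 0"
  shows "(LBINT y. wave_smooth k0 k1 b y * gauss (1 / (4 * a)) (t - y)) = sqrt (4 * pi * a) * wave_smooth k0 k1 (a + b) t"
proof -
  have c: "1 / (4 * a) > 0" using a by simp
  have sf: "sigma_finite_measure (lborel :: real measure)" "sigma_finite_measure (lborel :: (real^3) measure)"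
    by (rule lborel.sigma_finite_measure_axioms)+
  note sw0 = integral_swap_dominated[OF sf gauss_shift_integrable[OF c, of t] integrable_mult_gauss[OF s k0 i0 b],
      where K = "\<lambda>y x. cos (y * norm x)"]
  note sw1 = integral_swap_dominated[OF sf gauss_shift_integrable[OF c, of t] integrable_mult_gauss[OF s k1 i1 b],
      where K = "\<lambda>y x. sin (y * norm x)"]
  have g: "sqrt (pi / (1 / (4 * a))) * gauss (1 / (4 * (1 / (4 * a)))) (norm x) = sqrt (4 * pi * a) * gauss a x" for x :: "real^3"
    using a by (simp add: gauss_def mult_ac)
  have "(LBINT y. wave_smooth k0 k1 b y * gauss (1 / (4 * a)) (t - y)) =
    (LBINT y. gauss (1 / (4 * a)) (t - y) * (LBINT x. (k0 x * gauss b x) * cos (y * norm x)) +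
       gauss (1 / (4 * a)) (t - y) * (LBINT x. (k1 x * gauss b x) * sin (y * norm x)))"
    unfolding wave_smooth_alt[OF b] by (intro Bochner_Integration.integral_cong refl) (simp add: algebra_simps)
  also have "\<dots> = (LBINT y. gauss (1 / (4 * a)) (t - y) * (LBINT x. (k0 x * gauss b x) * cos (y * norm x))) +
       (LBINT y. gauss (1 / (4 * a)) (t - y) * (LBINT x. (k1 x * gauss b x) * sin (y * norm x)))"
    by (intro Bochner_Integration.integral_add sw0(2) sw1(2)) simp_all
  also have "\<dots> = (LBINT x. (k0 x * gauss b x) * (LBINT y. gauss (1 / (4 * a)) (t - y) * cos (y * norm x))) +
      (LBINT x. (k1 x * gauss b x) * (LBINT y. gauss (1 / (4 * a)) (t - y) * sin (y * norm x)))"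
    by (subst sw0(1), simp, simp, subst sw1(1)) simp_all
  also have "\<dots> = (LBINT x. sqrt (4 * pi * a) * ((k0 x * gauss (a + b) x) * cos (t * norm x))) +
      (LBINT x. sqrt (4 * pi * a) * ((k1 x * gauss (a + b) x) * sin (t * norm x)))"
    unfolding gauss_convolve_trig[OF c] g gauss_mult[symmetric]
    by (intro arg_cong2[where f = "(+)"] Bochner_Integration.integral_cong refl) simp_all
  also have "\<dots> = sqrt (4 * pi * a) * wave_smooth k0 k1 (a + b) t"
    using a b by (subst wave_smooth_alt) (simp_all add: distrib_left)
  finally show ?thesis .
qed

lemma wave_smooth_tendsto:
  assumes a: "a > 0" and b: "\<And>n. b n > 0" "b \<longlonglongrightarrow> 0"
  shows "(\<lambda>n. wave_smooth k0 k1 (a + b n) t) \<longlonglongrightarrow> wave_smooth k0 k1 a t"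
  unfolding wave_smooth_def
proof (rule integral_dominated_convergence[where w = "\<lambda>x. \<bar>k0 x * gauss a x\<bar> + \<bar>k1 x * gauss a x\<bar>"])
  show "integrable lborel (\<lambda>x. \<bar>k0 x * gauss a x\<bar> + \<bar>k1 x * gauss a x\<bar>)"
    by (intro Bochner_Integration.integrable_add integrable_abs integrable_mult_gauss[OF s] k0 k1 i0 i1 a)
  show "AE x in lborel. (\<lambda>n. (k0 x * cos (t * norm x) + k1 x * sin (t * norm x)) * gauss (a + b n) x) \<longlonglongrightarrow>
      (k0 x * cos (t * norm x) + k1 x * sin (t * norm x)) * gauss a x"
  proof (intro AE_I2 tendsto_intros)
    show "(\<lambda>n. gauss (a + b n) x) \<longlonglongrightarrow> gauss a x" for x :: "real^3"
    proof -
      have "(\<lambda>n. exp (- ((a + b n) * (norm x)\<^sup>2))) \<longlonglongrightarrow> exp (- ((a + 0) * (norm x)\<^sup>2))"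
        by (intro tendsto_intros b)
      then show ?thesis by (simp add: gauss_def)
    qed
  qed
  fix n
  have "norm ((k0 x * cos (t * norm x) + k1 x * sin (t * norm x)) * gauss (a + b n) x) \<le> \<bar>k0 x * gauss a x\<bar> + \<bar>k1 x * gauss a x\<bar>" for x
  proof -
    have "gauss (a + b n) x \<le> gauss a x"
      using gauss_mult[of a x "b n"] gauss_le_1[of "b n" x] gauss_pos[of a x] b(1)[of n]
      by (metis less_imp_le mult_left_le)
    moreover have "\<bar>k0 x * cos (t * norm x)\<bar> \<le> \<bar>k0 x\<bar>" "\<bar>k1 x * sin (t * norm x)\<bar> \<le> \<bar>k1 x\<bar>"
      by (simp_all add: abs_mult mult_left_le)
    then have "\<bar>k0 x * cos (t * norm x) + k1 x * sin (t * norm x)\<bar> \<le> \<bar>k0 x\<bar> + \<bar>k1 x\<bar>" by linarith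
    ultimately have "\<bar>k0 x * cos (t * norm x) + k1 x * sin (t * norm x)\<bar> * gauss (a + b n) x \<le> (\<bar>k0 x\<bar> + \<bar>k1 x\<bar>) * gauss a x"
      using gauss_pos[of "a + b n" x] by (intro mult_mono) auto
    then show ?thesis
      unfolding norm_mult real_norm_def abs_of_pos[OF gauss_pos] abs_mult by (simp only: distrib_right)
  qed
  then show "AE x in lborel. norm ((k0 x * cos (t * norm x) + k1 x * sin (t * norm x)) * gauss (a + b n) x) \<le> \<bar>k0 x * gauss a x\<bar> + \<bar>k1 x * gauss a x\<bar>"
    by simp
qed measurable

text \<open>By dominated convergence the integral of Q (1 - gauss)^2 tends to 0, so the scales can
  be taken as fast as desired. The rate (1/4)^n is that of a squared norm; its root (1/2)^n is what
  \<open>integrable_fast_Cauchy_limit\<close> sums.\<close>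

lemma gauss_scales_exist:
  defines "Q \<equiv> \<lambda>x. (norm x powr s)\<^sup>2 * ((k0 x)\<^sup>2 + (k1 x)\<^sup>2)"
  shows "\<exists>b. (\<forall>n. b n > 0) \<and> b \<longlonglongrightarrow> 0 \<and>
    (\<forall>n. integrable lborel (\<lambda>x. Q x * (1 - gauss (b n) x)\<^sup>2) \<and>
         (LBINT x. Q x * (1 - gauss (b n) x)\<^sup>2) \<le> (1 / 4) ^ n)"
proof -
  have iQ: "integrable lborel Q"
    using Bochner_Integration.integrable_add[OF i0 i1] by (simp add: Q_def power_mult_distrib distrib_left)
  have Q0: "Q x \<ge> 0" for x by (simp add: Q_def)
  have [measurable]: "Q \<in> borel_measurable borel" using iQ by auto
  have bd: "norm (Q x * (1 - gauss c x)\<^sup>2) \<le> Q x" if "c > 0" for x c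
  proof -
    have "(1 - gauss c x)\<^sup>2 \<le> 1"
      using gauss_pos[of c x] gauss_le_1[of c x] that by (intro power_le_one) auto
    then show ?thesis using Q0[of x] by (simp add: abs_mult mult_left_le)
  qed
  define e where "e = (\<lambda>i::nat. inverse (real (Suc i)))"
  have e: "e i > 0" for i by (simp add: e_def)
  have e0: "e \<longlonglongrightarrow> 0" unfolding e_def by (rule LIMSEQ_inverse_real_of_nat)
  have int: "integrable lborel (\<lambda>x. Q x * (1 - gauss (e i) x)\<^sup>2)" for i
    by (rule Bochner_Integration.integrable_bound[OF iQ]) (use bd[OF e] Q0 in auto)
  have "(\<lambda>i. LBINT x. Q x * (1 - gauss (e i) x)\<^sup>2) \<longlonglongrightarrow> (LINT x|(lborel :: (real^3) measure). (0::real))"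
  proof (rule integral_dominated_convergence[OF _ _ iQ])
    show "AE x in lborel. (\<lambda>i. Q x * (1 - gauss (e i) x)\<^sup>2) \<longlonglongrightarrow> 0"
    proof (rule AE_I2)
      fix x :: "real^3"
      have "(\<lambda>i. Q x * (1 - exp (- (e i * (norm x)\<^sup>2)))\<^sup>2) \<longlonglongrightarrow> Q x * (1 - exp (- (0 * (norm x)\<^sup>2)))\<^sup>2"
        by (intro tendsto_intros e0)
      then show "(\<lambda>i. Q x * (1 - gauss (e i) x)\<^sup>2) \<longlonglongrightarrow> 0" by (simp add: gauss_def)
    qed
    show "AE x in lborel. norm (Q x * (1 - gauss (e i) x)\<^sup>2) \<le> Q x" for i using bd[OF e] by simp
  qed measurable
  then have lim: "(\<lambda>i. LBINT x. Q x * (1 - gauss (e i) x)\<^sup>2) \<longlonglongrightarrow> 0" by simp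
  \<comment> \<open>The condition i >= n forces the chosen scales to tend to 0.\<close>
  have "\<exists>i\<ge>n. (LBINT x. Q x * (1 - gauss (e i) x)\<^sup>2) \<le> (1 / 4) ^ n" for n
  proof -
    have "\<forall>\<^sub>F i in sequentially. (LBINT x. Q x * (1 - gauss (e i) x)\<^sup>2) < (1 / 4) ^ n"
      by (rule order_tendstoD(2)[OF lim]) simp
    then have "\<forall>\<^sub>F i in sequentially. i \<ge> n \<and> (LBINT x. Q x * (1 - gauss (e i) x)\<^sup>2) < (1 / 4) ^ n"
      using eventually_ge_at_top[of n] by eventually_elim auto
    from eventually_happens'[OF sequentially_bot this] show ?thesis
      by (elim exE conjE) (rule exI, rule conjI, assumption, rule less_imp_le)
  qed
  then have "\<forall>n. \<exists>i. i \<ge> n \<and> (LBINT x. Q x * (1 - gauss (e i) x)\<^sup>2) \<le> (1 / 4) ^ n" by (rule allI)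
  from choice[OF this] obtain i
    where i: "\<And>n. i n \<ge> n" "\<And>n. (LBINT x. Q x * (1 - gauss (e (i n)) x)\<^sup>2) \<le> (1 / 4) ^ n"
    by auto
  have "filterlim i at_top sequentially"
    by (rule filterlim_at_top_mono[OF filterlim_ident]) (use i(1) in auto)
  then have "(\<lambda>n. e (i n)) \<longlonglongrightarrow> 0" by (rule filterlim_compose[OF e0])
  then show ?thesis by (intro exI[of _ "\<lambda>n. e (i n)"] conjI allI e int i(2))
qed

text \<open>Consecutive smoothed profiles differ by the transform of k0 and k1 times a difference of
  Gaussians, which \<open>weighted_transform_bound\<close> makes geometrically small in weighted
  L^1. The convolution identity then passes to the limit.\<close>

lemma wave_profile_exists:
  "\<exists>f. f \<in> borel_measurable borel \<and> integrable lborel (\<lambda>y. weight y * f y) \<and>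
     (\<forall>a>0. \<forall>t. (LBINT y. f y * gauss (1 / (4 * a)) (t - y)) = sqrt (4 * pi * a) * wave_smooth k0 k1 a t)"
proof -
  define Q where "Q = (\<lambda>x. (norm x powr s)\<^sup>2 * ((k0 x)\<^sup>2 + (k1 x)\<^sup>2))"
  have Q0: "Q x \<ge> 0" for x by (simp add: Q_def)
  from gauss_scales_exist obtain b where b': "\<forall>n. b n > 0" and b0: "b \<longlonglongrightarrow> 0"
    and bQ: "\<forall>n. integrable lborel (\<lambda>x. ((norm x powr s)\<^sup>2 * ((k0 x)\<^sup>2 + (k1 x)\<^sup>2)) * (1 - gauss (b n) x)\<^sup>2) \<and>
      (LBINT x. ((norm x powr s)\<^sup>2 * ((k0 x)\<^sup>2 + (k1 x)\<^sup>2)) * (1 - gauss (b n) x)\<^sup>2) \<le> (1 / 4) ^ n"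
    by (elim exE conjE) (rule that)
  note b = b'[rule_format] b0
  have iQ: "integrable lborel (\<lambda>x. Q x * (1 - gauss (b n) x)\<^sup>2)"
    and Qle: "(LBINT x. Q x * (1 - gauss (b n) x)\<^sup>2) \<le> (1 / 4) ^ n" for n
    unfolding Q_def by (rule bQ[THEN spec, THEN conjunct1], rule bQ[THEN spec, THEN conjunct2])
  have [measurable]: "Q \<in> borel_measurable borel" unfolding Q_def by measurable
  from weighted_transform_bound[OF s] obtain M where M: "M \<ge> 0"
    and bound': "\<forall>(h0::real^3 \<Rightarrow> real) h1 \<eta>. \<eta> > 0 \<longrightarrow> integrable lborel h0 \<longrightarrow> integrable lborel h1 \<longrightarrow>
      integrable lborel (\<lambda>x. (norm x powr s)\<^sup>2 * ((h0 x)\<^sup>2 + (h1 x)\<^sup>2)) \<longrightarrow>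
      (LBINT x. (norm x powr s)\<^sup>2 * ((h0 x)\<^sup>2 + (h1 x)\<^sup>2)) \<le> \<eta>\<^sup>2 \<longrightarrow>
      (LBINT y. weight y * \<bar>LBINT x. h0 x * cos (y * norm x) + h1 x * sin (y * norm x)\<bar>) \<le> M * \<eta>"
    by (elim exE conjE) (rule that)
  note bound = bound'[rule_format]
  note [measurable] = wave_smooth_measurable[OF k0 k1]
  \<comment> \<open>The weight is built into G so that plain L^1 completeness applies; f divides it
    out again.\<close>
  define G where "G = (\<lambda>n y. weight y * wave_smooth k0 k1 (b n) y)"
  have iG: "integrable lborel (G n)" for n
  proof (rule Bochner_Integration.integrable_bound)
    let ?C = "(LBINT x. \<bar>k0 x * gauss (b n) x\<bar> + \<bar>k1 x * gauss (b n) x\<bar>)"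
    show "integrable lborel (\<lambda>y. weight y * ?C)" using weight_integrable by simp
    have "\<bar>wave_smooth k0 k1 (b n) y\<bar> \<le> ?C" for y
      unfolding wave_smooth_def
    proof (intro order_trans[OF integral_abs_bound] integral_mono')
      show "integrable lborel (\<lambda>x. \<bar>k0 x * gauss (b n) x\<bar> + \<bar>k1 x * gauss (b n) x\<bar>)"
        by (intro Bochner_Integration.integrable_add integrable_abs integrable_mult_gauss[OF s] k0 k1 i0 i1 b)
      fix x
      have "\<bar>k0 x * cos (y * norm x)\<bar> \<le> \<bar>k0 x\<bar>" "\<bar>k1 x * sin (y * norm x)\<bar> \<le> \<bar>k1 x\<bar>"
        by (simp_all add: abs_mult mult_left_le)
      then have "\<bar>k0 x * cos (y * norm x) + k1 x * sin (y * norm x)\<bar> \<le> \<bar>k0 x\<bar> + \<bar>k1 x\<bar>" by linarith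
      then show "\<bar>(k0 x * cos (y * norm x) + k1 x * sin (y * norm x)) * gauss (b n) x\<bar> \<le> \<bar>k0 x * gauss (b n) x\<bar> + \<bar>k1 x * gauss (b n) x\<bar>"
        unfolding abs_mult abs_of_pos[OF gauss_pos] distrib_right[symmetric]
        by (intro mult_right_mono less_imp_le[OF gauss_pos])
    qed simp
    then show "AE y in lborel. norm (G n y) \<le> norm (weight y * ?C)"
      using weight_bounds(1)
      by (auto simp: G_def abs_mult less_imp_le intro!: AE_I2 mult_left_mono order_trans[OF _ abs_ge_self])
  qed (simp add: G_def)
  have Cauchy: "(LBINT y. \<bar>G (Suc n) y - G n y\<bar>) \<le> (2 * M) * (1 / 2) ^ n" for n
  proof -
    define D where "D = (\<lambda>x::real^3. gauss (b (Suc n)) x - gauss (b n) x)"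
    have [measurable]: "D \<in> borel_measurable borel" unfolding D_def by measurable
    have DQ: "Q x * (D x)\<^sup>2 \<le> 2 * (Q x * (1 - gauss (b (Suc n)) x)\<^sup>2) + 2 * (Q x * (1 - gauss (b n) x)\<^sup>2)" for x
    proof -
      \<comment> \<open>The right side exceeds the left by (2 - u - v)^2.\<close>
      have "(u - v)\<^sup>2 \<le> 2 * (1 - u)\<^sup>2 + 2 * (1 - v)\<^sup>2" for u v :: real
        using zero_le_power2[of "2 - u - v"] by (simp add: power2_eq_square algebra_simps)
      from mult_left_mono[OF this[of "gauss (b (Suc n)) x" "gauss (b n) x"] Q0[of x]]
      show ?thesis unfolding D_def by (simp only: distrib_left mult.left_commute)
    qed
    have iD2: "integrable lborel (\<lambda>x. 2 * (Q x * (1 - gauss (b (Suc n)) x)\<^sup>2) + 2 * (Q x * (1 - gauss (b n) x)\<^sup>2))"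
      using iQ by simp
    have iD: "integrable lborel (\<lambda>x. Q x * (D x)\<^sup>2)"
      by (rule Bochner_Integration.integrable_bound[OF iD2])
         (use DQ Q0 in \<open>auto intro!: AE_I2 order_trans[OF _ abs_ge_self]\<close>)
    have "(LBINT x. Q x * (D x)\<^sup>2) \<le> 2 * (LBINT x. Q x * (1 - gauss (b (Suc n)) x)\<^sup>2) + 2 * (LBINT x. Q x * (1 - gauss (b n) x)\<^sup>2)"
      using iQ by (intro order_trans[OF Bochner_Integration.integral_mono[OF iD iD2 DQ]]) simp
    also have "\<dots> \<le> 2 * (1 / 4) ^ Suc n + 2 * (1 / 4) ^ n"
      by (intro add_mono mult_left_mono Qle) auto
    also have "\<dots> \<le> 4 * (1 / 4) ^ n" by simp
    also have "\<dots> = (2 * (1 / 2) ^ n)\<^sup>2"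
    proof -
      have e: "(1 / 4 :: real) ^ n = (1 / 2) ^ n * (1 / 2) ^ n" by (simp flip: power_mult_distrib)
      show ?thesis unfolding e power2_eq_square by simp
    qed
    finally have le: "(LBINT x. Q x * (D x)\<^sup>2) \<le> (2 * (1 / 2) ^ n)\<^sup>2" .
    have QD: "(norm x powr s)\<^sup>2 * ((k0 x * D x)\<^sup>2 + (k1 x * D x)\<^sup>2) = Q x * (D x)\<^sup>2" for x
      by (simp add: Q_def power_mult_distrib algebra_simps)
    have iT: "integrable lborel (\<lambda>x. (k0 x * cos (y * norm x) + k1 x * sin (y * norm x)) * gauss c x)" if "c > 0" for c y
      using Bochner_Integration.integrable_add[OF wave_smooth_integrable[OF that]] by (simp add: algebra_simps)
    have diff: "G (Suc n) y - G n y = weight y * (LBINT x. (k0 x * D x) * cos (y * norm x) + (k1 x * D x) * sin (y * norm x))" for y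
    proof -
      have "(LBINT x. (k0 x * D x) * cos (y * norm x) + (k1 x * D x) * sin (y * norm x)) =
        (LBINT x. (k0 x * cos (y * norm x) + k1 x * sin (y * norm x)) * gauss (b (Suc n)) x -
           (k0 x * cos (y * norm x) + k1 x * sin (y * norm x)) * gauss (b n) x)"
        by (intro Bochner_Integration.integral_cong refl) (simp add: D_def algebra_simps)
      also have "\<dots> = wave_smooth k0 k1 (b (Suc n)) y - wave_smooth k0 k1 (b n) y"
        unfolding wave_smooth_def by (intro Bochner_Integration.integral_diff iT b)
      finally show ?thesis by (simp add: G_def right_diff_distrib)
    qed
    have ikD: "integrable lborel (\<lambda>x. k0 x * D x)" "integrable lborel (\<lambda>x. k1 x * D x)"
      unfolding D_def right_diff_distrib
      by (intro Bochner_Integration.integrable_diff integrable_mult_gauss[OF s] k0 k1 i0 i1 b)+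
    have "(LBINT y. weight y * \<bar>LBINT x. (k0 x * D x) * cos (y * norm x) + (k1 x * D x) * sin (y * norm x)\<bar>)
        \<le> M * (2 * (1 / 2) ^ n)"
      by (rule bound) (use ikD iD le in \<open>simp_all add: QD\<close>)
    then show ?thesis using weight_bounds(1) by (simp add: diff abs_mult less_imp_le mult_ac)
  qed
  from integrable_fast_Cauchy_limit[OF iG Cauchy] obtain g where g: "integrable lborel g"
    and lim': "\<forall>h\<in>borel_measurable lborel. (\<exists>B. \<forall>x. \<bar>h x\<bar> \<le> B) \<longrightarrow>
      (\<lambda>n. LBINT x. G n x * h x) \<longlonglongrightarrow> (LBINT x. g x * h x)"
    by (elim exE conjE) (rule that)
  note lim = lim'[THEN bspec, THEN mp, OF _ exI, OF _ allI]
  have [measurable]: "g \<in> borel_measurable borel" using g by auto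
  define f where "f = (\<lambda>y. g y / weight y)"
  have wf: "weight y * f y = g y" for y using weight_bounds(1)[of y] by (simp add: f_def)
  have "(LBINT y. f y * gauss (1 / (4 * a)) (t - y)) = sqrt (4 * pi * a) * wave_smooth k0 k1 a t" if a: "a > 0" for a t
  proof -
    \<comment> \<open>Dividing the test function by the weight compensates the weight in G. The
      quotient is bounded because y^2 is at most 2 t^2 + 2 (t - y)^2 and the Gaussian controls (t -
      y)^2.\<close>
    define h where "h = (\<lambda>y. gauss (1 / (4 * a)) (t - y) / weight y)"
    have [measurable]: "h \<in> borel_measurable borel" unfolding h_def by measurable
    have "\<bar>h y\<bar> \<le> 1 + 2 * t\<^sup>2 + 8 * a" for y
    proof -
      define z where "z = t - y"
      have gz: "z\<^sup>2 * gauss (1 / (4 * a)) z \<le> 4 * a"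
      proof -
        have "z\<^sup>2 / (4 * a) \<le> exp (z\<^sup>2 / (4 * a))" using exp_ge_add_one_self[of "z\<^sup>2 / (4 * a)"] by linarith
        then show ?thesis using a by (simp add: gauss_def exp_minus field_simps)
      qed
      have "y\<^sup>2 \<le> 2 * t\<^sup>2 + 2 * z\<^sup>2"
        unfolding z_def using zero_le_power2[of "y - 2 * t"] by (simp add: power2_eq_square algebra_simps)
      then have "gauss (1 / (4 * a)) z * (1 + y\<^sup>2) \<le> gauss (1 / (4 * a)) z * (1 + 2 * t\<^sup>2 + 2 * z\<^sup>2)"
        by (intro mult_left_mono less_imp_le[OF gauss_pos]) simp
      also have "\<dots> = gauss (1 / (4 * a)) z * (1 + 2 * t\<^sup>2) + 2 * (z\<^sup>2 * gauss (1 / (4 * a)) z)"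
        by (simp add: algebra_simps)
      also have "\<dots> \<le> 1 * (1 + 2 * t\<^sup>2) + 2 * (4 * a)"
        by (rule add_mono[OF mult_right_mono[OF gauss_le_1] mult_left_mono[OF gz]]) (use a in auto)
      finally have le: "gauss (1 / (4 * a)) z * (1 + y\<^sup>2) \<le> 1 + 2 * t\<^sup>2 + 8 * a" by simp
      have hy: "h y = gauss (1 / (4 * a)) z * (1 + y\<^sup>2)"
        by (simp only: h_def weight_def z_def divide_inverse inverse_inverse_eq)
      have "h y \<ge> 0" unfolding hy by (intro mult_nonneg_nonneg less_imp_le[OF gauss_pos]) simp
      then show ?thesis using le unfolding hy by simp
    qed
    note hb = this
    have "(\<lambda>n. LBINT x. G n x * h x) \<longlonglongrightarrow> (LBINT x. g x * h x)"
      by (rule lim[OF _ hb]) measurable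
    moreover have "G n x * h x = wave_smooth k0 k1 (b n) x * gauss (1 / (4 * a)) (t - x)" for n x
      using weight_bounds(1)[of x] by (simp add: G_def h_def)
    moreover have "g x * h x = f x * gauss (1 / (4 * a)) (t - x)" for x
      by (simp add: f_def h_def)
    ultimately have "(\<lambda>n. sqrt (4 * pi * a) * wave_smooth k0 k1 (a + b n) t) \<longlonglongrightarrow> (LBINT y. f y * gauss (1 / (4 * a)) (t - y))"
      by (simp add: wave_smooth_convolve[OF a b(1)])
    moreover have "(\<lambda>n. sqrt (4 * pi * a) * wave_smooth k0 k1 (a + b n) t) \<longlonglongrightarrow> sqrt (4 * pi * a) * wave_smooth k0 k1 a t"
      by (intro tendsto_intros wave_smooth_tendsto a b)
    ultimately show ?thesis by (rule LIMSEQ_unique)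
  qed
  moreover have "f \<in> borel_measurable borel" unfolding f_def by measurable
  ultimately show ?thesis
    using g by (intro exI[of _ f] conjI allI impI) (simp_all only: wf)
qed

end

section \<open>Test functions\<close>

definition smooth :: "(real \<Rightarrow> real) \<Rightarrow> bool" where
  "smooth f \<longleftrightarrow> (\<forall>k x. (deriv ^^ k) f field_differentiable at x)"

lemma smooth_deriv: "smooth f \<Longrightarrow> smooth (deriv f)"
  unfolding smooth_def using funpow_swap1[of deriv] by (metis funpow.simps(2) o_apply)

lemma smooth_differentiable: "smooth f \<Longrightarrow> f field_differentiable at x"
  unfolding smooth_def by (metis funpow_0)

lemma smooth_DERIV: "smooth f \<Longrightarrow> (f has_real_derivative deriv f x) (at x)"
  using smooth_differentiable by (simp add: DERIV_deriv_iff_field_differentiable)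

text \<open>A class that contains a derivative of each of its members contains all iterated
  derivatives. This spares formulas for the k-th derivative.\<close>

lemma smooth_coinduct:
  assumes "f \<in> S" and step: "\<And>g. g \<in> S \<Longrightarrow> \<exists>g'\<in>S. \<forall>x. (g has_real_derivative g' x) (at x)"
  shows "smooth f"
proof -
  have d: "deriv g \<in> S" "g field_differentiable at x" if g: "g \<in> S" for g x
  proof -
    obtain g' where g': "g' \<in> S" "\<And>x. (g has_real_derivative g' x) (at x)" using step[OF g] by blast
    then have "deriv g = g'" by (auto simp: fun_eq_iff intro: DERIV_imp_deriv)
    then show "deriv g \<in> S" using g' by simp
    show "g field_differentiable at x" using g'(2) by (auto simp: field_differentiable_def)
  qed
  have "(deriv ^^ k) f \<in> S" for k by (induction k) (use assms(1) d(1) in auto)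
  then show ?thesis unfolding smooth_def using d(2) by blast
qed

text \<open>By the Leibniz rule the derivative of a product is a sum of two products, so products
  become closed under differentiation only together with their sums, as
  \<open>smooth_coinduct\<close> needs.\<close>

inductive_set product_sums :: "(real \<Rightarrow> real) set" where
  mult: "smooth f \<Longrightarrow> smooth g \<Longrightarrow> (\<lambda>x. f x * g x) \<in> product_sums"
| add: "f \<in> product_sums \<Longrightarrow> g \<in> product_sums \<Longrightarrow> (\<lambda>x. f x + g x) \<in> product_sums"

lemma smooth_mult:
  assumes "smooth f" "smooth g"
  shows "smooth (\<lambda>x. f x * g x)"
proof (rule smooth_coinduct)
  show "(\<lambda>x. f x * g x) \<in> product_sums" using assms by (rule product_sums.mult)
  fix h assume "h \<in> product_sums"
  then show "\<exists>h'\<in>product_sums. \<forall>x. (h has_real_derivative h' x) (at x)"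
  proof induction
    case (mult f g)
    have "(\<lambda>x. deriv f x * g x + f x * deriv g x) \<in> product_sums"
      by (intro product_sums.intros smooth_deriv mult)
    moreover have "((\<lambda>x. f x * g x) has_real_derivative deriv f x * g x + f x * deriv g x) (at x)" for x
      using smooth_DERIV[OF mult(1)] smooth_DERIV[OF mult(2)]
      by (auto intro!: derivative_eq_intros)
    ultimately show ?case by (intro bexI[of _ "\<lambda>x. deriv f x * g x + f x * deriv g x"] allI)
  next
    case (add f g)
    then obtain f' g' where "f' \<in> product_sums" "\<And>x. (f has_real_derivative f' x) (at x)"
      "g' \<in> product_sums" "\<And>x. (g has_real_derivative g' x) (at x)" by blast
    then show ?case
      by (intro bexI[of _ "\<lambda>x. f' x + g' x"]) (auto intro!: derivative_eq_intros product_sums.add)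
  qed
qed

lemma smooth_affine:
  assumes "smooth f"
  shows "smooth (\<lambda>x. f (a + b * x))"
\<comment> \<open>The factor c collects the powers of b that the chain rule produces.\<close>
proof (rule smooth_coinduct[where S = "{(\<lambda>x. c * g (a + b * x)) |c g. smooth g}"])
  have "(\<lambda>x. f (a + b * x)) = (\<lambda>x. 1 * f (a + b * x))" by simp
  then show "(\<lambda>x. f (a + b * x)) \<in> {(\<lambda>x. c * g (a + b * x)) |c g. smooth g}"
    using assms by blast
  fix h assume "h \<in> {(\<lambda>x. c * g (a + b * x)) |c g. smooth g}"
  then obtain c g where h: "h = (\<lambda>x. c * g (a + b * x))" "smooth g" by blast
  have "(h has_real_derivative (c * b) * deriv g (a + b * x)) (at x)" for x
  proof -
    have "((\<lambda>x. a + b * x) has_real_derivative b) (at x)" by (auto intro!: derivative_eq_intros)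
    from DERIV_cmult[OF DERIV_chain2[OF smooth_DERIV[OF h(2)] this], of c] show ?thesis
      unfolding h by (simp add: mult_ac)
  qed
  then show "\<exists>h'\<in>{(\<lambda>x. c * g (a + b * x)) |c g. smooth g}. \<forall>x. (h has_real_derivative h' x) (at x)"
    using smooth_deriv[OF h(2)] by (intro bexI[of _ "\<lambda>x. (c * b) * deriv g (a + b * x)"]) auto
qed

section \<open>Smooth cutoffs built from exp (-1/x)\<close>

definition flat :: "real poly \<Rightarrow> real \<Rightarrow> real" where
  "flat p x = (if x > 0 then poly p (inverse x) * exp (- inverse x) else 0)"

lemma poly_exp_at_infinity:
  fixes p :: "real poly"
  shows "((\<lambda>y. poly p y * exp (- y)) \<longlongrightarrow> 0) at_top"
proof -
  have "((\<lambda>y. \<Sum>i\<le>degree p. coeff p i * (y ^ i / exp y)) \<longlongrightarrow> (\<Sum>i\<le>degree p. coeff p i * 0)) at_top"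
    by (intro tendsto_sum tendsto_mult tendsto_const tendsto_power_div_exp_0)
  also have "(\<lambda>y. \<Sum>i\<le>degree p. coeff p i * (y ^ i / exp y)) = (\<lambda>y. poly p y * exp (- y))"
    by (simp add: fun_eq_iff poly_altdef sum_distrib_right exp_minus divide_inverse mult.assoc)
  finally show ?thesis by simp
qed

text \<open>In y = 1/x the derivative is - y^2 d/dy, which maps p(y) exp (- y) to y^2 (p - p') exp
  (- y); so the range of \<open>flat\<close> is closed under differentiation. At 0 the right
  difference quotient is y p(y) exp (- y) with y tending to infinity.\<close>

lemma flat_DERIV:
  "(flat p has_real_derivative flat (monom 1 2 * (p - pderiv p)) x) (at x)"
proof -
  consider "x > 0" | "x < 0" | "x = 0" by linarith
  then show ?thesis
  proof cases
    case 1
    have "((\<lambda>x. poly p (inverse x) * exp (- inverse x)) has_real_derivative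
        flat (monom 1 2 * (p - pderiv p)) x) (at x)"
      using 1 by (auto intro!: derivative_eq_intros simp: flat_def poly_monom power2_eq_square field_simps)
    then show ?thesis
      by (rule has_field_derivative_transform_within_open[of _ _ _ "{0<..}"]) (use 1 in \<open>auto simp: flat_def\<close>)
  next
    case 2
    have "((\<lambda>x. 0) has_real_derivative flat (monom 1 2 * (p - pderiv p)) x) (at x)"
      using 2 by (simp add: flat_def)
    then show ?thesis
      by (rule has_field_derivative_transform_within_open[of _ _ _ "{..<0}"]) (use 2 in \<open>auto simp: flat_def\<close>)
  next
    case 3
    have "((\<lambda>h. flat p h / h) \<longlongrightarrow> 0) (at 0)"
    proof (rule filterlim_split_at)
      have "((\<lambda>h. poly (pCons 0 p) (inverse h) * exp (- inverse h)) \<longlongrightarrow> 0) (at_right 0)"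
        by (rule filterlim_compose[OF poly_exp_at_infinity filterlim_inverse_at_top_right])
      moreover have "\<forall>\<^sub>F h in at_right 0. poly (pCons 0 p) (inverse h) * exp (- inverse h) = flat p h / h"
        by (auto simp: eventually_at_filter flat_def field_simps)
      ultimately show "((\<lambda>h. flat p h / h) \<longlongrightarrow> 0) (at_right 0)" by (rule Lim_transform_eventually)
      have "\<forall>\<^sub>F h in at_left 0. 0 = flat p h / h"
        by (auto simp: eventually_at_filter flat_def)
      then show "((\<lambda>h. flat p h / h) \<longlongrightarrow> 0) (at_left 0)"
        by (rule Lim_transform_eventually[OF tendsto_const])
    qed
    then show ?thesis using 3 by (simp add: DERIV_def flat_def)
  qed
qed

lemma smooth_flat: "smooth (flat p)"
  by (rule smooth_coinduct[where S = "range flat"]) (use flat_DERIV in blast)+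

text \<open>As n grows, exp (- 1/(n x)) tends to 1 for each x > 0. The product thus approximates the
  indicator of (c, d) from below, with no normalising constant.\<close>

definition bump :: "real \<Rightarrow> real \<Rightarrow> nat \<Rightarrow> real \<Rightarrow> real" where
  "bump c d n x = flat 1 (real (Suc n) * (x - c)) * flat 1 (real (Suc n) * (d - x))"

lemma bump_outside: "x \<notin> {c<..<d} \<Longrightarrow> bump c d n x = 0"
  by (auto simp: bump_def flat_def zero_less_mult_iff)

lemma bump_test_fun: assumes "c > 0" shows "test_fun (bump c d n)"
proof -
  have "smooth (\<lambda>x. flat 1 (real (Suc n) * (x - c)))" "smooth (\<lambda>x. flat 1 (real (Suc n) * (d - x)))"
    using smooth_affine[OF smooth_flat, of 1 "- real (Suc n) * c" "real (Suc n)"]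
      smooth_affine[OF smooth_flat, of 1 "real (Suc n) * d" "- real (Suc n)"]
    by (simp_all add: algebra_simps)
  then have "smooth (bump c d n)"
    unfolding bump_def[abs_def] by (rule smooth_mult)
  moreover have "bump c d n r = 0" if "r \<notin> {c..d}" for r
    using that by (intro bump_outside) auto
  ultimately show ?thesis unfolding test_fun_def smooth_def using assms by blast
qed

lemma bump_bounds: "0 \<le> bump c d n x" "bump c d n x \<le> 1"
proof -
  have "0 \<le> flat 1 y" "flat 1 y \<le> 1" for y by (simp_all add: flat_def)
  then show "0 \<le> bump c d n x" "bump c d n x \<le> 1"
    by (simp_all add: bump_def mult_le_one)
qed

lemma bump_tendsto: "(\<lambda>n. bump c d n x) \<longlonglongrightarrow> indicator {c<..<d} x"
proof (cases "x \<in> {c<..<d}")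
  case True
  have e: "(\<lambda>n. exp (- inverse (real (Suc n) * y))) \<longlonglongrightarrow> 1" if "y > 0" for y
  proof -
    have "(\<lambda>n. exp (- (inverse (real (Suc n)) * inverse y))) \<longlonglongrightarrow> exp (- (0 * inverse y))"
      by (intro tendsto_intros LIMSEQ_inverse_real_of_nat)
    then show ?thesis by simp
  qed
  have b: "bump c d n x = exp (- inverse (real (Suc n) * (x - c))) * exp (- inverse (real (Suc n) * (d - x)))" for n
  proof -
    have "real (Suc n) * (x - c) > 0" "real (Suc n) * (d - x) > 0" using True by auto
    then show ?thesis unfolding bump_def flat_def by simp
  qed
  have "(\<lambda>n. bump c d n x) \<longlonglongrightarrow> 1 * 1"
    unfolding b by (intro tendsto_mult e) (use True in auto)
  then show ?thesis using True by simp
next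
  case False
  have "bump c d n x = 0" for n using False by (rule bump_outside)
  then show ?thesis using False by simp
qed

section \<open>The fundamental lemma of the calculus of variations on the half-line\<close>

lemma test_fun_measurable: "test_fun \<psi> \<Longrightarrow> \<psi> \<in> borel_measurable borel"
  using smooth_DERIV[of \<psi>]
  by (intro borel_measurable_continuous_onI DERIV_continuous_on[where D = "deriv \<psi>"])
     (auto simp: test_fun_def smooth_def intro: has_field_derivative_at_within)

text \<open>The positive and negative parts of z define two measures that agree on open intervals
  and hence everywhere; equal measures have densities equal almost everywhere.\<close>

lemma set_integral_zero_imp_AE:
  fixes z :: "real \<Rightarrow> real"
  assumes z: "set_integrable lborel {a..b} z"
    and zero: "\<And>c d. a < c \<Longrightarrow> c \<le> d \<Longrightarrow> d < b \<Longrightarrow> (LBINT x. z x * indicator {c<..<d} x) = 0"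
  shows "AE x in lborel. x \<in> {a<..<b} \<longrightarrow> z x = 0"
proof -
  define g where "g = (\<lambda>x. indicator {a<..<b} x * z x)"
  have ig0: "integrable lborel (\<lambda>x. indicator {a..b} x * z x)" using z by (simp add: set_integrable_def)
  have eq: "indicator {a<..<b} x * (indicator {a..b} x * z x) = g x" for x by (simp add: g_def indicator_def)
  have ig: "integrable lborel g"
    using integrable_mult_indicator[OF _ ig0, of "{a<..<b}"] by (simp add: eq)
  have [measurable]: "g \<in> borel_measurable borel" using ig by auto
  have int: "(LBINT x. g x * indicator {c<..<d} x) = 0" for c d
  proof (cases "max a c < min b d")
    case True
    define l where "l = max a c" define u where "u = min b d"
    \<comment> \<open>A third of the length keeps cn below dn for every n, while both endpoints stay
      strictly inside (a, b), where \<open>zero\<close> applies.\<close>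
    define e1 where "e1 = (u - l) / 3"
    have e1: "e1 > 0" "l + e1 < u - e1" using True by (auto simp: e1_def l_def u_def field_simps)
    define cn where "cn = (\<lambda>n. l + e1 * inverse (real (Suc n)))"
    define dn where "dn = (\<lambda>n. u - e1 * inverse (real (Suc n)))"
    have inv: "0 < inverse (real (Suc n))" "inverse (real (Suc n)) \<le> 1" for n by (auto simp: field_simps)
    have cd: "l < cn n" "cn n \<le> l + e1" "u - e1 \<le> dn n" "dn n < u" for n
      using inv[of n] e1 by (auto simp: cn_def dn_def intro: mult_left_le)
    have "cn \<longlonglongrightarrow> l + e1 * 0" "dn \<longlonglongrightarrow> u - e1 * 0"
      unfolding cn_def dn_def by (intro tendsto_intros LIMSEQ_inverse_real_of_nat)+
    then have lim: "cn \<longlonglongrightarrow> l" "dn \<longlonglongrightarrow> u" by simp_all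
    have "(\<lambda>n. LBINT x. g x * indicator {cn n<..<dn n} x) \<longlonglongrightarrow> (LBINT x. g x * indicator {l<..<u} x)"
    proof (rule integral_dominated_convergence[where w = "\<lambda>x. \<bar>g x\<bar>"])
      show "integrable lborel (\<lambda>x. \<bar>g x\<bar>)" using ig by simp
      show "AE x in lborel. norm (g x * indicator {cn n<..<dn n} x) \<le> \<bar>g x\<bar>" for n
        by (auto simp: indicator_def)
      show "AE x in lborel. (\<lambda>n. g x * indicator {cn n<..<dn n} x) \<longlonglongrightarrow> g x * indicator {l<..<u} x"
      proof (rule AE_I2)
        fix x
        have "\<forall>\<^sub>F n in sequentially. g x * indicator {l<..<u} x = g x * indicator {cn n<..<dn n} x"
        proof (cases "x \<in> {l<..<u}")
          case True
          then have "\<forall>\<^sub>F n in sequentially. cn n < x" "\<forall>\<^sub>F n in sequentially. x < dn n"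
            using order_tendstoD[OF lim(1)] order_tendstoD[OF lim(2)] by auto
          then show ?thesis by eventually_elim (use True in simp)
        next
          case False
          then have "x \<notin> {cn n<..<dn n}" for n using cd(1)[of n] cd(4)[of n] by auto
          then show ?thesis using False by simp
        qed
        then show "(\<lambda>n. g x * indicator {cn n<..<dn n} x) \<longlonglongrightarrow> g x * indicator {l<..<u} x"
          by (rule Lim_transform_eventually[OF tendsto_const])
      qed
    qed measurable
    moreover have "(LBINT x. g x * indicator {cn n<..<dn n} x) = 0" for n
    proof -
      have "(\<lambda>x. g x * indicator {cn n<..<dn n} x) = (\<lambda>x. z x * indicator {cn n<..<dn n} x)"
        using cd(1,4)[of n] by (auto simp: fun_eq_iff g_def indicator_def l_def u_def)
      moreover have "(LBINT x. z x * indicator {cn n<..<dn n} x) = 0"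
      proof (rule zero)
        show "a < cn n" using cd(1)[of n] by (simp add: l_def)
        show "dn n < b" using cd(4)[of n] by (simp add: u_def)
        show "cn n \<le> dn n" using cd(2,3)[of n] e1 by linarith
      qed
      ultimately show ?thesis by (simp only:)
    qed
    ultimately have "(LBINT x. g x * indicator {l<..<u} x) = 0"
      by (simp add: LIMSEQ_const_iff)
    moreover have "(\<lambda>x. g x * indicator {c<..<d} x) = (\<lambda>x. g x * indicator {l<..<u} x)"
      by (auto simp: fun_eq_iff g_def indicator_def l_def u_def)
    ultimately show ?thesis by (simp only:)
  next
    case False
    then have "(\<lambda>x. g x * indicator {c<..<d} x) = (\<lambda>x. 0)" by (auto simp: fun_eq_iff g_def indicator_def)
    then show ?thesis by simp
  qed
  define P where "P = density lborel (\<lambda>x. ennreal (g x))"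
  define N where "N = density lborel (\<lambda>x. ennreal (- g x))"
  have pos: "integrable lborel (\<lambda>x. max 0 (g x))" "integrable lborel (\<lambda>x. max 0 (- g x))"
    using ig by auto
  have em: "emeasure (density lborel (\<lambda>x. ennreal (h x))) {c<..<d} = ennreal (LBINT x. max 0 (h x) * indicator {c<..<d} x)"
    if "integrable lborel (\<lambda>x. max 0 (h x))" and [measurable]: "h \<in> borel_measurable borel" for h :: "real \<Rightarrow> real" and c d
  proof -
    have i: "integrable lborel (\<lambda>x. max 0 (h x) * indicator {c<..<d} x)"
      using integrable_mult_indicator[OF _ that(1), of "{c<..<d}"] by (simp add: mult.commute)
    have "emeasure (density lborel (\<lambda>x. ennreal (h x))) {c<..<d} = (\<integral>\<^sup>+x. ennreal (max 0 (h x) * indicator {c<..<d} x) \<partial>lborel)"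
      by (subst emeasure_density) (auto intro!: nn_integral_cong simp: indicator_def max_def ennreal_neg)
    also have "\<dots> = ennreal (LBINT x. max 0 (h x) * indicator {c<..<d} x)"
      by (rule nn_integral_eq_integral[OF i]) (auto simp: indicator_def)
    finally show ?thesis .
  qed
  have "P = N"
  proof (rule measure_eqI_generator_eq[where E = "range (\<lambda>(c, d). {c<..<d})" and \<Omega> = UNIV and A = "\<lambda>n. {- real n<..<real n}"])
    show "Int_stable (range (\<lambda>(c, d). {c<..<d :: real}))"
    proof (rule Int_stableI)
      fix A B :: "real set" assume "A \<in> range (\<lambda>(c, d). {c<..<d})" "B \<in> range (\<lambda>(c, d). {c<..<d})"
      then obtain c d c' d' where "A = {c<..<d}" "B = {c'<..<d'}" by auto
      then have "A \<inter> B = (\<lambda>(c, d). {c<..<d}) (max c c', min d d')" by auto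
      then show "A \<inter> B \<in> range (\<lambda>(c, d). {c<..<d})" by blast
    qed
    fix X assume "X \<in> range (\<lambda>(c, d). {c<..<d :: real})"
    then obtain c d where X: "X = {c<..<d}" by auto
    have i: "integrable lborel (\<lambda>x. max 0 (g x) * indicator {c<..<d} x)" "integrable lborel (\<lambda>x. max 0 (- g x) * indicator {c<..<d} x)"
      using integrable_mult_indicator[OF _ pos(1), of "{c<..<d}"] integrable_mult_indicator[OF _ pos(2), of "{c<..<d}"]
      by (simp_all add: mult.commute)
    have "(LBINT x. max 0 (g x) * indicator {c<..<d} x) - (LBINT x. max 0 (- g x) * indicator {c<..<d} x) =
       (LBINT x. max 0 (g x) * indicator {c<..<d} x - max 0 (- g x) * indicator {c<..<d} x)"
      by (rule Bochner_Integration.integral_diff[OF i, symmetric])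
    also have "\<dots> = (LBINT x. g x * indicator {c<..<d} x)"
      by (intro Bochner_Integration.integral_cong refl) (auto simp: max_def indicator_def)
    also have "\<dots> = 0" by (rule int)
    finally show "emeasure P X = emeasure N X"
      unfolding P_def N_def X by (simp add: em pos)
  next
    show "emeasure P {- real n<..<real n} \<noteq> \<infinity>" for n
      unfolding P_def by (simp add: em pos)
    have "box = (\<lambda>c d :: real. {c<..<d})" by (simp add: fun_eq_iff box_real)
    note borel_eq = borel_eq_box[where 'a = real, unfolded this]
    show "sets P = sigma_sets UNIV (range (\<lambda>(c, d). {c<..<d :: real}))"
      "sets N = sigma_sets UNIV (range (\<lambda>(c, d). {c<..<d :: real}))"
      unfolding P_def N_def sets_density sets_lborel by (subst borel_eq, simp)+
    show "(\<Union>n. {- real n<..<real n}) = UNIV"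
      by (auto intro: reals_Archimedean2 simp: set_eq_iff) (metis abs_less_iff minus_less_iff reals_Archimedean2)
  qed auto
  then have "AE x in lborel. ennreal (g x) = ennreal (- g x)"
    unfolding P_def N_def by (subst (asm) sigma_finite_measure.density_unique_iff[OF lborel.sigma_finite_measure_axioms]) auto
  then show ?thesis
  proof eventually_elim
    case (elim x)
    have "g x = 0"
      using elim by (cases "g x \<ge> 0") (auto simp: ennreal_neg ennreal_eq_0_iff dest: sym)
    then show ?case by (simp add: g_def indicator_def split: if_splits)
  qed
qed

text \<open>Dominated convergence replaces bumps by indicators of intervals, and
  \<open>set_integral_zero_imp_AE\<close> concludes on each bounded interval away from 0.\<close>

lemma loc_integrable_test_zero:
  assumes z: "loc_integrable z" and zero: "\<And>\<psi>. test_fun \<psi> \<Longrightarrow> (LBINT r. z r * \<psi> r) = 0"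
  shows "AE r in lborel. r > 0 \<longrightarrow> z r = 0"
proof -
  have ab: "AE x in lborel. x \<in> {a<..<b} \<longrightarrow> z x = 0" if a: "a > 0" for a b
  proof (rule set_integral_zero_imp_AE)
    show zab: "set_integrable lborel {a..b} z" using z a by (simp add: loc_integrable_def)
    then have i: "integrable lborel (\<lambda>x. indicator {a..b} x * z x)" by (simp add: set_integrable_def)
    fix c d assume cd: "a < c" "c \<le> d" "d < b"
    have c: "c > 0" using a cd by simp
    have t: "test_fun (bump c d n)" for n using c by (rule bump_test_fun)
    note [measurable] = test_fun_measurable[OF t]
    have [measurable]: "(\<lambda>x. indicator {a..b} x * z x) \<in> borel_measurable borel" using i by auto
    have out: "bump c d n x = 0" if "x \<notin> {a..b}" for n x
      using that cd by (intro bump_outside) auto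
    have "(\<lambda>n. LBINT x. (indicator {a..b} x * z x) * bump c d n x) \<longlonglongrightarrow>
        (LBINT x. (indicator {a..b} x * z x) * indicator {c<..<d} x)"
    proof (rule integral_dominated_convergence[where w = "\<lambda>x. \<bar>indicator {a..b} x * z x\<bar>"])
      show "integrable lborel (\<lambda>x. \<bar>indicator {a..b} x * z x\<bar>)" using i by (rule integrable_abs)
      show "AE x in lborel. (\<lambda>n. (indicator {a..b} x * z x) * bump c d n x) \<longlonglongrightarrow> (indicator {a..b} x * z x) * indicator {c<..<d} x"
        by (intro AE_I2 tendsto_intros bump_tendsto)
      show "AE x in lborel. norm ((indicator {a..b} x * z x) * bump c d n x) \<le> \<bar>indicator {a..b} x * z x\<bar>" for n
      proof (rule AE_I2)
        fix x
        show "norm ((indicator {a..b} x * z x) * bump c d n x) \<le> \<bar>indicator {a..b} x * z x\<bar>"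
          using bump_bounds[of c d n x] mult_left_le[of "bump c d n x" "\<bar>indicator {a..b} x * z x\<bar>"]
          by (simp add: abs_mult)
      qed
    qed measurable
    moreover have "(LBINT x. (indicator {a..b} x * z x) * bump c d n x) = 0" for n
    proof -
      have "(\<lambda>x. (indicator {a..b} x * z x) * bump c d n x) = (\<lambda>x. z x * bump c d n x)"
        using out[of _ n] by (auto simp: fun_eq_iff indicator_def)
      then show ?thesis using zero[OF t] by (simp only:)
    qed
    ultimately have "(LBINT x. (indicator {a..b} x * z x) * indicator {c<..<d} x) = 0"
      by (simp add: LIMSEQ_const_iff)
    moreover have "(\<lambda>x. (indicator {a..b} x * z x) * indicator {c<..<d} x) = (\<lambda>x. z x * indicator {c<..<d} x)"
      using cd by (auto simp: fun_eq_iff indicator_def)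
    ultimately show "(LBINT x. z x * indicator {c<..<d} x) = 0" by (simp only:)
  qed
  \<comment> \<open>\<open>loc_integrable\<close> controls z only on compact subsets of r > 0, so
    the half-line is exhausted by countably many intervals.\<close>
  have "AE x in lborel. \<forall>n::nat. x \<in> {inverse (real (Suc n))<..<real n} \<longrightarrow> z x = 0"
    unfolding AE_all_countable by (intro allI ab) simp
  then show ?thesis
  proof eventually_elim
    case (elim x)
    show ?case
    proof
      assume x: "x > 0"
      obtain n1 where n1: "inverse (real (Suc n1)) < x" using reals_Archimedean[OF x] by blast
      obtain n2 where n2: "x < real n2" using reals_Archimedean2 by blast
      have "inverse (real (Suc (max n1 n2))) \<le> inverse (real (Suc n1))"
        by (intro le_imp_inverse_le) auto
      then have "inverse (real (Suc (max n1 n2))) < x" using n1 by (rule order.strict_trans1)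
      moreover have "x < real (max n1 n2)" using n2 by linarith
      ultimately show "z x = 0" by (intro elim[rule_format, of "max n1 n2"]) (simp only: greaterThanLessThan_iff simp_thms)
    qed
  qed
qed

section \<open>Weak derivatives\<close>

definition weighted :: "(real \<Rightarrow> real) \<Rightarrow> bool" where
  "weighted z \<longleftrightarrow> z \<in> borel_measurable borel \<and> integrable lborel (\<lambda>x. weight x * z x)"

lemma weighted_measurable: "weighted z \<Longrightarrow> z \<in> borel_measurable borel"
  by (simp add: weighted_def)

lemma weighted_mult_integrable:
  assumes z: "weighted z" and [measurable]: "h \<in> borel_measurable borel" and h: "\<And>x. \<bar>h x\<bar> \<le> C * weight x"
  shows "integrable lborel (\<lambda>x. z x * h x)"
proof (rule Bochner_Integration.integrable_bound)
  have [measurable]: "z \<in> borel_measurable borel" using z by (rule weighted_measurable)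
  show "integrable lborel (\<lambda>x. C * (weight x * z x))" using z by (simp add: weighted_def)
  show "(\<lambda>x. z x * h x) \<in> borel_measurable lborel" by measurable
  show "AE x in lborel. norm (z x * h x) \<le> norm (C * (weight x * z x))"
  proof (rule AE_I2)
    fix x
    have "\<bar>z x\<bar> * \<bar>h x\<bar> \<le> \<bar>z x\<bar> * \<bar>C * weight x\<bar>"
      by (rule mult_left_mono[OF order_trans[OF h abs_ge_self]]) simp
    then show "norm (z x * h x) \<le> norm (C * (weight x * z x))" by (simp add: abs_mult mult_ac)
  qed
qed

lemma weighted_compact_integrable:
  assumes z: "weighted z" and h: "h \<in> borel_measurable borel" "\<And>x. \<bar>h x\<bar> \<le> C" "\<And>x. \<bar>x\<bar> > B \<Longrightarrow> h x = 0"
  shows "integrable lborel (\<lambda>x. z x * h x)"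
proof (rule weighted_mult_integrable[OF z h(1)])
  fix x
  have C: "C \<ge> 0" using h(2)[of 0] by simp
  show "\<bar>h x\<bar> \<le> (C * (1 + B\<^sup>2)) * weight x"
  proof (cases "\<bar>x\<bar> > B")
    case True
    then show ?thesis using h(3) C weight_bounds(1)[of x] by simp
  next
    case False
    then have "x\<^sup>2 \<le> B\<^sup>2" by (simp add: abs_le_square_iff[symmetric])
    then have "1 \<le> (1 + B\<^sup>2) * weight x"
      by (simp add: weight_def field_simps add_pos_nonneg)
    from mult_left_mono[OF this C] show ?thesis using h(2)[of x] by (simp add: mult.assoc)
  qed
qed

lemma weighted_set_integrable: "weighted z \<Longrightarrow> set_integrable lborel {a..b} z"
  unfolding set_integrable_def real_scaleR_def mult.commute[of "indicator {a..b} _"]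
  by (rule weighted_compact_integrable[of z _ 1 "max \<bar>a\<bar> \<bar>b\<bar>"]) (auto simp: indicator_def)

lemma weighted_loc_integrable: "weighted z \<Longrightarrow> loc_integrable z"
  by (simp add: loc_integrable_def weighted_set_integrable)

text \<open>A Peetre-type inequality, 1 + (t + e x)^2 <= 2 (1 + t^2)(1 + x^2), compares the weight
  at x with the weight at t + e x. With e = 1 and e = -1 it admits the profile at t + r and at t -
  r.\<close>

lemma weighted_affine:
  fixes e :: real
  assumes f: "weighted f" and e: "\<bar>e\<bar> = 1"
  shows "weighted (\<lambda>x. f (t + e * x))"
proof -
  have [measurable]: "f \<in> borel_measurable borel" using f by (rule weighted_measurable)
  have e0: "e \<noteq> 0" using e by auto
  have e2: "(e * x)\<^sup>2 = x\<^sup>2" for x using e by (metis abs_mult mult_1 power2_abs)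
  have i: "integrable lborel (\<lambda>x. weight (t + e * x) * f (t + e * x))"
    using f lborel_integrable_real_affine[of "\<lambda>x. weight x * f x" e t] e0 by (simp add: weighted_def)
  have "integrable lborel (\<lambda>x. weight x * f (t + e * x))"
  proof (rule Bochner_Integration.integrable_bound)
    show "integrable lborel (\<lambda>x. 2 * (1 + t\<^sup>2) * (weight (t + e * x) * f (t + e * x)))" using i by simp
    show "AE x in lborel. norm (weight x * f (t + e * x)) \<le> norm (2 * (1 + t\<^sup>2) * (weight (t + e * x) * f (t + e * x)))"
    proof (rule AE_I2)
      fix x
      have "(t + e * x)\<^sup>2 \<le> 2 * t\<^sup>2 + 2 * x\<^sup>2"
        using zero_le_power2[of "t - e * x"] e2[of x] by (simp add: power2_sum power2_diff)
      then have "1 + (t + e * x)\<^sup>2 \<le> 2 * (1 + t\<^sup>2) * (1 + x\<^sup>2)"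
        using mult_nonneg_nonneg[OF zero_le_power2[of t] zero_le_power2[of x]] unfolding distrib_left distrib_right by linarith
      then have "weight x \<le> 2 * (1 + t\<^sup>2) * weight (t + e * x)"
        by (simp add: weight_def field_simps add_pos_nonneg)
      then have "weight x * \<bar>f (t + e * x)\<bar> \<le> (2 * (1 + t\<^sup>2) * weight (t + e * x)) * \<bar>f (t + e * x)\<bar>"
        by (intro mult_right_mono) auto
      then show "norm (weight x * f (t + e * x)) \<le> norm (2 * (1 + t\<^sup>2) * (weight (t + e * x) * f (t + e * x)))"
        using weight_bounds(1)[of x] weight_bounds(1)[of "t + e * x"] by (simp add: abs_mult mult.assoc)
    qed
  qed measurable
  then show ?thesis by (simp add: weighted_def)
qed

lemma weighted_shift: "weighted f \<Longrightarrow> weighted (\<lambda>x. f (t + x))"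
  using weighted_affine[of f 1 t] by simp

lemma weighted_reflect: "weighted f \<Longrightarrow> weighted (\<lambda>x. f (t - x))"
  using weighted_affine[of f "-1" t] by simp

lemma weighted_add: "weighted f \<Longrightarrow> weighted g \<Longrightarrow> weighted (\<lambda>x. f x + g x)"
  unfolding weighted_def by (auto simp: distrib_left)

lemma weighted_diff: "weighted f \<Longrightarrow> weighted g \<Longrightarrow> weighted (\<lambda>x. f x - g x)"
  unfolding weighted_def by (auto simp: right_diff_distrib)

lemma test_funE:
  assumes "test_fun \<psi>"
  obtains a b C where "a > 0" "a \<le> b" "\<And>r. r \<notin> {a..b} \<Longrightarrow> \<psi> r = 0" "\<And>r. r \<notin> {a..b} \<Longrightarrow> deriv \<psi> r = 0"
    "\<And>r. \<bar>\<psi> r\<bar> \<le> C" "\<And>r. \<bar>deriv \<psi> r\<bar> \<le> C" "continuous_on UNIV \<psi>" "continuous_on UNIV (deriv \<psi>)"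
    "\<And>r. (\<psi> has_real_derivative deriv \<psi> r) (at r)"
proof -
  obtain a b0 where a: "a > 0" and z0: "\<And>r. r \<notin> {a..b0} \<Longrightarrow> \<psi> r = 0" and s: "smooth \<psi>"
    using assms by (auto simp: test_fun_def smooth_def)
  define b where "b = max a b0"
  have z: "\<psi> r = 0" if "r \<notin> {a..b}" for r using that by (intro z0) (auto simp: b_def)
  have D: "(\<psi> has_real_derivative deriv \<psi> r) (at r)" for r using s by (rule smooth_DERIV)
  have D2: "(deriv \<psi> has_real_derivative deriv (deriv \<psi>) r) (at r)" for r
    using s by (intro smooth_DERIV smooth_deriv)
  have c: "continuous_on UNIV \<psi>" "continuous_on UNIV (deriv \<psi>)"
    using D D2 by (meson DERIV_continuous_on has_field_derivative_at_within)+
  have dz: "deriv \<psi> r = 0" if r: "r \<notin> {a..b}" for r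
  proof -
    have "((\<lambda>_. 0) has_real_derivative deriv \<psi> r) (at r)"
      by (rule has_field_derivative_transform_within_open[OF D, of "- {a..b}"]) (use r z in auto)
    then show ?thesis using DERIV_unique[OF DERIV_const] by metis
  qed
  have "compact (\<psi> ` {a..b})" "compact (deriv \<psi> ` {a..b})"
    by (intro compact_continuous_image continuous_on_subset[OF c(1)] continuous_on_subset[OF c(2)] compact_Icc; simp)+
  then have "bounded (\<psi> ` {a..b})" "bounded (deriv \<psi> ` {a..b})" by (auto intro: compact_imp_bounded)
  then obtain C1 C2 where "\<forall>y\<in>\<psi> ` {a..b}. norm y \<le> C1" "\<forall>y\<in>deriv \<psi> ` {a..b}. norm y \<le> C2"
    unfolding bounded_iff by (elim exE)
  then have C: "\<And>r. r \<in> {a..b} \<Longrightarrow> \<bar>\<psi> r\<bar> \<le> C1" "\<And>r. r \<in> {a..b} \<Longrightarrow> \<bar>deriv \<psi> r\<bar> \<le> C2"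
    by auto
  have "\<bar>\<psi> r\<bar> \<le> max 0 (max C1 C2)" "\<bar>deriv \<psi> r\<bar> \<le> max 0 (max C1 C2)" for r
    using C[of r] z[of r] dz[of r] by (cases "r \<in> {a..b}"; force)+
  then show thesis using that[of a b "max 0 (max C1 C2)"] a z dz c D by (auto simp: b_def)
qed

text \<open>For h x = f (t + x) times an even or odd function, the two summands are the terms in f
  (t + x) and f (t - x): a pairing on the half-line becomes one pairing of f on the whole
  line.\<close>

lemma integral_reflect_halves:
  fixes h :: "real \<Rightarrow> real"
  assumes h: "integrable lborel h"
  shows "(LBINT x. h x) = (LBINT x. indicator {0<..} x * (h x + h (- x)))"
proof -
  have i: "integrable lborel (\<lambda>x. indicator {0<..} x * h x)" "integrable lborel (\<lambda>x. indicator {..<0} x * h x)"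
    using integrable_mult_indicator[OF _ h, of "{0<..}"] integrable_mult_indicator[OF _ h, of "{..<0}"] by simp_all
  have e: "(\<lambda>x. indicator {..<0} (0 + -1 * x) * h (0 + -1 * x)) = (\<lambda>x. indicator {0<..} x * h (- x))"
    by (auto simp: fun_eq_iff indicator_def)
  have r: "(LBINT x. indicator {..<0} x * h x) = (LBINT x. indicator {0<..} x * h (- x))"
    using lborel_integral_real_affine[of "-1" "\<lambda>x. indicator {..<0} x * h x" 0] unfolding e by simp
  have i': "integrable lborel (\<lambda>x. indicator {0<..} x * h (- x))"
    using lborel_integrable_real_affine[OF i(2), of "-1" 0] unfolding e by simp
  have [measurable]: "h \<in> borel_measurable borel" using h by auto
  have "(LBINT x. h x) = (LBINT x. indicator {0<..} x * h x + indicator {..<0} x * h x)"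
  proof (rule integral_cong_AE)
    show "AE x in lborel. h x = indicator {0<..} x * h x + indicator {..<0} x * h x"
      using AE_lborel_singleton[of "0::real"] by eventually_elim (auto simp: indicator_def)
  qed measurable
  also have "\<dots> = (LBINT x. indicator {0<..} x * h x) + (LBINT x. indicator {0<..} x * h (- x))"
    unfolding Bochner_Integration.integral_add[OF i] r ..
  also have "\<dots> = (LBINT x. indicator {0<..} x * h x + indicator {0<..} x * h (- x))"
    by (rule Bochner_Integration.integral_add[OF i(1) i', symmetric])
  finally show ?thesis by (simp only: distrib_left)
qed

text \<open>For z x = f (t + x) + f (t - x) and r > 0 this is the integral of f over (t - r, t + r),
  d'Alembert's formula for r w(t, r); it vanishes for r <= 0.\<close>

definition half_primitive :: "(real \<Rightarrow> real) \<Rightarrow> real \<Rightarrow> real" where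
  "half_primitive z r = (LBINT x. z x * indicator {0<..<r} x)"

text \<open>Exchanging the integrals moves the primitive from z to h, where it becomes a tail
  integral. The support of h allows z to be cut to [0, b], where it is integrable.\<close>

lemma half_primitive_pairing:
  assumes z: "weighted z" and h: "h \<in> borel_measurable borel" "\<And>x. \<bar>h x\<bar> \<le> C" "\<And>x. x \<notin> {a..b} \<Longrightarrow> h x = 0" "a > 0"
  shows "(LBINT r. half_primitive z r * h r) =
    (LBINT x. z x * (indicator {0<..} x * (LBINT r. h r * indicator {x<..} r)))"
proof -
  note [measurable] = h(1) weighted_measurable[OF z]
  have sf: "sigma_finite_measure (lborel :: real measure)" by (rule lborel.sigma_finite_measure_axioms)
  have ih: "integrable lborel h"
  proof -
    have "integrable lborel (\<lambda>x. indicator {a..b} x * C)"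
      by (intro integrable_mult_left integrable_real_indicator) (auto simp: emeasure_lborel_Icc_eq)
    then show ?thesis
      by (rule Bochner_Integration.integrable_bound) (use h in \<open>auto intro!: AE_I2 simp: indicator_def intro: order_trans[OF _ abs_ge_self]\<close>)
  qed
  have iz: "integrable lborel (\<lambda>x. z x * indicator {0..b} x)"
    using weighted_set_integrable[OF z, of 0 b] by (simp add: set_integrable_def mult.commute)
  define K where "K = (\<lambda>r x :: real. indicator {x<..} r * indicator {0<..} x :: real)"
  have Km: "(\<lambda>(r, x). K r x) \<in> borel_measurable (lborel \<Otimes>\<^sub>M lborel)"
  proof -
    have "(\<lambda>(r, x). K r x) = (\<lambda>p :: real \<times> real. if snd p < fst p \<and> 0 < snd p then 1 else 0)"
      by (auto simp: K_def fun_eq_iff indicator_def)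
    also have "\<dots> \<in> borel_measurable (lborel \<Otimes>\<^sub>M lborel)" by measurable
    finally show ?thesis .
  qed
  have K1: "\<bar>K r x\<bar> \<le> 1" for r x by (simp add: K_def indicator_def)
  have "(LBINT r. half_primitive z r * h r) =
     (LBINT r. h r * (LBINT x. (z x * indicator {0..b} x) * K r x))"
  proof (rule Bochner_Integration.integral_cong[OF refl])
    fix r
    show "half_primitive z r * h r = h r * (LBINT x. (z x * indicator {0..b} x) * K r x)"
    proof (cases "h r = 0")
      case False
      then have "r \<le> b" using h(3)[of r] by auto
      then have "(\<lambda>x. (z x * indicator {0..b} x) * K r x) = (\<lambda>x. z x * indicator {0<..<r} x)"
        by (auto simp: fun_eq_iff K_def indicator_def)
      then show ?thesis by (simp only: half_primitive_def mult.commute)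
    qed simp
  qed
  also have "\<dots> = (LBINT x. (z x * indicator {0..b} x) * (LBINT r. h r * K r x))"
    by (rule integral_swap_dominated(1)[OF sf sf ih iz Km K1])
  also have "\<dots> = (LBINT x. z x * (indicator {0<..} x * (LBINT r. h r * indicator {x<..} r)))"
  proof (rule Bochner_Integration.integral_cong[OF refl])
    fix x
    have "(LBINT r. h r * K r x) = indicator {0<..} x * (LBINT r. h r * indicator {x<..} r)"
      unfolding K_def mult.assoc[symmetric] by (simp add: mult.commute)
    moreover have "(LBINT r. h r * indicator {x<..} r) = 0" if "x > b"
    proof -
      have "(\<lambda>r. h r * indicator {x<..} r) = (\<lambda>r. 0)"
        using that h(3) by (auto simp: fun_eq_iff indicator_def)
      then show ?thesis by simp
    qed
    ultimately show "(z x * indicator {0..b} x) * (LBINT r. h r * K r x) =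
        z x * (indicator {0<..} x * (LBINT r. h r * indicator {x<..} r))"
      by (auto simp: indicator_def)
  qed
  finally show ?thesis .
qed

lemma integral_tail_FTC:
  assumes F: "\<And>r. (F has_real_derivative h r) (at r)" and h: "continuous_on UNIV h" "\<And>r. r > b \<Longrightarrow> h r = 0"
    and "x \<le> b"
  shows "(LBINT r. h r * indicator {x<..} r) = F b - F x"
proof -
  have [measurable]: "h \<in> borel_measurable borel" using h(1) by (rule borel_measurable_continuous_onI)
  have "(LBINT r. h r * indicator {x<..} r) = (LBINT r. h r * indicator {x..b} r)"
  proof (rule integral_cong_AE)
    show "AE r in lborel. h r * indicator {x<..} r = h r * indicator {x..b} r"
      using AE_lborel_singleton[of x] by eventually_elim (use h(2) in \<open>auto simp: indicator_def not_le\<close>)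
  qed measurable
  also have "\<dots> = F b - F x"
    using assms(4) F h(1) by (intro integral_FTC_Icc_real) (auto simp: continuous_on_eq_continuous_at)
  finally show ?thesis .
qed

lemma half_primitive_weak_deriv:
  assumes z: "weighted z" and \<psi>: "test_fun \<psi>"
  shows "(LBINT r. half_primitive z r * deriv \<psi> r) = - (LBINT r. z r * \<psi> r)"
proof -
  from \<psi> obtain a b C where a: "a > 0" "a \<le> b" and z0: "\<And>r. r \<notin> {a..b} \<Longrightarrow> \<psi> r = 0" "\<And>r. r \<notin> {a..b} \<Longrightarrow> deriv \<psi> r = 0"
    and C: "\<And>r. \<bar>deriv \<psi> r\<bar> \<le> C" and c: "continuous_on UNIV (deriv \<psi>)"
    and D: "\<And>r. (\<psi> has_real_derivative deriv \<psi> r) (at r)" by (rule test_funE) (rule that)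
  have m: "deriv \<psi> \<in> borel_measurable borel" using c by (rule borel_measurable_continuous_onI)
  have "(LBINT r. half_primitive z r * deriv \<psi> r) =
     (LBINT x. z x * (indicator {0<..} x * (LBINT r. deriv \<psi> r * indicator {x<..} r)))"
    by (rule half_primitive_pairing[OF z m C z0(2) a(1)])
  also have "\<dots> = (LBINT x. - (z x * \<psi> x))"
  proof (rule Bochner_Integration.integral_cong[OF refl])
    fix x
    \<comment> \<open>An upper limit beyond both x and b serves every x at once, and \<psi> vanishes
      there.\<close>
    have "(LBINT r. deriv \<psi> r * indicator {x<..} r) = \<psi> (max x b + 1) - \<psi> x"
      by (rule integral_tail_FTC[OF D c]) (auto intro!: z0(2))
    moreover have "\<psi> (max x b + 1) = 0" by (intro z0) auto
    moreover have "\<psi> x = 0" if "x \<le> 0" using that a by (intro z0) auto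
    ultimately show "z x * (indicator {0<..} x * (LBINT r. deriv \<psi> r * indicator {x<..} r)) = - (z x * \<psi> x)"
      by (auto simp: indicator_def)
  qed
  finally show ?thesis by simp
qed

lemma integral_shift_mult:
  fixes f h :: "real \<Rightarrow> real"
  shows "(LBINT x. f (t + x) * h x) = (LBINT x. f x * h (x - t))"
  using lborel_integral_real_affine[of 1 "\<lambda>x. f x * h (x - t)" t] by simp

text \<open>The profile f need not be differentiable, so the time dependence is moved to the test
  function: the pairing is the integral of f(x) \<Psi>(x - \<tau>) with a fixed \<Psi> that is
  Lipschitz, differentiable and compactly supported. Dominated convergence then differentiates under
  the integral.\<close>

lemma half_primitive_time_deriv:
  assumes f: "weighted f" and \<psi>: "test_fun \<psi>"
  shows "((\<lambda>\<tau>. LBINT r. half_primitive (\<lambda>x. f (\<tau> + x) + f (\<tau> - x)) r * \<psi> r) has_real_derivative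
           (LBINT r. (f (t + r) - f (t - r)) * \<psi> r)) (at t)"
proof -
  from \<psi> obtain a b C where a: "a > 0" "a \<le> b" and z0: "\<And>r. r \<notin> {a..b} \<Longrightarrow> \<psi> r = 0"
    and C: "\<And>r. \<bar>\<psi> r\<bar> \<le> C" and c: "continuous_on UNIV \<psi>" by (rule test_funE) (rule that)
  have C0: "C \<ge> 0" using C[of 0] by simp
  have m [measurable]: "\<psi> \<in> borel_measurable borel" using c by (rule borel_measurable_continuous_onI)
  have "\<exists>F. \<forall>x :: real. -\<infinity> < ereal x \<longrightarrow> ereal x < \<infinity> \<longrightarrow> (F has_vector_derivative \<psi> x) (at x)"
    by (rule einterval_antiderivative) (use c in \<open>auto simp: continuous_on_eq_continuous_at\<close>)
  then obtain F where F: "\<And>x. (F has_real_derivative \<psi> x) (at x)"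
    by (auto simp: has_real_derivative_iff_has_vector_derivative)
  have F0: "F x = F 0" if "x < a" for x
  proof -
    have *: "F v = F u" if uv: "u < v" "v < a" for u v
    proof -
      obtain y where "u < y" "y < v" "F v - F u = (v - u) * \<psi> y"
        using MVT2[OF uv(1), of F \<psi>] F by blast
      then show ?thesis using z0[of y] uv by simp
    qed
    consider "x = 0" | "x < 0" | "0 < x" by linarith
    then show ?thesis using *[of x 0] *[of 0 x] that a by cases auto
  qed
  have Fb: "F x = F b" if "x \<ge> b" for x
  proof (cases "x = b")
    case False
    then have x: "b < x" using that by simp
    obtain y where "b < y" "y < x" "F x - F b = (x - b) * \<psi> y"
      using MVT2[OF x, of F \<psi>] F by blast
    then show ?thesis using z0[of y] by simp
  qed simp
  \<comment> \<open>\<Psi> is the even extension of the tail integral of \<psi>, and \<psi>o the odd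
    extension of \<psi>. Since \<psi> vanishes near 0, \<Psi> is constant there and has no corner at
    the origin.\<close>
  define \<Psi> where "\<Psi> = (\<lambda>x. F b - F \<bar>x\<bar>)"
  define \<psi>o where "\<psi>o = (\<lambda>x. sgn x * \<psi> \<bar>x\<bar>)"
  have \<Psi>0: "\<Psi> x = 0" if "\<bar>x\<bar> \<ge> b" for x using Fb[OF that] by (simp add: \<Psi>_def)
  have D\<Psi>: "(\<Psi> has_real_derivative - \<psi>o x) (at x)" for x
  proof -
    consider "x > 0" | "x < 0" | "x = 0" by linarith
    then show ?thesis
    proof cases
      case 1
      have "((\<lambda>x. F b - F x) has_real_derivative - \<psi>o x) (at x)"
        using 1 by (auto intro!: derivative_eq_intros F simp: \<psi>o_def)
      then show ?thesis
        by (rule has_field_derivative_transform_within_open[of _ _ _ "{0<..}"]) (use 1 in \<open>auto simp: \<Psi>_def\<close>)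
    next
      case 2
      have "((\<lambda>x. F (- x)) has_real_derivative \<psi> (- x) * - 1) (at x)"
        by (rule DERIV_chain2[OF F]) (auto intro!: derivative_eq_intros)
      then have "((\<lambda>x. F b - F (- x)) has_real_derivative - \<psi>o x) (at x)"
        using 2 by (auto intro!: derivative_eq_intros simp: \<psi>o_def)
      then show ?thesis
        by (rule has_field_derivative_transform_within_open[of _ _ _ "{..<0}"]) (use 2 in \<open>auto simp: \<Psi>_def\<close>)
    next
      case 3
      have "((\<lambda>x. F b - F 0) has_real_derivative - \<psi>o x) (at x)"
        using 3 by (simp add: \<psi>o_def)
      then show ?thesis
      proof (rule has_field_derivative_transform_within_open[of _ _ _ "{-a<..<a}"])
        show "F b - F 0 = \<Psi> y" if "y \<in> {-a<..<a}" for y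
          using that F0[of "\<bar>y\<bar>"] by (simp add: \<Psi>_def abs_less_iff)
      qed (use 3 a in auto)
    qed
  qed
  have c\<Psi>: "continuous_on UNIV \<Psi>" using D\<Psi> by (meson DERIV_continuous_on has_field_derivative_at_within)
  have m\<Psi> [measurable]: "\<Psi> \<in> borel_measurable borel" using c\<Psi> by (rule borel_measurable_continuous_onI)
  have m\<psi>o [measurable]: "\<psi>o \<in> borel_measurable borel" unfolding \<psi>o_def by measurable
  have \<psi>oC: "\<bar>\<psi>o x\<bar> \<le> C" for x using C[of "\<bar>x\<bar>"] C0 by (auto simp: \<psi>o_def abs_mult sgn_if)
  have \<psi>o0: "\<psi>o x = 0" if "\<bar>x\<bar> > b" for x using that z0[of "\<bar>x\<bar>"] by (simp add: \<psi>o_def)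
  have lip: "\<bar>\<Psi> x - \<Psi> y\<bar> \<le> C * \<bar>x - y\<bar>" for x y
    using field_differentiable_bound[of UNIV \<Psi> "\<lambda>x. - \<psi>o x" C x y] D\<Psi> \<psi>oC by simp
  have \<Psi>C: "\<bar>\<Psi> x\<bar> \<le> C * (\<bar>x\<bar> + b)" for x
    using lip[of x b] \<Psi>0[of b] a C0 by (simp add: order_trans[OF _ mult_left_mono[of "\<bar>x - b\<bar>" "\<bar>x\<bar> + b" C]])
  have \<Psi>B: "\<bar>\<Psi> x\<bar> \<le> 2 * C * b" for x
  proof (cases "\<bar>x\<bar> \<ge> b")
    case True
    then show ?thesis using \<Psi>0 C0 a by simp
  next
    case False
    then have "C * (\<bar>x\<bar> + b) \<le> C * (2 * b)" using C0 by (intro mult_left_mono) auto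
    then show ?thesis using \<Psi>C[of x] by simp
  qed
  define J where "J = (\<lambda>\<tau>. LBINT x. f x * \<Psi> (x - \<tau>))"
  have J: "(LBINT r. half_primitive (\<lambda>x. f (\<tau> + x) + f (\<tau> - x)) r * \<psi> r) = J \<tau>" for \<tau>
  proof -
    have w: "weighted (\<lambda>x. f (\<tau> + x) + f (\<tau> - x))"
      by (intro weighted_add weighted_shift weighted_reflect f)
    have tail: "(LBINT r. \<psi> r * indicator {x<..} r) = \<Psi> x" if "x > 0" for x
    proof -
      have "(LBINT r. \<psi> r * indicator {x<..} r) = F (max x b) - F x"
        by (rule integral_tail_FTC[OF F c]) (use z0 in auto)
      then show ?thesis using that Fb[of "max x b"] by (simp add: \<Psi>_def)
    qed
    have "(LBINT r. half_primitive (\<lambda>x. f (\<tau> + x) + f (\<tau> - x)) r * \<psi> r) =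
      (LBINT x. (f (\<tau> + x) + f (\<tau> - x)) * (indicator {0<..} x * (LBINT r. \<psi> r * indicator {x<..} r)))"
      by (rule half_primitive_pairing[OF w m C z0 a(1)])
    also have "\<dots> = (LBINT x. indicator {0<..} x * (f (\<tau> + x) * \<Psi> x + f (\<tau> + - x) * \<Psi> (- x)))"
    proof (rule Bochner_Integration.integral_cong[OF refl])
      fix x
      have "\<Psi> (- x) = \<Psi> x" by (simp add: \<Psi>_def)
      then show "(f (\<tau> + x) + f (\<tau> - x)) * (indicator {0<..} x * (LBINT r. \<psi> r * indicator {x<..} r)) =
          indicator {0<..} x * (f (\<tau> + x) * \<Psi> x + f (\<tau> + - x) * \<Psi> (- x))"
        by (cases "x > 0") (simp_all add: tail distrib_right)
    qed
    also have "\<dots> = (LBINT x. f (\<tau> + x) * \<Psi> x)"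
      by (rule integral_reflect_halves[symmetric])
         (rule weighted_compact_integrable[OF weighted_shift[OF f] m\<Psi> \<Psi>B, of b], use \<Psi>0 in auto)
    also have "\<dots> = J \<tau>" unfolding J_def by (rule integral_shift_mult)
    finally show ?thesis .
  qed
  have V: "(LBINT r. (f (t + r) - f (t - r)) * \<psi> r) = (LBINT x. f x * \<psi>o (x - t))"
  proof -
    have "(LBINT x. f x * \<psi>o (x - t)) = (LBINT x. f (t + x) * \<psi>o x)"
      by (rule integral_shift_mult[symmetric])
    also have "\<dots> = (LBINT x. indicator {0<..} x * (f (t + x) * \<psi>o x + f (t + - x) * \<psi>o (- x)))"
      by (rule integral_reflect_halves)
         (rule weighted_compact_integrable[OF weighted_shift[OF f] m\<psi>o \<psi>oC, of b], rule \<psi>o0)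
    also have "\<dots> = (LBINT r. (f (t + r) - f (t - r)) * \<psi> r)"
    proof (rule Bochner_Integration.integral_cong[OF refl])
      fix x
      have "\<psi> x = 0" if "x \<le> 0" using that a by (intro z0) auto
      then show "indicator {0<..} x * (f (t + x) * \<psi>o x + f (t + - x) * \<psi>o (- x)) = (f (t + x) - f (t - x)) * \<psi> x"
        by (auto simp: indicator_def \<psi>o_def sgn_if algebra_simps)
    qed
    finally show ?thesis ..
  qed
  have [measurable]: "f \<in> borel_measurable borel" using f by (rule weighted_measurable)
  have ci: "integrable lborel (\<lambda>x. f x * \<Psi> (x - \<tau>))" for \<tau>
    by (rule weighted_compact_integrable[OF f, of _ "2 * C * b" "b + \<bar>\<tau>\<bar>"]) (use \<Psi>B in \<open>auto intro!: \<Psi>0\<close>)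
  have "((\<lambda>h. (J (t + h) - J t) / h) \<longlongrightarrow> (LBINT x. f x * \<psi>o (x - t))) (at 0)"
    unfolding tendsto_at_iff_sequentially
  proof (intro allI impI)
    fix X :: "nat \<Rightarrow> real" assume X: "\<forall>i. X i \<in> UNIV - {0}" "X \<longlonglongrightarrow> 0"
    obtain B where B: "B > 0" "\<And>n. norm (X n) \<le> B"
      using convergent_imp_Bseq[OF convergentI[OF X(2)]] by (auto elim: BseqE)
    have eq: "(J (t + X n) - J t) / X n = (LBINT x. f x * ((\<Psi> (x - (t + X n)) - \<Psi> (x - t)) / X n))" for n
    proof -
      have "J (t + X n) - J t = (LBINT x. f x * \<Psi> (x - (t + X n)) - f x * \<Psi> (x - t))"
        unfolding J_def by (rule Bochner_Integration.integral_diff[OF ci ci, symmetric])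
      then show ?thesis by (simp add: right_diff_distrib flip: integral_divide_zero)
    qed
    have "(\<lambda>n. LBINT x. f x * ((\<Psi> (x - (t + X n)) - \<Psi> (x - t)) / X n)) \<longlonglongrightarrow> (LBINT x. f x * \<psi>o (x - t))"
    proof (rule integral_dominated_convergence)
      \<comment> \<open>Outside [-L, L] both translates of \<Psi> vanish, because |X n| <= B;
        inside, the Lipschitz bound gives C.\<close>
      define L where "L = b + \<bar>t\<bar> + B"
      show "integrable lborel (\<lambda>x. \<bar>f x * (C * indicator {-L..L} x)\<bar>)"
        by (intro integrable_abs weighted_compact_integrable[OF f, of _ C L]) (use C0 in \<open>auto simp: indicator_def\<close>)
      show "AE x in lborel. (\<lambda>n. f x * ((\<Psi> (x - (t + X n)) - \<Psi> (x - t)) / X n)) \<longlonglongrightarrow> f x * \<psi>o (x - t)"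
      proof (intro AE_I2 tendsto_intros)
        fix x
        have "((\<lambda>h. \<Psi> (x - t - h)) has_real_derivative - \<psi>o (x - t - 0) * (0 - 1)) (at 0)"
          by (rule DERIV_chain2[OF D\<Psi>]) (auto intro!: derivative_eq_intros)
        then have "((\<lambda>h. (\<Psi> (x - t - (0 + h)) - \<Psi> (x - t - 0)) / h) \<longlongrightarrow> \<psi>o (x - t)) (at 0)"
          unfolding DERIV_def by simp
        then have "((\<lambda>h. (\<Psi> (x - t - (0 + h)) - \<Psi> (x - t - 0)) / h) \<circ> X) \<longlonglongrightarrow> \<psi>o (x - t)"
          using X unfolding tendsto_at_iff_sequentially by blast
        then show "(\<lambda>n. (\<Psi> (x - (t + X n)) - \<Psi> (x - t)) / X n) \<longlonglongrightarrow> \<psi>o (x - t)"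
          by (simp add: comp_def diff_diff_eq)
      qed
      fix n
      show "AE x in lborel. norm (f x * ((\<Psi> (x - (t + X n)) - \<Psi> (x - t)) / X n)) \<le> \<bar>f x * (C * indicator {-L..L} x)\<bar>"
      proof (rule AE_I2)
        fix x
        have "\<bar>(\<Psi> (x - (t + X n)) - \<Psi> (x - t)) / X n\<bar> \<le> C * indicator {-L..L} x"
        proof (cases "x \<in> {-L..L}")
          case True
          have "\<bar>\<Psi> (x - (t + X n)) - \<Psi> (x - t)\<bar> \<le> C * \<bar>X n\<bar>"
            using lip[of "x - (t + X n)" "x - t"] by simp
          then show ?thesis using X(1) True by (simp add: divide_le_eq)
        next
          case False
          then have "\<bar>x\<bar> > L" by auto
          then have "\<bar>x - (t + X n)\<bar> \<ge> b" "\<bar>x - t\<bar> \<ge> b" using B(2)[of n] B(1) by (auto simp: L_def)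
          then show ?thesis using \<Psi>0 False by simp
        qed
        then show "norm (f x * ((\<Psi> (x - (t + X n)) - \<Psi> (x - t)) / X n)) \<le> \<bar>f x * (C * indicator {-L..L} x)\<bar>"
          unfolding real_norm_def abs_mult[of "f x"]
          by (rule mult_left_mono[OF order_trans[OF _ abs_ge_self] abs_ge_zero])
      qed
    qed measurable
    then show "((\<lambda>h. (J (t + h) - J t) / h) \<circ> X) \<longlonglongrightarrow> (LBINT x. f x * \<psi>o (x - t))"
      by (simp only: comp_def eq)
  qed
  then show ?thesis unfolding J V DERIV_def .
qed

section \<open>Pairings with Gaussians\<close>

lemma gauss_norm: "gauss a (norm x) = gauss a x"
  by (simp add: gauss_def)

lemma measurable_of_mult_gauss:
  fixes k :: "'a::euclidean_space \<Rightarrow> real"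
  assumes "integrable lborel (\<lambda>x. k x * gauss a x)"
  shows "k \<in> borel_measurable borel"
proof -
  have [measurable]: "(\<lambda>x. k x * gauss a x) \<in> borel_measurable borel" using assms by auto
  have "(\<lambda>x. (k x * gauss a x) / gauss a x) \<in> borel_measurable borel" by measurable
  moreover have "(k x * gauss a x) / gauss a x = k x" for x
    using gauss_pos[of a x] by simp
  ultimately show ?thesis by (simp only:)
qed

lemma integrable_exp_dominated:
  fixes k f :: "'a \<Rightarrow> real" and \<Phi> :: "real \<Rightarrow> real"
  assumes k: "integrable M (\<lambda>x. k x * exp (- (\<alpha> * f x)))" and [measurable]: "k \<in> borel_measurable M" "f \<in> borel_measurable M"
    and f0: "\<And>x. f x \<ge> 0" and \<Phi>: "continuous_on UNIV \<Phi>"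
    and bound: "\<And>z. z \<ge> 0 \<Longrightarrow> \<bar>\<Phi> z\<bar> \<le> C * exp (- (\<alpha> * z))"
  shows "integrable M (\<lambda>x. k x * \<Phi> (f x))"
proof (rule Bochner_Integration.integrable_bound)
  have [measurable]: "\<Phi> \<in> borel_measurable borel" using \<Phi> by (rule borel_measurable_continuous_onI)
  show "(\<lambda>x. k x * \<Phi> (f x)) \<in> borel_measurable M" by measurable
  show "integrable M (\<lambda>x. C * (k x * exp (- (\<alpha> * f x))))" using k by simp
  show "AE x in M. norm (k x * \<Phi> (f x)) \<le> norm (C * (k x * exp (- (\<alpha> * f x))))"
  proof (intro AE_I2)
    fix x
    have "\<bar>k x\<bar> * \<bar>\<Phi> (f x)\<bar> \<le> \<bar>k x\<bar> * \<bar>C * exp (- (\<alpha> * f x))\<bar>"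
      by (intro mult_left_mono order_trans[OF bound[OF f0] abs_ge_self]) simp
    then show "norm (k x * \<Phi> (f x)) \<le> norm (C * (k x * exp (- (\<alpha> * f x))))"
      by (simp add: abs_mult mult.left_commute)
  qed
qed

text \<open>Only the pairings of a Fourier transform with radial functions matter, and these are determined by
  the function through Gaussians; so no uniqueness of the transform as a function is required.\<close>

lemma has_fourier_radial_unique:
  fixes w :: "'a::euclidean_space \<Rightarrow> real" and \<Phi> :: "real \<Rightarrow> real"
  assumes g: "has_fourier (\<lambda>x. of_real (w x)) g" and h: "has_fourier (\<lambda>x. of_real (w x)) h"
    and \<Phi>: "continuous_on UNIV \<Phi>" and \<alpha>: "\<alpha> > 0"
    and bound: "\<And>z. z \<ge> 0 \<Longrightarrow> \<bar>\<Phi> z\<bar> \<le> C * exp (- (\<alpha> * z))"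
  shows "(LBINT x. Re (g x) * \<Phi> ((norm x)\<^sup>2)) = (LBINT x. Re (h x) * \<Phi> ((norm x)\<^sup>2))"
    and "integrable lborel (\<lambda>x. Re (g x) * \<Phi> ((norm x)\<^sup>2))"
proof -
  have i: "integrable lborel (\<lambda>x. Re (k x) * gauss a x)" if "has_fourier (\<lambda>x. of_real (w x)) k" "a > 0" for k a
    using integrable_Re[OF has_fourier_gauss(1)[OF that]] by simp
  have m: "(\<lambda>x. Re (k x)) \<in> borel_measurable borel" if "has_fourier (\<lambda>x. of_real (w x)) k" for k
    using measurable_of_mult_gauss[OF i[OF that zero_less_one]] .
  have iP: "integrable lborel (\<lambda>x. Re (k x) * \<Phi> ((norm x)\<^sup>2))" if "has_fourier (\<lambda>x. of_real (w x)) k" for k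
  proof (rule integrable_exp_dominated[OF _ _ _ _ \<Phi> bound])
    show "integrable lborel (\<lambda>x. Re (k x) * exp (- (\<alpha> * (norm x)\<^sup>2)))" using i[OF that \<alpha>] by (simp add: gauss_def)
  qed (use m[OF that] in auto)
  show "integrable lborel (\<lambda>x. Re (g x) * \<Phi> ((norm x)\<^sup>2))" by (rule iP[OF g])
  \<comment> \<open>In the variable |x|^2 Gaussians are the exponentials of the Laplace transform,
    and both transforms of w have the same Gaussian pairings.\<close>
  have "(LBINT x. (Re (g x) - Re (h x)) * \<Phi> ((norm x)\<^sup>2)) = 0"
  proof (rule laplace_unique[OF _ _ _ _ \<Phi> \<alpha> bound])
    fix a :: real assume a: "a > 0"
    note ii = i[OF g a] i[OF h a]
    show "integrable lborel (\<lambda>x. (Re (g x) - Re (h x)) * exp (- (a * (norm x)\<^sup>2)))"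
      using Bochner_Integration.integrable_diff[OF ii] by (simp add: gauss_def left_diff_distrib)
    show "(LBINT x. (Re (g x) - Re (h x)) * exp (- (a * (norm x)\<^sup>2))) = 0"
      using Bochner_Integration.integral_diff[OF ii] has_fourier_gauss(3)[OF g a] has_fourier_gauss(3)[OF h a]
      by (simp add: gauss_def left_diff_distrib)
  qed auto
  then have "(LBINT x. Re (g x) * \<Phi> ((norm x)\<^sup>2) - Re (h x) * \<Phi> ((norm x)\<^sup>2)) = 0"
    by (simp only: left_diff_distrib)
  then show "(LBINT x. Re (g x) * \<Phi> ((norm x)\<^sup>2)) = (LBINT x. Re (h x) * \<Phi> ((norm x)\<^sup>2))"
    using Bochner_Integration.integral_diff[OF iP[OF g] iP[OF h]] by simp
qed

lemma abs_sinc_le_1: "\<bar>sinc x\<bar> \<le> 1"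
proof (cases "x = 0")
  case False
  then show ?thesis using abs_sin_x_le_abs_x[of x] by (simp add: divide_le_eq)
qed simp

text \<open>\<open>linear_wave\<close> supplies its own Fourier transforms of the data, which need
  not be the functions g and h that carry the Sobolev bounds. The multipliers are radial, so
  \<open>has_fourier_radial_unique\<close> exchanges the former for the latter.\<close>

lemma linear_wave_gauss:
  fixes w0 w1 :: "real^3 \<Rightarrow> real"
  assumes wave: "linear_wave w0 w1 w"
    and g: "has_fourier (\<lambda>x. of_real (w0 x)) g" and h: "has_fourier (\<lambda>x. of_real (w1 x)) h" and a: "a > 0"
  shows "sqrt (pi / a) ^ 3 * (LBINT x. w t x * gauss (1 / (4 * a)) x)
           = wave_smooth (\<lambda>x. Re (g x)) (\<lambda>x. Re (h x) / norm x) a t"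
    and "integrable lborel (\<lambda>x. w t x * gauss a x)"
proof -
  obtain g0 g1 where g0: "has_fourier (\<lambda>x. of_real (w0 x)) g0" and g1: "has_fourier (\<lambda>x. of_real (w1 x)) g1"
    and gt: "has_fourier (\<lambda>x. of_real (w t x))
       (\<lambda>\<xi>. of_real (cos (t * norm \<xi>)) * g0 \<xi> + of_real (sin (t * norm \<xi>) / norm \<xi>) * g1 \<xi>)"
    using wave unfolding linear_wave_def by blast
  show "integrable lborel (\<lambda>x. w t x * gauss a x)" by (rule has_fourier_gauss(2)[OF gt a])
  \<comment> \<open>The multipliers as functions of z = |x|^2, which have to be continuous on the
    whole line; in the second one \<open>sinc\<close> fills the removable singularity at 0.\<close>
  define \<Phi>0 where "\<Phi>0 = (\<lambda>z. cos (t * sqrt z) * exp (- (a * z)))"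
  define \<Phi>1 where "\<Phi>1 = (\<lambda>z. t * sinc (t * sqrt z) * exp (- (a * z)))"
  have c0: "continuous_on UNIV \<Phi>0" unfolding \<Phi>0_def by (intro continuous_intros)
  have c1: "continuous_on UNIV \<Phi>1" unfolding \<Phi>1_def by (intro continuous_intros)
  have b0: "\<bar>\<Phi>0 z\<bar> \<le> 1 * exp (- (a * z))" for z
    unfolding \<Phi>0_def abs_mult abs_exp_cancel by (intro mult_right_mono) auto
  have b1: "\<bar>\<Phi>1 z\<bar> \<le> \<bar>t\<bar> * exp (- (a * z))" for z
    unfolding \<Phi>1_def abs_mult abs_exp_cancel
    by (intro mult_right_mono mult_left_le abs_sinc_le_1) auto
  note u0 = has_fourier_radial_unique[OF _ _ c0 a b0] and u1 = has_fourier_radial_unique[OF _ _ c1 a b1]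
  have e0: "\<Phi>0 ((norm x)\<^sup>2) = cos (t * norm x) * gauss a x" for x :: "real^3"
    by (simp add: \<Phi>0_def gauss_def)
  \<comment> \<open>At x = 0 the quotient is 0 by the convention for division, whereas the factor
    with \<open>sinc\<close> gives t; hence only almost everywhere.\<close>
  have e1: "AE x in lborel. \<Phi>1 ((norm x)\<^sup>2) = sin (t * norm x) / norm x * gauss a (x :: real^3)"
    using AE_lborel_singleton[of "0 :: real^3"]
    by eventually_elim (auto simp: \<Phi>1_def gauss_def)
  have [measurable]: "\<Phi>1 \<in> borel_measurable borel" using c1 by (rule borel_measurable_continuous_onI)
  have mR: "(\<lambda>x. Re (k x)) \<in> borel_measurable borel" if "has_fourier (\<lambda>x. of_real (v x)) k"
    for v :: "real^3 \<Rightarrow> real" and k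
    using measurable_of_mult_gauss[of "\<lambda>x. Re (k x)" 1] integrable_Re[OF has_fourier_gauss(1)[OF that zero_less_one]]
    by simp
  note [measurable] = mR[OF g0] mR[OF g1] mR[OF g] mR[OF h]
  have A1: "AE x in lborel. Re (k x) * \<Phi>1 ((norm x)\<^sup>2) = Re (k x) * (sin (t * norm x) / norm x * gauss a x)" for k :: "real^3 \<Rightarrow> complex"
    using e1 by eventually_elim (rule arg_cong)
  have I0: "integrable lborel (\<lambda>x. Re (k x) * (cos (t * norm x) * gauss a x))"
    if "has_fourier (\<lambda>x. of_real (w0 x)) k" for k
    using u0(2)[OF that that] unfolding e0 .
  have I1: "integrable lborel (\<lambda>x. Re (k x) * (sin (t * norm x) / norm x * gauss a x))"
    if k: "has_fourier (\<lambda>x. of_real (w1 x)) k" for k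
  proof -
    note [measurable] = mR[OF k]
    show ?thesis using u1(2)[OF k k] by (subst (asm) integrable_cong_AE[OF _ _ A1]) measurable
  qed
  have U1: "(LBINT x. Re (k x) * \<Phi>1 ((norm x)\<^sup>2)) = (LBINT x. Re (k x) * (sin (t * norm x) / norm x * gauss a x))"
    if k: "has_fourier (\<lambda>x. of_real (w1 x)) k" for k
  proof -
    note [measurable] = mR[OF k]
    show ?thesis by (rule integral_cong_AE[OF _ _ A1]) measurable
  qed
  have "sqrt (pi / a) ^ 3 * (LBINT x. w t x * gauss (1 / (4 * a)) x) =
     (LBINT x. Re (of_real (cos (t * norm x)) * g0 x + of_real (sin (t * norm x) / norm x) * g1 x) * gauss a x)"
    using has_fourier_gauss(3)[OF gt a] by simp
  also have "\<dots> = (LBINT x. Re (g0 x) * (cos (t * norm x) * gauss a x) + Re (g1 x) * (sin (t * norm x) / norm x * gauss a x))"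
    by (intro Bochner_Integration.integral_cong refl) (simp add: algebra_simps)
  also have "\<dots> = (LBINT x. Re (g0 x) * (cos (t * norm x) * gauss a x)) + (LBINT x. Re (g1 x) * (sin (t * norm x) / norm x * gauss a x))"
    by (rule Bochner_Integration.integral_add[OF I0[OF g0] I1[OF g1]])
  also have "\<dots> = (LBINT x. Re (g x) * (cos (t * norm x) * gauss a x)) + (LBINT x. Re (h x) * (sin (t * norm x) / norm x * gauss a x))"
    using u0(1)[OF g0 g] u1(1)[OF g1 h] unfolding e0 U1[OF g1] U1[OF h] by simp
  also have "\<dots> = (LBINT x. Re (g x) * (cos (t * norm x) * gauss a x) + Re (h x) * (sin (t * norm x) / norm x * gauss a x))"
    by (rule Bochner_Integration.integral_add[OF I0[OF g] I1[OF h], symmetric])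
  also have "\<dots> = wave_smooth (\<lambda>x. Re (g x)) (\<lambda>x. Re (h x) / norm x) a t"
    unfolding wave_smooth_def by (intro Bochner_Integration.integral_cong refl) (simp add: algebra_simps)
  finally show "sqrt (pi / a) ^ 3 * (LBINT x. w t x * gauss (1 / (4 * a)) x)
           = wave_smooth (\<lambda>x. Re (g x)) (\<lambda>x. Re (h x) / norm x) a t" .
qed

section \<open>Gaussian pairings in the radial variable\<close>

lemma gauss_tail_integral:
  fixes c x :: real
  assumes c: "c > 0" and x: "x \<ge> 0"
  shows "(LBINT r. r * gauss c r * indicator {x..} r) = gauss c x / (2 * c)"
proof -
  let ?F = "\<lambda>r::real. - gauss c r / (2 * c)"
  have lim: "(?F \<longlongrightarrow> 0) at_top"
  proof -
    have "filterlim (\<lambda>r::real. c * r\<^sup>2) at_top at_top"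
      using c by (intro filterlim_tendsto_pos_mult_at_top[OF tendsto_const] filterlim_pow_at_top filterlim_ident) auto
    then have "((\<lambda>r. exp (- (c * r\<^sup>2))) \<longlongrightarrow> 0) at_top"
      by (intro filterlim_compose[OF exp_at_bot] filterlim_uminus_at_top[THEN iffD1]) (simp add: filterlim_uminus_at_bot)
    then have "((\<lambda>r. - exp (- (c * r\<^sup>2)) / (2 * c)) \<longlongrightarrow> - 0 / (2 * c)) at_top"
      by (intro tendsto_intros) (use c in auto)
    then show ?thesis by (simp add: gauss_def)
  qed
  have D: "(?F has_real_derivative r * gauss c r) (at r)" for r
    unfolding gauss_def real_norm_def power2_abs
    by (rule derivative_eq_intros refl | use c in \<open>simp add: field_simps\<close>)+
  have "(\<integral>\<^sup>+r. ennreal (r * gauss c r) * indicator {x..} r \<partial>lborel) = ennreal (0 - ?F x)"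
    by (rule nn_integral_FTC_atLeast[OF _ D _ lim]) (use x in \<open>auto intro!: mult_nonneg_nonneg less_imp_le[OF gauss_pos]\<close>)
  moreover have "(\<integral>\<^sup>+r. ennreal (r * gauss c r) * indicator {x..} r \<partial>lborel) = (\<integral>\<^sup>+r. ennreal (r * gauss c r * indicator {x..} r) \<partial>lborel)"
    by (intro nn_integral_cong) (simp add: indicator_def)
  ultimately have nn: "(\<integral>\<^sup>+r. ennreal (r * gauss c r * indicator {x..} r) \<partial>lborel) = ennreal (gauss c x / (2 * c))" by simp
  have "(LBINT r. r * gauss c r * indicator {x..} r) = enn2real (\<integral>\<^sup>+r. ennreal (r * gauss c r * indicator {x..} r) \<partial>lborel)"
  proof (rule integral_eq_nn_integral)
    have "0 \<le> r * gauss c r * indicator {x..} r" for r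
      using x by (auto simp: indicator_def intro!: mult_nonneg_nonneg less_imp_le[OF gauss_pos])
    then show "AE r in lborel. 0 \<le> r * gauss c r * indicator {x..} r" by simp
  qed measurable
  also have "\<dots> = gauss c x / (2 * c)"
    unfolding nn by (rule enn2real_ennreal) (use c gauss_pos[of c x] in simp)
  finally show ?thesis .
qed

lemma half_primitive_measurable:
  assumes [measurable]: "z \<in> borel_measurable borel"
  shows "half_primitive z \<in> borel_measurable borel"
proof -
  have "(\<lambda>p :: real \<times> real. z (snd p) * (if 0 < snd p \<and> snd p < fst p then 1 else 0)) \<in> borel_measurable (borel \<Otimes>\<^sub>M lborel)"
    by measurable
  moreover have "(\<lambda>p :: real \<times> real. z (snd p) * (if 0 < snd p \<and> snd p < fst p then 1 else 0)) =
      (\<lambda>(r, x). z x * indicator {0<..<r} x)" by (auto simp: fun_eq_iff indicator_def)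
  ultimately have "(\<lambda>(r, x). z x * indicator {0<..<r} x) \<in> borel_measurable (borel \<Otimes>\<^sub>M lborel)" by simp
  then show ?thesis
    unfolding half_primitive_def[abs_def] by (rule lborel.borel_measurable_lebesgue_integral)
qed

text \<open>Integration by parts through Fubini; the factor r makes the tail integral a Gaussian
  again. As z is integrable only against \<open>weight\<close>, G carries the inverse weight at r,
  which the Gaussian absorbs, and K is the quotient weight r / weight x, at most 1 because x <
  r.\<close>

lemma half_primitive_gauss:
  assumes z: "weighted z" and c: "c > 0"
  shows "(LBINT r. indicator {0<..} r * (half_primitive z r * (r * gauss c r))) =
      (LBINT x. indicator {0<..} x * (z x * gauss c x)) / (2 * c)" (is ?eq)
    and "integrable lborel (\<lambda>r. indicator {0<..} r * (half_primitive z r * (r * gauss c r)))" (is ?int)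
proof -
  note [measurable] = weighted_measurable[OF z]
  have sf: "sigma_finite_measure (lborel :: real measure)" by (rule lborel.sigma_finite_measure_axioms)
  define G where "G = (\<lambda>r::real. indicator {0<..} r * (r * gauss c r) / weight r)"
  have iG: "integrable lborel G"
  proof (rule Bochner_Integration.integrable_bound)
    \<comment> \<open>The exponent 3 comes from r (1 + r^2) <= (1 + r)^3; half of the Gaussian is
      spent on absorbing this factor.\<close>
    define C where "C = exp ((real 3)\<^sup>2 / (4 * (c / 2)))"
    have c2: "c / 2 > 0" using c by simp
    show "integrable lborel (\<lambda>r::real. C * gauss (c / 2) r)" using gauss_real_integral(1)[OF c2] by simp
    show "G \<in> borel_measurable lborel" unfolding G_def by measurable
    show "AE r in lborel. norm (G r) \<le> norm (C * gauss (c / 2) r)"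
    proof (rule AE_I2)
      fix r :: real
      show "norm (G r) \<le> norm (C * gauss (c / 2) r)"
      proof (cases "r > 0")
        case True
        have "G r = r * (1 + r\<^sup>2) * gauss c r" using True by (simp add: G_def weight_def divide_inverse)
        also have "\<dots> \<le> (1 + r) ^ 3 * gauss c r"
          using True by (intro mult_right_mono less_imp_le[OF gauss_pos]) (simp add: power3_eq_cube power2_eq_square algebra_simps)
        also have "\<dots> \<le> (C * exp (c / 2 * r\<^sup>2)) * gauss c r"
          unfolding C_def using True c2 by (intro mult_right_mono less_imp_le[OF gauss_pos] one_plus_power_le_exp) auto
        also have "\<dots> = C * gauss (c / 2) r" by (simp add: gauss_def mult.assoc flip: exp_add)
        finally have le: "G r \<le> C * gauss (c / 2) r" .
        have "G r \<ge> 0" unfolding G_def using True gauss_pos[of c r] weight_bounds(1)[of r] by simp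
        then show ?thesis using le by simp
      qed (simp add: G_def)
    qed
  qed
  have iz: "integrable lborel (\<lambda>x. weight x * z x)" using z by (simp add: weighted_def)
  define K where "K = (\<lambda>r x :: real. if 0 < x \<and> x < r then weight r / weight x else 0)"
  have Km: "(\<lambda>(r, x). K r x) \<in> borel_measurable (lborel \<Otimes>\<^sub>M lborel)" unfolding K_def by measurable
  have K1: "\<bar>K r x\<bar> \<le> 1" for r x
  proof (cases "0 < x \<and> x < r")
    case True
    then have "x\<^sup>2 \<le> r\<^sup>2" by (intro power_mono) auto
    then have "weight r \<le> weight x" unfolding weight_def by (intro le_imp_inverse_le) (auto simp: add_pos_nonneg)
    then show ?thesis using True weight_bounds(1)[of r] weight_bounds(1)[of x] by (simp add: K_def)
  qed (auto simp: K_def)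
  note sw = integral_swap_dominated[OF sf sf iG iz Km K1]
  have e: "indicator {0<..} r * (half_primitive z r * (r * gauss c r)) = G r * (LBINT x. (weight x * z x) * K r x)" for r
  proof -
    have "(\<lambda>x. (weight x * z x) * K r x) = (\<lambda>x. weight r * (z x * indicator {0<..<r} x))"
      using weight_bounds(1) by (auto simp: fun_eq_iff K_def indicator_def less_imp_neq[symmetric])
    then have "(LBINT x. (weight x * z x) * K r x) = weight r * half_primitive z r"
      unfolding half_primitive_def by simp
    then show ?thesis using weight_bounds(1)[of r] by (simp add: G_def)
  qed
  show ?int unfolding e by (rule sw(2))
  have "(LBINT r. indicator {0<..} r * (half_primitive z r * (r * gauss c r))) =
      (LBINT x. (weight x * z x) * (LBINT r. G r * K r x))"
    unfolding e by (rule sw(1))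
  also have "\<dots> = (LBINT x. indicator {0<..} x * (z x * gauss c x) / (2 * c))"
  proof (rule Bochner_Integration.integral_cong[OF refl])
    fix x :: real
    show "(weight x * z x) * (LBINT r. G r * K r x) = indicator {0<..} x * (z x * gauss c x) / (2 * c)"
    proof (cases "x > 0")
      case True
      have "(LBINT r. G r * K r x) = (LBINT r. (r * gauss c r * indicator {x..} r) / weight x)"
      proof (rule integral_cong_AE)
        show "AE r in lborel. G r * K r x = (r * gauss c r * indicator {x..} r) / weight x"
          using AE_lborel_singleton[of x]
        proof eventually_elim
          case (elim r)
          then show ?case using True weight_bounds(1)[of r] by (auto simp: G_def K_def indicator_def)
        qed
        show "(\<lambda>r. G r * K r x) \<in> borel_measurable lborel" unfolding G_def K_def by measurable
      qed measurable
      also have "\<dots> = gauss c x / (2 * c) / weight x"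
        using True c by (simp add: gauss_tail_integral)
      finally show ?thesis using True weight_bounds(1)[of x] by simp
    next
      case False
      then show ?thesis by (simp add: K_def)
    qed
  qed
  also have "\<dots> = (LBINT x. indicator {0<..} x * (z x * gauss c x)) / (2 * c)"
    by (rule integral_divide_zero)
  finally show ?eq .
qed

section \<open>Representation and exterior energy\<close>

lemma weighted_gauss_integrable:
  assumes z: "weighted z" and c: "c > 0"
  shows "integrable lborel (\<lambda>x. z x * gauss c x)"
proof (rule weighted_mult_integrable[OF z])
  fix x :: real
  have "gauss c x * (1 + x\<^sup>2) \<le> exp (2\<^sup>2 / (4 * c))"
  proof -
    have "1 + x\<^sup>2 \<le> (1 + \<bar>x\<bar>) ^ 2" by (simp add: power2_eq_square algebra_simps)
    also have "\<dots> \<le> exp ((real 2)\<^sup>2 / (4 * c)) * exp (c * \<bar>x\<bar>\<^sup>2)"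
      using c by (intro one_plus_power_le_exp) auto
    finally have "gauss c x * (1 + x\<^sup>2) \<le> gauss c x * (exp ((real 2)\<^sup>2 / (4 * c)) * exp (c * \<bar>x\<bar>\<^sup>2))"
      by (intro mult_left_mono less_imp_le[OF gauss_pos])
    also have "\<dots> = exp (2\<^sup>2 / (4 * c))" by (simp add: gauss_def exp_minus field_simps)
    finally show ?thesis .
  qed
  from mult_right_mono[OF this less_imp_le[OF weight_bounds(1)[of x]]]
  have "gauss c x * ((1 + x\<^sup>2) * weight x) \<le> exp (2\<^sup>2 / (4 * c)) * weight x" by (simp only: mult.assoc)
  moreover have "(1 + x\<^sup>2) * weight x = 1"
    using add_pos_nonneg[of 1 "x\<^sup>2"] by (simp add: weight_def)
  ultimately show "\<bar>gauss c x\<bar> \<le> exp (2\<^sup>2 / (4 * c)) * weight x"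
    using gauss_pos[of c x] by simp
qed measurable

text \<open>Nothing is known of v at negative arguments, where it need not be measurable.
  Restricting x to a line through the origin gives the even function v', measurable and equal to v
  for r >= 0.\<close>

lemma radial_gauss_pairing:
  fixes v :: "real \<Rightarrow> real"
  assumes i: "\<And>a. a > 0 \<Longrightarrow> integrable lborel (\<lambda>x::real^3. v (norm x) * gauss a x)"
  obtains v' where "v' \<in> borel_measurable borel" "\<And>r. r \<ge> 0 \<Longrightarrow> v' r = v r"
    "\<And>a. a > 0 \<Longrightarrow> integrable lborel (\<lambda>r. indicator {0<..} r * (r * v' r * (r * gauss a r)))"
    "\<And>a. a > 0 \<Longrightarrow> (LBINT x. v (norm (x::real^3)) * gauss a x) =
        4 * pi * (LBINT r. indicator {0<..} r * (r * v' r * (r * gauss a r)))"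
proof
  define e :: "real^3" where "e = axis 1 1"
  have ne: "norm e = 1" by (simp add: e_def norm_axis_1)
  define v' where "v' = (\<lambda>r. v (norm (r *\<^sub>R e)))"
  have m: "(\<lambda>x::real^3. v (norm x)) \<in> borel_measurable borel"
    using measurable_of_mult_gauss[OF i[OF zero_less_one]] .
  have "(\<lambda>r. r *\<^sub>R e) \<in> borel \<rightarrow>\<^sub>M borel" by measurable
  from measurable_compose[OF this m] show [measurable]: "v' \<in> borel_measurable borel" by (simp add: v'_def)
  show v': "v' r = v r" if "r \<ge> 0" for r using that by (simp add: v'_def ne)
  have eq: "v (norm x) * gauss a x = v' (norm x) * gauss a (norm x)" for x :: "real^3" and a
    by (simp add: v' gauss_norm)
  \<comment> \<open>Of the factor r^2 in the sphere area one r goes to v', forming r w, and the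
    other to the Gaussian.\<close>
  have s: "sphere_area r * (v' r * gauss a r) = 4 * pi * (indicator {0<..} r * (r * v' r * (r * gauss a r)))" for r a :: real
    by (simp add: sphere_area_def indicator_def power2_eq_square)
  have M: "(\<lambda>r::real. v' r * gauss a r) \<in> borel_measurable borel" for a by measurable
  show "integrable lborel (\<lambda>r. indicator {0<..} r * (r * v' r * (r * gauss a r)))" if "a > 0" for a
    using i[OF that] unfolding eq integrable_norm_iff[OF M] s by simp
  show "(LBINT x. v (norm (x::real^3)) * gauss a x) =
        4 * pi * (LBINT r. indicator {0<..} r * (r * v' r * (r * gauss a r)))" if "a > 0" for a
    unfolding eq integral_norm[OF M] s by simp
qed

text \<open>Laplace uniqueness is applied in the variable r^2.\<close>

lemma gauss_pairings_imp_test_pairings: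
  fixes V S :: "real \<Rightarrow> real"
  assumes [measurable]: "V \<in> borel_measurable borel" "S \<in> borel_measurable borel"
    and iV: "\<And>c. c > 0 \<Longrightarrow> integrable lborel (\<lambda>r. indicator {0<..} r * (V r * (r * gauss c r)))"
    and iS: "\<And>c. c > 0 \<Longrightarrow> integrable lborel (\<lambda>r. indicator {0<..} r * (S r * (r * gauss c r)))"
    and eq: "\<And>c. c > 0 \<Longrightarrow> (LBINT r. indicator {0<..} r * (V r * (r * gauss c r))) =
                (LBINT r. indicator {0<..} r * (S r * (r * gauss c r)))"
    and \<psi>: "continuous_on UNIV \<psi>" "\<And>r. r \<notin> {a..b} \<Longrightarrow> \<psi> r = 0" "\<And>r. \<bar>\<psi> r\<bar> \<le> C" and a: "0 < a" "a \<le> b"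
  shows "(LBINT r. V r * \<psi> r) = (LBINT r. S r * \<psi> r)"
proof -
  \<comment> \<open>Chosen so that r \<Phi>(r^2) = \<psi>(r) for r > 0. The maximum with a keeps the
    denominator away from 0 and is inactive on the support of \<psi>.\<close>
  define \<Phi> where "\<Phi> = (\<lambda>z. \<psi> (sqrt z) / max a (sqrt z))"
  have C: "C \<ge> 0" using \<psi>(3)[of 0] by simp
  have c\<Phi>: "continuous_on UNIV \<Phi>"
    unfolding \<Phi>_def by (intro continuous_intros continuous_on_compose2[OF \<psi>(1)]) (use a in auto)
  \<comment> \<open>On the support z <= b^2, so exp (b^2 - z) >= 1 and the exponential bound costs
    only a constant.\<close>
  have b\<Phi>: "\<bar>\<Phi> z\<bar> \<le> (C / a * exp (b\<^sup>2)) * exp (- (1 * z))" if z: "z \<ge> 0" for z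
  proof (cases "sqrt z \<in> {a..b}")
    case True
    then have "z \<le> b\<^sup>2" using z by (simp add: real_le_lsqrt sqrt_le_D)
    then have "1 \<le> exp (b\<^sup>2) * exp (- (1 * z))" by (simp flip: exp_add)
    moreover have "\<bar>\<Phi> z\<bar> \<le> C / a"
      unfolding \<Phi>_def abs_divide using \<psi>(3)[of "sqrt z"] a C by (intro frac_le) auto
    ultimately show ?thesis using C a mult_mono[of "\<bar>\<Phi> z\<bar>" "C / a" 1 "exp (b\<^sup>2) * exp (- (1 * z))"]
      by (simp add: mult.assoc)
  next
    case False
    then show ?thesis using C a \<psi>(2) by (simp add: \<Phi>_def)
  qed
  have \<Phi>\<psi>: "indicator {0<..} r * (T r * (r * \<Phi> (r\<^sup>2))) = T r * \<psi> r" for T :: "real \<Rightarrow> real" and r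
    using a \<psi>(2)[of r] by (cases "r \<in> {a..b}") (auto simp: \<Phi>_def indicator_def max_def)
  have g: "gauss c r = exp (- (c * r\<^sup>2))" for c r :: real by (simp add: gauss_def)
  have iT: "integrable lborel (\<lambda>r. T r * \<psi> r)"
    if [measurable]: "T \<in> borel_measurable borel" and T: "integrable lborel (\<lambda>r. indicator {0<..} r * (T r * (r * gauss 1 r)))" for T
  proof -
    have "integrable lborel (\<lambda>r. (indicator {0<..} r * (T r * r)) * \<Phi> (r\<^sup>2))"
      by (rule integrable_exp_dominated[OF _ _ _ _ c\<Phi> b\<Phi>]) (use T in \<open>auto simp: g mult.assoc\<close>)
    then show ?thesis by (simp add: mult.assoc \<Phi>\<psi>)
  qed
  have "(LBINT r. (indicator {0<..} r * ((V r - S r) * r)) * \<Phi> (r\<^sup>2)) = 0"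
  proof (rule laplace_unique[OF _ _ _ _ c\<Phi> zero_less_one b\<Phi>])
    fix c :: real assume c: "c > 0"
    have e: "indicator {0<..} r * ((V r - S r) * r) * exp (- (c * r\<^sup>2)) =
      indicator {0<..} r * (V r * (r * gauss c r)) - indicator {0<..} r * (S r * (r * gauss c r))" for r
      by (simp add: g algebra_simps)
    show "integrable lborel (\<lambda>r. indicator {0<..} r * ((V r - S r) * r) * exp (- (c * r\<^sup>2)))"
      unfolding e by (rule Bochner_Integration.integrable_diff[OF iV[OF c] iS[OF c]])
    show "(LBINT r. indicator {0<..} r * ((V r - S r) * r) * exp (- (c * r\<^sup>2))) = 0"
      unfolding e Bochner_Integration.integral_diff[OF iV[OF c] iS[OF c]] using eq[OF c] by simp
  qed auto
  moreover have "(indicator {0<..} r * ((V r - S r) * r)) * \<Phi> (r\<^sup>2) = V r * \<psi> r - S r * \<psi> r" for r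
  proof -
    have "(indicator {0<..} r * ((V r - S r) * r)) * \<Phi> (r\<^sup>2) =
        indicator {0<..} r * (V r * (r * \<Phi> (r\<^sup>2))) - indicator {0<..} r * (S r * (r * \<Phi> (r\<^sup>2)))"
      by (simp add: algebra_simps)
    then show ?thesis unfolding \<Phi>\<psi> .
  qed
  ultimately have "(LBINT r. V r * \<psi> r - S r * \<psi> r) = 0"
    by (simp only:)
  then show ?thesis
    using Bochner_Integration.integral_diff[OF iT iT] iV[OF zero_less_one] iS[OF zero_less_one] by simp
qed

text \<open>Both sides have the same pairings with r times a Gaussian: the left ones come from
  \<open>linear_wave_gauss\<close>, the right ones, folded to a convolution of f with a Gaussian at
  t, from \<open>wave_profile_exists\<close>, and each is a multiple of \<open>wave_smooth\<close>.
  \<open>gauss_pairings_imp_test_pairings\<close> then admits every test function.\<close>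

lemma radial_wave_profile:
  assumes s: "1 \<le> s" "s < 3 / 2"
    and h0: "in_hdot s (radial_fun u0)" and h1: "in_hdot (s - 1) (radial_fun u1)"
    and wave: "linear_wave (radial_fun u0) (radial_fun u1) (\<lambda>t. radial_fun (u t))"
  shows "\<exists>f. weighted f \<and> (\<forall>t \<psi>. test_fun \<psi> \<longrightarrow>
    (LBINT r. r * u t r * \<psi> r) = (LBINT r. half_primitive (\<lambda>x. f (t + x) + f (t - x)) r * \<psi> r))"
proof -
  obtain g where g: "has_fourier (\<lambda>x. of_real (radial_fun u0 x)) g"
    and ig: "integrable lborel (\<lambda>\<xi>. (norm \<xi> powr s * norm (g \<xi>))\<^sup>2)"
    using h0 unfolding in_hdot_def by blast
  obtain h where h: "has_fourier (\<lambda>x. of_real (radial_fun u1 x)) h"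
    and ih: "integrable lborel (\<lambda>\<xi>. (norm \<xi> powr (s - 1) * norm (h \<xi>))\<^sup>2)"
    using h1 unfolding in_hdot_def by blast
  define k0 where "k0 = (\<lambda>x. Re (g x))"
  \<comment> \<open>Division by |x| raises the order s - 1 of the second datum to s, so both data
    enter with one weight.\<close>
  define k1 where "k1 = (\<lambda>x. Re (h x) / norm x)"
  have [measurable]: "(\<lambda>x. Re (g x)) \<in> borel_measurable borel" "(\<lambda>x. Re (h x)) \<in> borel_measurable borel"
    using measurable_of_mult_gauss[of "\<lambda>x. Re (g x)" 1] integrable_Re[OF has_fourier_gauss(1)[OF g zero_less_one]]
      measurable_of_mult_gauss[of "\<lambda>x. Re (h x)" 1] integrable_Re[OF has_fourier_gauss(1)[OF h zero_less_one]]
    by simp_all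
  have m0: "k0 \<in> borel_measurable borel" and m1: "k1 \<in> borel_measurable borel"
    unfolding k0_def k1_def by measurable
  note [measurable] = m0 m1
  have i0: "integrable lborel (\<lambda>x. (norm x powr s * k0 x)\<^sup>2)"
  proof (rule Bochner_Integration.integrable_bound[OF ig])
    have "\<bar>norm x powr s * k0 x\<bar> \<le> \<bar>norm x powr s * norm (g x)\<bar>" for x
      using abs_Re_le_cmod[of "g x"] by (simp add: k0_def abs_mult mult_left_mono)
    then have "(norm x powr s * k0 x)\<^sup>2 \<le> (norm x powr s * norm (g x))\<^sup>2" for x
      by (rule abs_le_square_iff[THEN iffD1])
    then show "AE x in lborel. norm ((norm x powr s * k0 x)\<^sup>2) \<le> norm ((norm x powr s * norm (g x))\<^sup>2)"
      unfolding real_norm_def abs_power2 by (rule AE_I2)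
  qed measurable
  have i1: "integrable lborel (\<lambda>x. (norm x powr s * k1 x)\<^sup>2)"
  proof (rule Bochner_Integration.integrable_bound[OF ih])
    have "\<bar>norm x powr s * k1 x\<bar> \<le> \<bar>norm x powr (s - 1) * norm (h x)\<bar>" for x
    proof (cases "x = 0")
      case False
      have "norm x powr s * k1 x = norm x powr (s - 1) * Re (h x)"
        using False by (simp add: k1_def powr_diff)
      then show ?thesis
        using abs_Re_le_cmod[of "h x"] by (simp add: abs_mult mult_left_mono)
    qed (simp add: k1_def)
    then have "(norm x powr s * k1 x)\<^sup>2 \<le> (norm x powr (s - 1) * norm (h x))\<^sup>2" for x
      by (rule abs_le_square_iff[THEN iffD1])
    then show "AE x in lborel. norm ((norm x powr s * k1 x)\<^sup>2) \<le> norm ((norm x powr (s - 1) * norm (h x))\<^sup>2)"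
      unfolding real_norm_def abs_power2 by (rule AE_I2)
  qed measurable
  from wave_profile_exists[OF s m0 m1 i0 i1] obtain f0 where f0m: "f0 \<in> borel_measurable borel"
    and f0i: "integrable lborel (\<lambda>y. weight y * f0 y)"
    and f0': "\<forall>a>0. \<forall>t. (LBINT y. f0 y * gauss (1 / (4 * a)) (t - y)) = sqrt (4 * pi * a) * wave_smooth k0 k1 a t"
    by (elim exE conjE) (rule that)
  \<comment> \<open>The factor (2 pi)^(-3) of Fourier inversion times the 1/2 from writing sin (r
    \<rho>) cos (t \<rho>) as \<rho>/2 times the integral of cos (y \<rho>) over (t - r, t +
    r).\<close>
  define \<kappa> where "\<kappa> = 1 / (16 * pi ^ 3)"
  define f where "f = (\<lambda>x. \<kappa> * f0 x)"
  have f: "weighted f"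
    using f0m f0i unfolding weighted_def f_def by (auto simp: mult.left_commute)
  have "(LBINT r. r * u t r * \<psi> r) = (LBINT r. half_primitive (\<lambda>x. f (t + x) + f (t - x)) r * \<psi> r)"
    if \<psi>: "test_fun \<psi>" for t \<psi>
  proof -
    let ?z = "\<lambda>x. f (t + x) + f (t - x)"
    have z: "weighted ?z" by (intro weighted_add weighted_shift weighted_reflect f)
    have iw: "integrable lborel (\<lambda>x::real^3. u t (norm x) * gauss a x)" if "a > 0" for a
      using linear_wave_gauss(2)[OF wave g h that] .
    obtain v where vm [measurable]: "v \<in> borel_measurable borel" and v: "\<And>r. r \<ge> 0 \<Longrightarrow> v r = u t r"
      and iv: "\<And>a. a > 0 \<Longrightarrow> integrable lborel (\<lambda>r. indicator {0<..} r * (r * v r * (r * gauss a r)))"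
      and Iv: "\<And>a. a > 0 \<Longrightarrow> (LBINT x. u t (norm (x::real^3)) * gauss a x) =
        4 * pi * (LBINT r. indicator {0<..} r * (r * v r * (r * gauss a r)))"
      using radial_gauss_pairing[OF iw] by blast
    from \<psi> obtain a b C where a: "a > 0" "a \<le> b" and z0: "\<And>r. r \<notin> {a..b} \<Longrightarrow> \<psi> r = 0"
      and C: "\<And>r. \<bar>\<psi> r\<bar> \<le> C" and c: "continuous_on UNIV \<psi>" by (rule test_funE) (rule that)
    have "(LBINT r. (r * v r) * \<psi> r) = (LBINT r. half_primitive ?z r * \<psi> r)"
    proof (rule gauss_pairings_imp_test_pairings[OF _ _ iv half_primitive_gauss(2)[OF z] _ c z0 C a])
      show "half_primitive ?z \<in> borel_measurable borel"
        by (rule half_primitive_measurable[OF weighted_measurable[OF z]])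
      fix c :: real assume c: "c > 0"
      \<comment> \<open>A Gaussian of parameter c in space corresponds to the parameter 1/(4c) in
        frequency.\<close>
      define \<alpha> where "\<alpha> = 1 / (4 * c)"
      have \<alpha>: "\<alpha> > 0" "c = 1 / (4 * \<alpha>)" using c by (auto simp: \<alpha>_def)
      \<comment> \<open>With \<alpha> = A^2 and pi = P^2 the square roots disappear, and the
        comparison of constants becomes field arithmetic.\<close>
      define A where "A = sqrt \<alpha>"
      have A: "A > 0" "\<alpha> = A\<^sup>2" using \<alpha> by (auto simp: A_def)
      define P where "P = sqrt pi"
      have P: "P > 0" "pi = P\<^sup>2" by (auto simp: P_def)
      define I where "I = (LBINT r. indicator {0<..} r * (r * v r * (r * gauss c r)))"
      define N where "N = (LBINT y. f0 y * gauss c (t - y))"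
      have sq: "sqrt (pi / \<alpha>) = P / A" "sqrt (4 * pi * \<alpha>) = 2 * P * A"
        by (simp_all add: P_def A_def real_sqrt_divide real_sqrt_mult)
      have "(P / A) ^ 3 * (4 * pi * I) = wave_smooth k0 k1 \<alpha> t"
        using linear_wave_gauss(1)[OF wave g h \<alpha>(1), of t] Iv[OF c]
        unfolding sq k0_def k1_def I_def \<alpha>(2)[symmetric] by simp
      moreover have "N = 2 * P * A * wave_smooth k0 k1 \<alpha> t"
        using f0' \<alpha> unfolding N_def sq(2)[symmetric] by simp
      ultimately have NI: "N = 2 * P * A * ((P / A) ^ 3 * (4 * pi * I))" by simp
      have "(LBINT x. indicator {0<..} x * (?z x * gauss c x)) = \<kappa> * N"
      proof -
        have "(LBINT x. indicator {0<..} x * (?z x * gauss c x)) =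
           (LBINT x. indicator {0<..} x * (f (t + x) * gauss c x + f (t + - x) * gauss c (- x)))"
          by (simp add: gauss_def distrib_right)
        also have "\<dots> = (LBINT x. f (t + x) * gauss c x)"
          by (rule integral_reflect_halves[symmetric])
             (rule weighted_gauss_integrable[OF weighted_shift[OF f] c])
        also have "\<dots> = (LBINT x. f x * gauss c (x - t))" by (rule integral_shift_mult)
        also have "\<dots> = (LBINT x. \<kappa> * (f0 x * gauss c (t - x)))"
          by (simp add: f_def gauss_def power2_commute mult.assoc)
        finally show ?thesis unfolding N_def by simp
      qed
      then have "(LBINT r. indicator {0<..} r * (half_primitive ?z r * (r * gauss c r))) = \<kappa> * N / (2 * c)"
        by (simp only: half_primitive_gauss(1)[OF z c])
      also have "\<dots> = I"
        unfolding NI \<kappa>_def \<alpha>(2) A(2) P(2) using A(1) P(1)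
        by (simp add: field_simps power2_eq_square power3_eq_cube)
      finally show "(LBINT r. indicator {0<..} r * (r * v r * (r * gauss c r))) =
          (LBINT r. indicator {0<..} r * (half_primitive ?z r * (r * gauss c r)))"
        unfolding I_def by simp
    qed measurable
    moreover have "(\<lambda>r. (r * v r) * \<psi> r) = (\<lambda>r. r * u t r * \<psi> r)"
    proof
      fix r
      show "(r * v r) * \<psi> r = r * u t r * \<psi> r"
        using v[of r] z0[of r] a by (cases "r \<in> {a..b}") auto
    qed
    ultimately show ?thesis by (simp only:)
  qed
  then show ?thesis using f by blast
qed

section \<open>Identification of the weak derivatives\<close>

lemma test_fun_deriv: assumes "test_fun \<psi>" shows "test_fun (deriv \<psi>)"
proof -
  from assms obtain a b where "a > 0" "\<And>r. r \<notin> {a..b} \<Longrightarrow> deriv \<psi> r = 0" by (rule test_funE) (rule that)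
  moreover have "smooth (deriv \<psi>)" using assms by (intro smooth_deriv) (simp add: test_fun_def smooth_def)
  ultimately show ?thesis unfolding test_fun_def smooth_def by blast
qed

lemma loc_integrable_test_integrable:
  assumes z: "loc_integrable z" and \<psi>: "test_fun \<psi>"
  shows "integrable lborel (\<lambda>r. z r * \<psi> r)"
proof -
  from \<psi> obtain a b C where a: "a > 0" "a \<le> b" and z0: "\<And>r. r \<notin> {a..b} \<Longrightarrow> \<psi> r = 0"
    and C: "\<And>r. \<bar>\<psi> r\<bar> \<le> C" by (rule test_funE) (rule that)
  note [measurable] = test_fun_measurable[OF \<psi>]
  have i: "integrable lborel (\<lambda>r. indicator {a..b} r * z r)"
    using z a by (simp add: loc_integrable_def set_integrable_def)
  then have [measurable]: "(\<lambda>r. indicator {a..b} r * z r) \<in> borel_measurable borel" by auto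
  have "integrable lborel (\<lambda>r. (indicator {a..b} r * z r) * \<psi> r)"
  proof (rule Bochner_Integration.integrable_bound)
    show "integrable lborel (\<lambda>r. C * (indicator {a..b} r * z r))" using i by simp
    show "(\<lambda>r. (indicator {a..b} r * z r) * \<psi> r) \<in> borel_measurable lborel" by measurable
    show "AE r in lborel. norm ((indicator {a..b} r * z r) * \<psi> r) \<le> norm (C * (indicator {a..b} r * z r))"
    proof (rule AE_I2)
      fix r
      have "\<bar>indicator {a..b} r * z r\<bar> * \<bar>\<psi> r\<bar> \<le> \<bar>indicator {a..b} r * z r\<bar> * \<bar>C\<bar>"
        by (rule mult_left_mono[OF order_trans[OF C abs_ge_self] abs_ge_zero])
      then show "norm ((indicator {a..b} r * z r) * \<psi> r) \<le> norm (C * (indicator {a..b} r * z r))"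
        by (simp only: real_norm_def abs_mult mult_ac)
    qed
  qed
  moreover have "(\<lambda>r. (indicator {a..b} r * z r) * \<psi> r) = (\<lambda>r. z r * \<psi> r)"
    using z0 by (auto simp: fun_eq_iff indicator_def)
  ultimately show ?thesis by simp
qed

lemma loc_integrable_test_unique:
  assumes y: "loc_integrable y" and z: "loc_integrable z"
    and eq: "\<And>\<psi>. test_fun \<psi> \<Longrightarrow> (LBINT r. y r * \<psi> r) = (LBINT r. z r * \<psi> r)"
  shows "AE r in lborel. r > 0 \<longrightarrow> y r = z r"
proof -
  have "AE r in lborel. r > 0 \<longrightarrow> y r - z r = 0"
  proof (rule loc_integrable_test_zero)
    show "loc_integrable (\<lambda>r. y r - z r)"
      using y z by (auto simp: loc_integrable_def)
    show "(LBINT r. (y r - z r) * \<psi> r) = 0" if "test_fun \<psi>" for \<psi>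
      using eq[OF that] Bochner_Integration.integral_diff[OF loc_integrable_test_integrable[OF y that] loc_integrable_test_integrable[OF z that]]
      by (simp add: left_diff_distrib)
  qed
  then show ?thesis by simp
qed

text \<open>\<open>dist_dr\<close> and \<open>dist_dt\<close> are Hilbert choices, so their
  specifications become available only once a witness is exhibited. The profile provides it, and the
  fundamental lemma shows that the choice differs from it on a null set of r > 0 at most.\<close>

lemma radial_wave_dist_derivs:
  assumes f: "weighted f"
    and rep: "\<And>t \<psi>. test_fun \<psi> \<Longrightarrow> (LBINT r. U t r * \<psi> r) =
       (LBINT r. half_primitive (\<lambda>x. f (t + x) + f (t - x)) r * \<psi> r)"
  shows "AE r in lborel. r > 0 \<longrightarrow> dist_dr U t r = f (t + r) + f (t - r)"
    and "AE r in lborel. r > 0 \<longrightarrow> dist_dt U t r = f (t + r) - f (t - r)"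
proof -
  let ?z = "\<lambda>x. f (t + x) + f (t - x)" and ?v = "\<lambda>x. f (t + x) - f (t - x)"
  have z: "weighted ?z" and v: "weighted ?v"
    by (intro weighted_add weighted_diff weighted_shift weighted_reflect f)+
  have lz: "loc_integrable ?z" and lv: "loc_integrable ?v"
    using z v by (auto intro: weighted_loc_integrable)
  have wz: "(LBINT r. U t r * deriv \<psi> r) = - (LBINT r. ?z r * \<psi> r)" if "test_fun \<psi>" for \<psi>
    using rep[OF test_fun_deriv[OF that]] half_primitive_weak_deriv[OF z that] by simp
  have wv: "((\<lambda>\<tau>. LBINT r. U \<tau> r * \<psi> r) has_real_derivative (LBINT r. ?v r * \<psi> r)) (at t)"
    if "test_fun \<psi>" for \<psi>
    using half_primitive_time_deriv[OF f that, of t] unfolding rep[OF that] .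
  define Pr where "Pr = (\<lambda>z. loc_integrable z \<and> (\<forall>\<psi>. test_fun \<psi> \<longrightarrow>
           (LBINT r. U t r * deriv \<psi> r) = - (LBINT r. z r * \<psi> r)))"
  define Pt where "Pt = (\<lambda>v. loc_integrable v \<and> (\<forall>\<psi>. test_fun \<psi> \<longrightarrow>
           ((\<lambda>\<tau>. LBINT r. U \<tau> r * \<psi> r) has_real_derivative (LBINT r. v r * \<psi> r)) (at t)))"
  have "Pr ?z" unfolding Pr_def using lz wz by blast
  then have r: "Pr (dist_dr U t)" unfolding dist_dr_def Pr_def[symmetric] by (rule someI[of Pr])
  have "Pt ?v" unfolding Pt_def using lv wv by blast
  then have t: "Pt (dist_dt U t)" unfolding dist_dt_def Pt_def[symmetric] by (rule someI[of Pt])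
  show "AE r in lborel. r > 0 \<longrightarrow> dist_dr U t r = ?z r"
  proof (rule loc_integrable_test_unique[OF _ lz])
    show "loc_integrable (dist_dr U t)" using r by (simp add: Pr_def)
    show "(LBINT r. dist_dr U t r * \<psi> r) = (LBINT r. ?z r * \<psi> r)" if "test_fun \<psi>" for \<psi>
    proof -
      have "(LBINT r. U t r * deriv \<psi> r) = - (LBINT r. dist_dr U t r * \<psi> r)"
        using r that unfolding Pr_def by simp
      then show ?thesis using wz[OF that] by simp
    qed
  qed
  show "AE r in lborel. r > 0 \<longrightarrow> dist_dt U t r = ?v r"
  proof (rule loc_integrable_test_unique[OF _ lv])
    show "loc_integrable (dist_dt U t)" using t by (simp add: Pt_def)
    show "(LBINT r. dist_dt U t r * \<psi> r) = (LBINT r. ?v r * \<psi> r)" if "test_fun \<psi>" for \<psi>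
    proof -
      have "((\<lambda>\<tau>. LBINT r. U \<tau> r * \<psi> r) has_real_derivative (LBINT r. dist_dt U t r * \<psi> r)) (at t)"
        using t that unfolding Pt_def by simp
      then show ?thesis using wv[OF that] by (rule DERIV_unique)
    qed
  qed
qed

section \<open>Comparison of the energies\<close>

lemma powr_sum_diff_bounds:
  fixes p q m :: real
  assumes m: "m > 0"
  shows "\<bar>p\<bar> powr m \<le> \<bar>p - q\<bar> powr m + \<bar>p + q\<bar> powr m"
    and "\<bar>p - q\<bar> powr m + \<bar>p + q\<bar> powr m \<le> 2 powr (m + 1) * (\<bar>p\<bar> powr m + \<bar>q\<bar> powr m)"
proof -
  \<comment> \<open>p is the average of p - q and p + q.\<close>
  have "\<bar>p\<bar> \<le> \<bar>p - q\<bar> \<or> \<bar>p\<bar> \<le> \<bar>p + q\<bar>" by linarith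
  then have "\<bar>p\<bar> powr m \<le> \<bar>p - q\<bar> powr m \<or> \<bar>p\<bar> powr m \<le> \<bar>p + q\<bar> powr m"
    using m by (auto intro: powr_mono2)
  moreover have "\<bar>p - q\<bar> powr m \<ge> 0" "\<bar>p + q\<bar> powr m \<ge> 0" by simp_all
  ultimately show "\<bar>p\<bar> powr m \<le> \<bar>p - q\<bar> powr m + \<bar>p + q\<bar> powr m" by linarith
  have le: "\<bar>x\<bar> powr m \<le> 2 powr m * (\<bar>p\<bar> powr m + \<bar>q\<bar> powr m)" if "\<bar>x\<bar> \<le> \<bar>p\<bar> + \<bar>q\<bar>" for x
  proof -
    have "\<bar>x\<bar> \<le> 2 * max \<bar>p\<bar> \<bar>q\<bar>" using that by linarith
    then have "\<bar>x\<bar> powr m \<le> (2 * max \<bar>p\<bar> \<bar>q\<bar>) powr m" using m by (intro powr_mono2) auto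
    also have "\<dots> = 2 powr m * max \<bar>p\<bar> \<bar>q\<bar> powr m" by (simp add: powr_mult)
    also have "max \<bar>p\<bar> \<bar>q\<bar> powr m \<le> \<bar>p\<bar> powr m + \<bar>q\<bar> powr m" by (simp add: max_def)
    finally show ?thesis by (simp add: mult_left_mono)
  qed
  have "\<bar>p - q\<bar> powr m + \<bar>p + q\<bar> powr m \<le> 2 * (2 powr m * (\<bar>p\<bar> powr m + \<bar>q\<bar> powr m))"
    using le[of "p - q"] le[of "p + q"] by linarith
  then show "\<bar>p - q\<bar> powr m + \<bar>p + q\<bar> powr m \<le> 2 powr (m + 1) * (\<bar>p\<bar> powr m + \<bar>q\<bar> powr m)"
    by (simp add: powr_add mult_ac)
qed

theorem lemma3p7:
  fixes p m s :: real
  assumes "p > 5" and "m = (p - 1) / 2" and "s = 3 / 2 - 1 / m"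
  shows "\<exists>c::real. c > 0 \<and>
    (\<forall>(u0::real \<Rightarrow> real) (u1::real \<Rightarrow> real) (u::real \<Rightarrow> real \<Rightarrow> real) (R::real).
       in_hdot s (radial_fun u0) \<longrightarrow> in_hdot (s - 1) (radial_fun u1) \<longrightarrow>
       linear_wave (radial_fun u0) (radial_fun u1) (\<lambda>t. radial_fun (u t)) \<longrightarrow> R > 0 \<longrightarrow>
         (\<forall>t\<ge>0. ext_energy m R u t \<ge> ennreal c * ext_energy m R u 0) \<or>
         (\<forall>t\<le>0. ext_energy m R u t \<ge> ennreal c * ext_energy m R u 0))"
\<comment> \<open>The factor 2 powr (m + 1) is that of \<open>powr_sum_diff_bounds\<close>; one more
  2 comes from bounding the sum of the two parts by twice the larger one.\<close>
proof (intro exI[of _ "1 / 2 powr (m + 2)"] conjI allI impI)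
  have m: "m > 2" using assms by simp
  have "1 / m \<le> 1 / 2" "1 / m > 0" using m by (auto simp: field_simps)
  then have s: "1 \<le> s" "s < 3 / 2" using assms(3) by linarith+
  show "1 / 2 powr (m + 2) > (0::real)" by simp
  fix u0 u1 :: "real \<Rightarrow> real" and u :: "real \<Rightarrow> real \<Rightarrow> real" and R :: real
  assume h0: "in_hdot s (radial_fun u0)" and h1: "in_hdot (s - 1) (radial_fun u1)"
    and wave: "linear_wave (radial_fun u0) (radial_fun u1) (\<lambda>t. radial_fun (u t))" and R: "R > 0"
  from radial_wave_profile[OF s h0 h1 wave] obtain f where f: "weighted f"
    and rep': "\<forall>t \<psi>. test_fun \<psi> \<longrightarrow> (LBINT r. r * u t r * \<psi> r) =
       (LBINT r. half_primitive (\<lambda>x. f (t + x) + f (t - x)) r * \<psi> r)"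
    by (elim exE conjE) (rule that)
  note rep = rep'[rule_format]
  have [measurable]: "f \<in> borel_measurable borel" using f by (rule weighted_measurable)
  have D: "AE r in lborel. r > 0 \<longrightarrow> dist_dr (\<lambda>\<tau> \<rho>. \<rho> * u \<tau> \<rho>) t r = f (t + r) + f (t - r)"
    "AE r in lborel. r > 0 \<longrightarrow> dist_dt (\<lambda>\<tau> \<rho>. \<rho> * u \<tau> \<rho>) t r = f (t + r) - f (t - r)" for t
    by (rule radial_wave_dist_derivs[OF f]; rule rep; assumption)+
  define h where "h = (\<lambda>x. \<bar>f x\<bar> powr m)"
  have [measurable]: "h \<in> borel_measurable borel" unfolding h_def by measurable
  \<comment> \<open>Since R > 0, the range of integration lies in r > 0, where the weak derivatives
    are identified.\<close>
  have E: "ext_energy m R u t = (\<integral>\<^sup>+ r\<in>{R + \<bar>t\<bar><..}. ennreal (\<bar>f (t + r) - f (t - r)\<bar> powr m + \<bar>f (t + r) + f (t - r)\<bar> powr m) \<partial>lborel)" for t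
    unfolding ext_energy_def
  proof (rule nn_integral_cong_AE)
    show "AE r in lborel. ennreal (\<bar>dist_dt (\<lambda>\<tau> \<rho>. \<rho> * u \<tau> \<rho>) t r\<bar> powr m + \<bar>dist_dr (\<lambda>\<tau> \<rho>. \<rho> * u \<tau> \<rho>) t r\<bar> powr m) * indicator {R + \<bar>t\<bar><..} r =
       ennreal (\<bar>f (t + r) - f (t - r)\<bar> powr m + \<bar>f (t + r) + f (t - r)\<bar> powr m) * indicator {R + \<bar>t\<bar><..} r"
      using D(1)[of t] D(2)[of t]
    proof eventually_elim
      case (elim r)
      then show ?case using R by (cases "r > R + \<bar>t\<bar>") simp_all
    qed
  qed
  \<comment> \<open>\<open>Ip\<close> is the incoming and \<open>Im\<close> the outgoing part at
    time 0. Either may be infinite, so the estimates stay in \<open>ennreal\<close> and avoid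
    subtraction.\<close>
  define Ip where "Ip = (\<integral>\<^sup>+ x\<in>{R<..}. ennreal (h x) \<partial>lborel)"
  define Im where "Im = (\<integral>\<^sup>+ x\<in>{R<..}. ennreal (h (- x)) \<partial>lborel)"
  \<comment> \<open>For t >= 0 the substitution x = r - t carries r > R + t onto x > R: the outgoing
    part travels with the edge of the exterior region, so none of it is lost.\<close>
  have lower_Im: "Im \<le> ext_energy m R u t" if t: "t \<ge> 0" for t
  proof -
    have "Im = (\<integral>\<^sup>+ r. ennreal (h (t - r)) * indicator {R + \<bar>t\<bar><..} r \<partial>lborel)"
      unfolding Im_def
      by (subst nn_integral_real_affine[where c = 1 and t = "- t"])
         (use t in \<open>simp_all add: indicator_def algebra_simps\<close>)
    also have "\<dots> \<le> ext_energy m R u t"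
      unfolding E
    proof (intro nn_integral_mono mult_right_mono ennreal_leI)
      show "h (t - r) \<le> \<bar>f (t + r) - f (t - r)\<bar> powr m + \<bar>f (t + r) + f (t - r)\<bar> powr m" for r
        using powr_sum_diff_bounds(1)[of m "f (t - r)" "f (t + r)"] m
        by (simp add: h_def abs_minus_commute[of "f (t - r)"] add.commute[of "f (t - r)"])
    qed simp
    finally show ?thesis .
  qed
  \<comment> \<open>For t <= 0 the edge is R - t, and x = r + t plays the same role for the incoming
    part.\<close>
  have lower_Ip: "Ip \<le> ext_energy m R u t" if t: "t \<le> 0" for t
  proof -
    have "Ip = (\<integral>\<^sup>+ r. ennreal (h (t + r)) * indicator {R + \<bar>t\<bar><..} r \<partial>lborel)"
      unfolding Ip_def
      by (subst nn_integral_real_affine[where c = 1 and t = t])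
         (use t in \<open>simp_all add: indicator_def algebra_simps\<close>)
    also have "\<dots> \<le> ext_energy m R u t"
      unfolding E
    proof (intro nn_integral_mono mult_right_mono ennreal_leI)
      show "h (t + r) \<le> \<bar>f (t + r) - f (t - r)\<bar> powr m + \<bar>f (t + r) + f (t - r)\<bar> powr m" for r
        using powr_sum_diff_bounds(1)[of m "f (t + r)" "f (t - r)"] m by (simp add: h_def)
    qed simp
    finally show ?thesis .
  qed
  have upper: "ext_energy m R u 0 \<le> ennreal (2 powr (m + 1)) * (Ip + Im)"
  proof -
    have "ext_energy m R u 0 \<le> (\<integral>\<^sup>+ r. ennreal (2 powr (m + 1)) * (ennreal (h r) * indicator {R<..} r + ennreal (h (- r)) * indicator {R<..} r) \<partial>lborel)"
      unfolding E
    proof (rule nn_integral_mono)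
      fix r
      have le: "\<bar>f (0 + r) - f (0 - r)\<bar> powr m + \<bar>f (0 + r) + f (0 - r)\<bar> powr m \<le> 2 powr (m + 1) * (h r + h (- r))"
        using powr_sum_diff_bounds(2)[of m "f r" "f (- r)"] m by (simp add: h_def)
      have "ennreal (2 powr (m + 1) * (h r + h (- r))) = ennreal (2 powr (m + 1)) * (ennreal (h r) + ennreal (h (- r)))"
        by (subst ennreal_mult) (simp_all add: h_def)
      from ennreal_leI[OF le, unfolded this]
      show "ennreal (\<bar>f (0 + r) - f (0 - r)\<bar> powr m + \<bar>f (0 + r) + f (0 - r)\<bar> powr m) * indicator {R + \<bar>0\<bar><..} r
         \<le> ennreal (2 powr (m + 1)) * (ennreal (h r) * indicator {R<..} r + ennreal (h (- r)) * indicator {R<..} r)"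
        by (cases "r > R") simp_all
    qed
    also have "\<dots> = ennreal (2 powr (m + 1)) * (Ip + Im)"
      unfolding Ip_def Im_def by (subst nn_integral_cmult, simp, subst nn_integral_add) simp_all
    finally show ?thesis .
  qed
  have main: "ennreal (1 / 2 powr (m + 2)) * ext_energy m R u 0 \<le> J" if "Ip \<le> J" "Im \<le> J" for J
  proof -
    have "ext_energy m R u 0 \<le> ennreal (2 powr (m + 1)) * (J + J)"
      by (rule order_trans[OF upper mult_left_mono[OF add_mono[OF that]]]) simp
    also have "J + J = ennreal 2 * J" by (simp add: mult_2)
    also have "ennreal (2 powr (m + 1)) * (ennreal 2 * J) = (ennreal (2 powr (m + 1)) * ennreal 2) * J"
      by (rule mult.assoc[symmetric])
    also have "ennreal (2 powr (m + 1)) * ennreal 2 = ennreal (2 powr (m + 1) * 2)"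
      by (rule ennreal_mult[symmetric]) simp_all
    also have "2 powr (m + 1) * 2 = 2 powr (m + 2)" by (simp add: powr_add)
    finally have "ennreal (1 / 2 powr (m + 2)) * ext_energy m R u 0 \<le> ennreal (1 / 2 powr (m + 2)) * (ennreal (2 powr (m + 2)) * J)"
      by (rule mult_left_mono) simp
    also have "\<dots> = (ennreal (1 / 2 powr (m + 2)) * ennreal (2 powr (m + 2))) * J" by (rule mult.assoc[symmetric])
    also have "ennreal (1 / 2 powr (m + 2)) * ennreal (2 powr (m + 2)) = ennreal (1 / 2 powr (m + 2) * 2 powr (m + 2))"
      by (rule ennreal_mult[symmetric]) simp_all
    also have "\<dots> * J = J" by simp
    finally show ?thesis .
  qed
  show "(\<forall>t\<ge>0. ext_energy m R u t \<ge> ennreal (1 / 2 powr (m + 2)) * ext_energy m R u 0) \<or>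
        (\<forall>t\<le>0. ext_energy m R u t \<ge> ennreal (1 / 2 powr (m + 2)) * ext_energy m R u 0)"
  \<comment> \<open>Which part is larger at time 0 alone selects the direction of time, so the
    choice is uniform in t.\<close>
  proof (cases "Ip \<le> Im")
    case True
    show ?thesis by (intro disjI1 allI impI order_trans[OF main[OF True order_refl]] lower_Im)
  next
    case False
    then have "Im \<le> Ip" by simp
    then show ?thesis by (intro disjI2 allI impI order_trans[OF main[OF order_refl]] lower_Ip)
  qed
qed

end
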